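(* Let $\Omega\subset\mathbb{R}^d$ be a non-empty, bounded, open set and $\Phi\colon\mathbb{R}^N_+\to[0,\infty)$. Then $\mathscr{L}^{\Phi,N}_{1,1}(\Omega)\ge\Lambda^{\Phi,N}_{1,1}(\Omega)$. If $\Phi$ satisfies (Φ.3), then $\mathscr{L}^{\Phi,N}_{1,1}(\Omega)=\Lambda^{\Phi,N}_{1,1}(\Omega)$; moreover, if $u$ is a $(1,\Phi)$-eigen-$N$-function of $\Omega$ then $(\{u_1>0\},\dots,\{u_N>0\})$ is a $(1,\Phi)$-eigen-$N$-set of $\Omega$, and conversely, if $\mathcal E$ is a $(1,\Phi)$-eigen-$N$-set of $\Omega$, there exists a $(1,\Phi)$-eigen-$N$-function $u$ of $\Omega$ with $\{u_i>0\}\subset\mathcal E_i$ for all $i$.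
   Context: All sets are Lebesgue measurable; inclusions/disjointness up to null sets; $|E|$ Lebesgue measure, $P(E)$ perimeter. $h(F)=\inf\{P(E)/|E|: E\subset F, |E|>0\}$. An $N$-set of $F$ is $\mathcal E=(\mathcal E_1,\dots,\mathcal E_N)$ with $\mathcal E_i\subset F$, $|\mathcal E_i|>0$, $|\mathcal E_i\cap\mathcal E_j|=0$ for $i\ne j$. $\mathscr{L}^{\Phi,N}_{1,1}(F)=\inf\{\Phi(h(\mathcal E_1),\dots,h(\mathcal E_N)): \mathcal E \text{ an } N\text{-set of } F\}$; minimizers are $(1,\Phi)$-eigen-$N$-sets. $BV_0(F)=\{u\in BV(\mathbb{R}^d): u=0\text{ a.e. on }\mathbb{R}^d\setminus F\}$. A $(1,N)$-function of $F$ is $u=(u_1,\dots,u_N)$ with $u_i\in BV_0(F)$, $u_i\ge0$, $\|u_i\|_{L^1}=1$, $u_iu_j=0$ a.e. for $i\ne j$; $[u]_1=(|Du_1|(\mathbb{R}^d),\dots,|Du_N|(\mathbb{R}^d))$. $\Lambda^{\Phi,N}_{1,1}(F)=\inf\{\Phi([u]_1)\}$ over $(1,N)$-functions of $F$; minimizers are $(1,\Phi)$-eigen-$N$-functions. $\mathbb{R}^N_+$ has componentwise order; (Φ.3): $v\le w\Rightarrow\Phi(v)\le\Phi(w)$. *)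

theory Defs
  imports "HOL-Analysis.Analysis"
begin

definition test_fields :: "(('a::euclidean_space \<Rightarrow> 'a) \<times> ('a \<Rightarrow> 'a \<Rightarrow>\<^sub>L 'a)) set" where
  "test_fields = {(\<phi>, \<phi>'). (\<forall>x. (\<phi> has_derivative blinfun_apply (\<phi>' x)) (at x))
       \<and> continuous_on UNIV \<phi>'
       \<and> compact (closure {x. \<phi> x \<noteq> 0})
       \<and> (\<forall>x. norm (\<phi> x) \<le> 1)}"

definition divergence :: "('a::euclidean_space \<Rightarrow> 'a \<Rightarrow>\<^sub>L 'a) \<Rightarrow> 'a \<Rightarrow> real" where
  "divergence \<phi>' x = (\<Sum>b\<in>Basis. blinfun_apply (\<phi>' x) b \<bullet> b)"

definition total_variation :: "('a::euclidean_space \<Rightarrow> real) \<Rightarrow> ereal" where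
  "total_variation u =
     (SUP p \<in> test_fields. ereal (integral\<^sup>L lebesgue (\<lambda>x. u x * divergence (snd p) x)))"

definition perimeter :: "'a::euclidean_space set \<Rightarrow> ereal" where
  "perimeter E = total_variation (indicator E)"

definition cheeger :: "'a::euclidean_space set \<Rightarrow> ereal" where
  "cheeger F = (INF E \<in> {E. E \<in> sets lebesgue \<and> E - F \<in> null_sets lebesgue
                          \<and> 0 < emeasure lebesgue E}.
                  perimeter E / enn2ereal (emeasure lebesgue E))"

definition N_set :: "'a::euclidean_space set \<Rightarrow> ('n::finite \<Rightarrow> 'a set) \<Rightarrow> bool" where
  "N_set F E \<longleftrightarrow> (\<forall>i. E i \<in> sets lebesgue \<and> E i - F \<in> null_sets lebesgue
                        \<and> 0 < emeasure lebesgue (E i))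
               \<and> (\<forall>i j. i \<noteq> j \<longrightarrow> E i \<inter> E j \<in> null_sets lebesgue)"

definition h_vec :: "('n::finite \<Rightarrow> 'a::euclidean_space set) \<Rightarrow> real^'n" where
  "h_vec E = (\<chi> i. real_of_ereal (cheeger (E i)))"

text \<open>Only N-sets on which Phi is defined (all h(E_i) finite) are admissible.\<close>
definition L_eig :: "(real^'n::finite \<Rightarrow> real) \<Rightarrow> 'a::euclidean_space set \<Rightarrow> real" where
  "L_eig \<Phi> F = Inf {\<Phi> (h_vec E) | E. N_set F E \<and> (\<forall>i. cheeger (E i) < \<infinity>)}"

definition eigen_N_set :: "(real^'n::finite \<Rightarrow> real) \<Rightarrow> 'a::euclidean_space set \<Rightarrow> ('n \<Rightarrow> 'a set) \<Rightarrow> bool" where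
  "eigen_N_set \<Phi> F E \<longleftrightarrow> N_set F E \<and> (\<forall>i. cheeger (E i) < \<infinity>) \<and> \<Phi> (h_vec E) = L_eig \<Phi> F"

definition BV :: "('a::euclidean_space \<Rightarrow> real) set" where
  "BV = {u. integrable lebesgue u \<and> total_variation u < \<infinity>}"

definition BV0 :: "'a::euclidean_space set \<Rightarrow> ('a \<Rightarrow> real) set" where
  "BV0 F = {u \<in> BV. AE x in lebesgue. x \<notin> F \<longrightarrow> u x = 0}"

definition one_N_function :: "'a::euclidean_space set \<Rightarrow> ('n::finite \<Rightarrow> 'a \<Rightarrow> real) \<Rightarrow> bool" where
  "one_N_function F u \<longleftrightarrow>
     (\<forall>i. u i \<in> BV0 F \<and> (AE x in lebesgue. 0 \<le> u i x)
          \<and> integral\<^sup>L lebesgue (\<lambda>x. \<bar>u i x\<bar>) = 1)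
   \<and> (\<forall>i j. i \<noteq> j \<longrightarrow> (AE x in lebesgue. u i x * u j x = 0))"

definition tv_vec :: "('n::finite \<Rightarrow> 'a::euclidean_space \<Rightarrow> real) \<Rightarrow> real^'n" where
  "tv_vec u = (\<chi> i. real_of_ereal (total_variation (u i)))"

definition Lambda_eig :: "(real^'n::finite \<Rightarrow> real) \<Rightarrow> 'a::euclidean_space set \<Rightarrow> real" where
  "Lambda_eig \<Phi> F = Inf {\<Phi> (tv_vec u) | u. one_N_function F (u :: 'n \<Rightarrow> 'a \<Rightarrow> real)}"

definition eigen_N_function :: "(real^'n::finite \<Rightarrow> real) \<Rightarrow> 'a::euclidean_space set \<Rightarrow> ('n \<Rightarrow> 'a \<Rightarrow> real) \<Rightarrow> bool" where
  "eigen_N_function \<Phi> F u \<longleftrightarrow> one_N_function F u \<and> \<Phi> (tv_vec u) = Lambda_eig \<Phi> F"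

definition Phi3 :: "(real^'n::finite \<Rightarrow> real) \<Rightarrow> bool" where
  "Phi3 \<Phi> \<longleftrightarrow> (\<forall>v w. (\<forall>i. 0 \<le> v $ i) \<and> (\<forall>i. v $ i \<le> w $ i) \<longrightarrow> \<Phi> v \<le> \<Phi> w)"

end

theory Submission
  imports Defs
begin

text \<open>
  By the coarea inequality, the integral over \<open>t > 0\<close> of \<open>P({u > t})\<close> is at most \<open>|Du|\<close>, so
  \<open>h({u > 0}) \<le> |Du|\<close> for every non-negative \<open>u\<close> of unit mass: eigenfunctions give eigensets.
  Conversely, every \<open>E\<close> inside a bounded set with \<open>h(E)\<close> finite carries a non-negative function
  \<open>u\<close> of unit mass with \<open>|Du| = h(E)\<close>, so that the values of \<open>\<Phi>\<close> on the two sides agree.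

  The coarea inequality follows from smooth slices of mollifications of \<open>u\<close>, using Tonelli in
  \<open>(x, t)\<close> and Fatou in \<open>t\<close>. The function \<open>u\<close> is found without a compactness theorem: the
  \<open>g\<close> on \<open>E\<close> with \<open>0 \<le> g \<le> 1\<close> that are optimal up to an error form convex sets, decreasing with
  the error, and elements of almost minimal \<open>L\<^sup>2\<close> norm in these are Cauchy by the parallelogram law.
  A translation estimate keeps the measure of almost optimal sets away from zero.
\<close>

section \<open>Differentiation under the integral sign\<close>

text \<open>The inequality that holds for every \<open>\<Phi>\<close> leaves no room for
  approximation: \<open>\<Phi>\<close> is then neither monotone nor continuous, so each N-set must
  be matched by an N-function with exactly the same vector of values. Hence the infimum in the
  Cheeger constant has to be attained, at least by a function. Sets are a poor space for this,
  because averages of indicators are not indicators; functions with values in [0,1] can be averaged,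
  and total variation minus h(E) times the mass is convex on them. Two dangers remain. The zero
  function would meet all the other constraints, so a lower bound on the mass is carried along. And
  the limit might have total variation below h(E) times its mass; the coarea inequality excludes
  this, since its superlevel sets of positive measure compete in h(E). Competitors are Lebesgue sets
  known only up to null sets, whereas the analysis is done with Borel functions on
  \<open>lborel\<close>; representatives are chosen when the two problems are compared.\<close>

lemma distr_lborel_minus: "distr lborel borel (\<lambda>x. a - x) = (lborel :: 'a::euclidean_space measure)"
proof -
  have "(lborel :: 'a measure) = density (distr lborel borel (\<lambda>x. a + (-1) *\<^sub>R x)) (\<lambda>_. ennreal (\<bar>-1::real\<bar> ^ DIM('a)))"
    by (rule lborel_affine) simp
  also have "\<dots> = distr lborel borel (\<lambda>x. a - x)"
    by (simp add: density_1)
  finally show ?thesis by simp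
qed

lemma distr_lborel_plus': "distr lborel borel (\<lambda>x. x + a) = (lborel :: 'a::euclidean_space measure)"
proof -
  have "(\<lambda>x. x + a) = (+) a" by (simp add: fun_eq_iff add.commute)
  then show ?thesis by (simp add: lborel_distr_plus)
qed

lemma nn_integral_lborel_plus:
  fixes f :: "'a::euclidean_space \<Rightarrow> ennreal"
  assumes "f \<in> borel_measurable borel"
  shows "(\<integral>\<^sup>+x. f (x + a) \<partial>lborel) = (\<integral>\<^sup>+x. f x \<partial>lborel)"
  using nn_integral_distr[of "\<lambda>x. x + a" lborel borel f] assms by (simp add: distr_lborel_plus')

lemma integral_lborel_plus:
  fixes f :: "'a::euclidean_space \<Rightarrow> 'b::{banach, second_countable_topology}"
  assumes "f \<in> borel_measurable borel"
  shows "integral\<^sup>L lborel (\<lambda>x. f (x + a)) = integral\<^sup>L lborel f"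
  using integral_distr[of "\<lambda>x. x + a" lborel borel f] assms by (simp add: distr_lborel_plus')

lemma integrable_lborel_plus:
  fixes f :: "'a::euclidean_space \<Rightarrow> 'b::{banach, second_countable_topology}"
  assumes "integrable lborel f"
  shows "integrable lborel (\<lambda>x. f (x + a))"
  using integrable_distr_eq[of "\<lambda>x. x + a" lborel borel f] assms by (simp add: distr_lborel_plus')

lemma integrable_lborel_minus:
  fixes f :: "'a::euclidean_space \<Rightarrow> 'b::{banach, second_countable_topology}"
  assumes "integrable lborel f"
  shows "integrable lborel (\<lambda>x. f (a - x))"
  using integrable_distr_eq[of "\<lambda>x. a - x" lborel borel f] assms by (simp add: distr_lborel_minus)

section \<open>Functions with continuous gradient, and integrals of their translates\<close>

definition C1_grad :: "('a::euclidean_space \<Rightarrow> real) \<Rightarrow> ('a \<Rightarrow> 'a) \<Rightarrow> bool" where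
  "C1_grad f g \<longleftrightarrow> (\<forall>x. (f has_derivative (\<lambda>h. g x \<bullet> h)) (at x)) \<and> continuous_on UNIV g"

lemma C1_grad_continuous: "C1_grad f g \<Longrightarrow> continuous_on UNIV f" "C1_grad f g \<Longrightarrow> continuous_on UNIV g"
  unfolding C1_grad_def
  by (auto simp: continuous_on_eq_continuous_within intro: has_derivative_continuous)

lemma C1_grad_measurable:
  assumes "C1_grad f g" shows "f \<in> borel_measurable borel" "g \<in> borel_measurable borel"
  using C1_grad_continuous[OF assms] by (auto intro: borel_measurable_continuous_onI)

lemma C1_grad_Lipschitz:
  assumes "C1_grad f g" "\<And>x. norm (g x) \<le> B"
  shows "\<bar>f x - f y\<bar> \<le> B * norm (x - y)"
proof -
  have "norm (f x - f y) \<le> B * norm (x - y)"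
  proof (rule differentiable_bound[of UNIV f "\<lambda>x h. g x \<bullet> h"])
    show "onorm (\<lambda>h. g x \<bullet> h) \<le> B" for x
    proof (rule onorm_le)
      fix h
      have "norm (g x \<bullet> h) \<le> norm (g x) * norm h"
        by (simp add: Cauchy_Schwarz_ineq2)
      also have "\<dots> \<le> B * norm h"
        using assms(2) by (simp add: mult_right_mono)
      finally show "norm (g x \<bullet> h) \<le> B * norm h" .
    qed
  qed (use assms in \<open>auto simp: C1_grad_def\<close>)
  then show ?thesis by simp
qed

text \<open>The shift \<open>L x\<close> covers both convolution (\<open>L = uminus\<close>) and
  correlation (\<open>L\<close> the identity). Dominated convergence along sequences justifies the
  differentiation: the mean value inequality bounds the difference quotient of \<open>K\<close> by
  \<open>B\<close>, the linear term contributes another \<open>B\<close>, whence the majorant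
  \<open>\<bar>w x\<bar> * (2 * B)\<close>.\<close>

lemma C1_grad_integral:
  fixes w :: "'b \<Rightarrow> real" and K :: "'a::euclidean_space \<Rightarrow> real"
  assumes w: "integrable M w" and [measurable]: "L \<in> borel_measurable M"
    and K: "C1_grad K G" and KB: "\<And>x. \<bar>K x\<bar> \<le> A" and GB: "\<And>x. norm (G x) \<le> B"
  shows "C1_grad (\<lambda>y. \<integral>x. w x * K (y + L x) \<partial>M) (\<lambda>y. \<integral>x. w x *\<^sub>R G (y + L x) \<partial>M)"
proof -
  have [measurable]: "w \<in> borel_measurable M" "K \<in> borel_measurable borel" "G \<in> borel_measurable borel"
    using w C1_grad_measurable[OF K] by auto
  have iK: "integrable M (\<lambda>x. w x * K (y + L x))" for y
  proof (rule Bochner_Integration.integrable_bound[of M "\<lambda>x. w x * A"])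
    show "AE x in M. norm (w x * K (y + L x)) \<le> norm (w x * A)"
      using order_trans[OF KB abs_ge_self[of A]] by (intro AE_I2) (simp add: abs_mult mult_left_mono)
  qed (use w in simp_all)
  have iG: "integrable M (\<lambda>x. w x *\<^sub>R G (y + L x))" for y
  proof (rule Bochner_Integration.integrable_bound[of M "\<lambda>x. w x * B"])
    show "AE x in M. norm (w x *\<^sub>R G (y + L x)) \<le> norm (w x * B)"
      using order_trans[OF GB abs_ge_self[of B]] by (intro AE_I2) (simp add: abs_mult mult_left_mono)
  qed (use w in simp_all)
  have "continuous_on UNIV (\<lambda>y. \<integral>x. w x *\<^sub>R G (y + L x) \<partial>M)"
    unfolding continuous_on_sequentially
  proof (intro allI ballI impI, elim conjE)
    fix X :: "nat \<Rightarrow> 'a" and y assume X: "X \<longlonglongrightarrow> y"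
    have "(\<lambda>n. \<integral>x. w x *\<^sub>R G (X n + L x) \<partial>M) \<longlonglongrightarrow> (\<integral>x. w x *\<^sub>R G (y + L x) \<partial>M)"
    proof (rule integral_dominated_convergence[where w="\<lambda>x. \<bar>w x\<bar> * B"])
      have "isCont G p" for p using C1_grad_continuous(2)[OF K] by (simp add: continuous_on_eq_continuous_at)
      then show "AE x in M. (\<lambda>n. w x *\<^sub>R G (X n + L x)) \<longlonglongrightarrow> w x *\<^sub>R G (y + L x)"
        by (auto intro!: AE_I2 tendsto_intros isCont_tendsto_compose[of _ G] X)
    qed (use w GB in \<open>auto intro!: AE_I2 mult_left_mono\<close>)
    then show "((\<lambda>y. \<integral>x. w x *\<^sub>R G (y + L x) \<partial>M) \<circ> X) \<longlonglongrightarrow> (\<integral>x. w x *\<^sub>R G (y + L x) \<partial>M)"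
      by (simp add: o_def)
  qed
  moreover have "((\<lambda>y. \<integral>x. w x * K (y + L x) \<partial>M) has_derivative (\<lambda>h. (\<integral>x. w x *\<^sub>R G (y + L x) \<partial>M) \<bullet> h)) (at y)" for y
    unfolding has_derivative_at
  proof
    show "bounded_linear (\<lambda>h. (\<integral>x. w x *\<^sub>R G (y + L x) \<partial>M) \<bullet> h)"
      by (rule bounded_linear_inner_right)
    show "(\<lambda>h. norm ((\<integral>x. w x * K (y + h + L x) \<partial>M) - (\<integral>x. w x * K (y + L x) \<partial>M) -
        (\<integral>x. w x *\<^sub>R G (y + L x) \<partial>M) \<bullet> h) / norm h) \<midarrow>0\<rightarrow> 0"
      unfolding tendsto_at_iff_sequentially
    proof (intro allI impI)
      fix X :: "nat \<Rightarrow> 'a" assume X0: "\<forall>i. X i \<in> UNIV - {0}" and X: "X \<longlonglongrightarrow> 0"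
      let ?q = "\<lambda>n x. w x * ((K (y + L x + X n) - K (y + L x) - G (y + L x) \<bullet> X n) / norm (X n))"
      have eq: "((\<integral>x. w x * K (y + X n + L x) \<partial>M) - (\<integral>x. w x * K (y + L x) \<partial>M) -
        (\<integral>x. w x *\<^sub>R G (y + L x) \<partial>M) \<bullet> X n) / norm (X n) = (\<integral>x. ?q n x \<partial>M)" for n
      proof -
        have i3: "integrable M (\<lambda>x. w x * (G (y + L x) \<bullet> X n))"
          using integrable_inner_left[OF iG[of y], of "X n"] by auto
        have "(\<integral>x. ?q n x \<partial>M) = (\<integral>x. (w x * K (y + X n + L x) - w x * K (y + L x) - w x * (G (y + L x) \<bullet> X n)) / norm (X n) \<partial>M)"
          by (intro Bochner_Integration.integral_cong) (auto simp: algebra_simps)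
        also have "\<dots> = (\<integral>x. w x * K (y + X n + L x) - w x * K (y + L x) - w x * (G (y + L x) \<bullet> X n) \<partial>M) / norm (X n)"
          by simp
        also have "(\<integral>x. w x * K (y + X n + L x) - w x * K (y + L x) - w x * (G (y + L x) \<bullet> X n) \<partial>M) =
          (\<integral>x. w x * K (y + X n + L x) \<partial>M) - (\<integral>x. w x * K (y + L x) \<partial>M) - (\<integral>x. w x * (G (y + L x) \<bullet> X n) \<partial>M)"
          by (simp add: iK i3)
        also have "(\<integral>x. w x * (G (y + L x) \<bullet> X n) \<partial>M) = (\<integral>x. w x *\<^sub>R G (y + L x) \<partial>M) \<bullet> X n"
          using integral_inner_left[of "X n" M, OF iG[of y]] by simp
        finally show ?thesis by (rule sym)
      qed
      have "(\<lambda>n. \<integral>x. ?q n x \<partial>M) \<longlonglongrightarrow> (\<integral>x. 0 \<partial>M)"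
      proof (rule integral_dominated_convergence[where w="\<lambda>x. \<bar>w x\<bar> * (2 * B)"])
        show "AE x in M. (\<lambda>n. ?q n x) \<longlonglongrightarrow> 0"
        proof (rule AE_I2, rule tendsto_mult_right_zero)
          fix x
          have "(K has_derivative (\<lambda>h. G (y + L x) \<bullet> h)) (at (y + L x))"
            using K by (auto simp: C1_grad_def)
          then have "(\<lambda>h. norm (K (y + L x + h) - K (y + L x) - G (y + L x) \<bullet> h) / norm h) \<midarrow>0\<rightarrow> 0"
            unfolding has_derivative_at by blast
          then have "(\<lambda>n. norm (K (y + L x + X n) - K (y + L x) - G (y + L x) \<bullet> X n) / norm (X n)) \<longlonglongrightarrow> 0"
            using X X0 unfolding tendsto_at_iff_sequentially o_def by blast
          then show "(\<lambda>n. (K (y + L x + X n) - K (y + L x) - G (y + L x) \<bullet> X n) / norm (X n)) \<longlonglongrightarrow> 0"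
            by (intro tendsto_norm_zero_cancel[of "\<lambda>n. (K (y + L x + X n) - K (y + L x) - G (y + L x) \<bullet> X n) / norm (X n)"]) simp
        qed
        show "AE x in M. norm (?q n x) \<le> \<bar>w x\<bar> * (2 * B)" for n
        proof (rule AE_I2)
          fix x
          have "\<bar>K (y + L x + X n) - K (y + L x)\<bar> \<le> B * norm (X n)"
            using C1_grad_Lipschitz[OF K GB, of "y + L x + X n" "y + L x"] by simp
          moreover have "\<bar>G (y + L x) \<bullet> X n\<bar> \<le> B * norm (X n)"
            by (rule order_trans[OF Cauchy_Schwarz_ineq2]) (simp add: GB mult_right_mono)
          ultimately have "\<bar>K (y + L x + X n) - K (y + L x) - G (y + L x) \<bullet> X n\<bar> \<le> 2 * B * norm (X n)"
            by linarith
          moreover have "norm (X n) > 0" using X0 by auto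
          ultimately have "\<bar>(K (y + L x + X n) - K (y + L x) - G (y + L x) \<bullet> X n) / norm (X n)\<bar> \<le> 2 * B"
            by (simp add: divide_le_eq)
          then show "norm (?q n x) \<le> \<bar>w x\<bar> * (2 * B)"
            unfolding real_norm_def abs_mult by (rule mult_left_mono) simp
        qed
      qed (use w in auto)
      then have lim: "(\<lambda>n. \<bar>\<integral>x. ?q n x \<partial>M\<bar>) \<longlonglongrightarrow> 0"
        unfolding Bochner_Integration.integral_zero by (rule tendsto_rabs_zero)
      have eq': "norm ((\<integral>x. w x * K (y + X n + L x) \<partial>M) - (\<integral>x. w x * K (y + L x) \<partial>M) -
        (\<integral>x. w x *\<^sub>R G (y + L x) \<partial>M) \<bullet> X n) / norm (X n) = \<bar>\<integral>x. ?q n x \<partial>M\<bar>" for n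
        unfolding eq[symmetric] by simp
      show "((\<lambda>h. norm ((\<integral>x. w x * K (y + h + L x) \<partial>M) - (\<integral>x. w x * K (y + L x) \<partial>M) -
        (\<integral>x. w x *\<^sub>R G (y + L x) \<partial>M) \<bullet> h) / norm h) \<circ> X) \<longlonglongrightarrow> 0"
        unfolding o_def eq' by (rule lim)
    qed
  qed
  ultimately show ?thesis
    unfolding C1_grad_def by auto
qed

lemma continuous_vanishing_bounded:
  fixes f :: "'a::euclidean_space \<Rightarrow> 'b::real_normed_vector"
  assumes "continuous_on UNIV f" "\<And>x. R \<le> norm x \<Longrightarrow> f x = 0"
  obtains B where "\<And>x. norm (f x) \<le> B"
proof -
  have "compact (f ` cball 0 R)"
    by (rule compact_continuous_image[OF continuous_on_subset[OF assms(1)]]) auto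
  then obtain B where B: "\<And>x. x \<in> cball 0 R \<Longrightarrow> norm (f x) \<le> B"
    using compact_imp_bounded bounded_iff by (metis imageI)
  have "norm (f x) \<le> max 0 B" for x
  proof (cases "R \<le> norm x")
    case False
    then show ?thesis using B[of x] by simp
  qed (simp add: assms(2))
  then show thesis using that by blast
qed

text \<open>
  The integral of \<open>f (y + x)\<close> over \<open>x\<close> does not depend on \<open>y\<close>; differentiate it at \<open>y = 0\<close>.
\<close>

lemma integral_gradient_eq_0:
  fixes f :: "'a::euclidean_space \<Rightarrow> real"
  assumes f: "C1_grad f g" and supp: "\<And>x. R \<le> norm x \<Longrightarrow> f x = 0" "\<And>x. R \<le> norm x \<Longrightarrow> g x = 0"
  shows "integral\<^sup>L lborel g = 0"
proof -
  have [measurable]: "f \<in> borel_measurable borel" "g \<in> borel_measurable borel"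
    using C1_grad_measurable[OF f] by auto
  obtain A B where AB: "\<And>x. \<bar>f x\<bar> \<le> A" "\<And>x. norm (g x) \<le> B"
    using continuous_vanishing_bounded[OF C1_grad_continuous(1)[OF f] supp(1)]
      continuous_vanishing_bounded[OF C1_grad_continuous(2)[OF f] supp(2)]
    by (metis real_norm_def)
  \<comment> \<open>An integrable weight is required for differentiating under the integral. The
    radius exceeds \<open>R\<close> by one so that the weight does not cut into the support of
    \<open>f\<close> shifted by any \<open>y\<close> with norm below 1.\<close>
  define w :: "'a \<Rightarrow> real" where "w = indicator (ball 0 (R + 1))"
  have w: "integrable lborel w"
    unfolding w_def using emeasure_lborel_ball_finite[of "0::'a" "R + 1"] by (intro integrable_real_indicator) auto
  have C: "C1_grad (\<lambda>y. \<integral>x. w x * f (y + x) \<partial>lborel) (\<lambda>y. \<integral>x. w x *\<^sub>R g (y + x) \<partial>lborel)"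
    using C1_grad_integral[OF w _ f AB, of "\<lambda>x. x"] by simp
  have const: "(\<integral>x. w x * f (y + x) \<partial>lborel) = integral\<^sup>L lborel f" if "norm y < 1" for y
  proof -
    have "w x * f (y + x) = f (x + y)" for x
    proof (cases "norm x < R + 1")
      case False
      then have "R \<le> norm (x + y)"
        using that norm_diff_ineq[of x y] by linarith
      then show ?thesis using supp(1)[of "x + y"] by (simp add: add.commute[of y])
    qed (simp add: w_def add.commute[of y])
    then have "(\<integral>x. w x * f (y + x) \<partial>lborel) = (\<integral>x. f (x + y) \<partial>lborel)"
      by presburger
    then show ?thesis
      using integral_lborel_plus[of f y] by simp
  qed
  have "((\<lambda>y. \<integral>x. w x * f (y + x) \<partial>lborel) has_derivative (\<lambda>h. (\<integral>x. w x *\<^sub>R g (0 + x) \<partial>lborel) \<bullet> h)) (at 0)"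
    using C unfolding C1_grad_def by blast
  moreover have "((\<lambda>y. \<integral>x. w x * f (y + x) \<partial>lborel) has_derivative (\<lambda>h. 0)) (at 0)"
    by (rule has_derivative_transform_within_open[of "\<lambda>y. integral\<^sup>L lborel f" _ _ _ "ball 0 1"])
       (auto simp: const)
  ultimately have "(\<lambda>h. (\<integral>x. w x *\<^sub>R g (0 + x) \<partial>lborel) \<bullet> h) = (\<lambda>h. 0)"
    by (rule has_derivative_unique)
  then have "\<And>h. (\<integral>x. w x *\<^sub>R g (0 + x) \<partial>lborel) \<bullet> h = 0"
    by (rule fun_cong)
  then have "(\<integral>x. w x *\<^sub>R g (0 + x) \<partial>lborel) = 0"
    using inner_eq_zero_iff by blast
  moreover have "w x *\<^sub>R g (0 + x) = g x" for x
    using supp(2)[of x] by (auto simp: w_def indicator_def)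
  ultimately show ?thesis by simp
qed

section \<open>Test fields and total variation\<close>

lemma continuous_vanishing_integrable:
  fixes f :: "'a::euclidean_space \<Rightarrow> 'b::euclidean_space"
  assumes "continuous_on UNIV f" "\<And>x. R \<le> norm x \<Longrightarrow> f x = 0"
  shows "integrable lborel f"
proof -
  have "integrable lborel (\<lambda>x. indicator (cball 0 R) x *\<^sub>R f x)"
    by (rule borel_integrable_compact) (auto intro: continuous_on_subset[OF assms(1)])
  moreover have "indicator (cball 0 R) x *\<^sub>R f x = f x" for x
    using assms(2)[of x] by (auto simp: indicator_def)
  ultimately show ?thesis by simp
qed

text \<open>Squaring the positive part is the cheapest way to a kernel of class C^1, the regularity
  asked of test fields. An explicit formula also makes the symmetry visible.\<close>

definition bump :: "real \<Rightarrow> 'a::euclidean_space \<Rightarrow> real" where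
  "bump r x = (max 0 (r\<^sup>2 - x \<bullet> x))\<^sup>2"

lemma C1_grad_mult_left:
  assumes "C1_grad f g" shows "C1_grad (\<lambda>x. c * f x) (\<lambda>x. c *\<^sub>R g x)"
proof -
  have "((\<lambda>x. c * f x) has_derivative (\<lambda>h. (c *\<^sub>R g x) \<bullet> h)) (at x)" for x
    using has_derivative_mult_right[of f "\<lambda>h. g x \<bullet> h" "at x" c] assms by (simp add: C1_grad_def)
  then show ?thesis
    using assms by (auto simp: C1_grad_def intro!: continuous_on_scaleR[OF continuous_on_const])
qed

lemma DERIV_max_power2: "((\<lambda>s::real. (max 0 s)\<^sup>2) has_real_derivative 2 * max 0 s) (at s)"
proof (cases s "0::real" rule: linorder_cases)
  case less
  have "((\<lambda>s::real. 0) has_real_derivative 0) (at s)" by simp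
  then have "((\<lambda>s::real. (max 0 s)\<^sup>2) has_real_derivative 0) (at s)"
    by (rule has_field_derivative_transform_within[of _ _ _ _ "-s"]) (use less in \<open>auto simp: dist_real_def max_def\<close>)
  then show ?thesis using less by simp
next
  case equal
  have "((\<lambda>h::real. (max 0 h)\<^sup>2 / h) \<longlongrightarrow> 0) (at 0)"
  proof (rule Lim_null_comparison[of _ "\<lambda>h. \<bar>h\<bar>"])
    show "eventually (\<lambda>h::real. norm ((max 0 h)\<^sup>2 / h) \<le> \<bar>h\<bar>) (at 0)"
      by (intro always_eventually) (auto simp: max_def power2_eq_square)
    show "((\<lambda>h::real. \<bar>h\<bar>) \<longlongrightarrow> 0) (at 0)" by (auto intro!: tendsto_eq_intros)
  qed
  then show ?thesis using equal by (simp add: DERIV_def)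
next
  case greater
  have "((\<lambda>s::real. s\<^sup>2) has_real_derivative 2 * s) (at s)"
    by (auto intro!: derivative_eq_intros)
  then have "((\<lambda>s::real. (max 0 s)\<^sup>2) has_real_derivative 2 * s) (at s)"
    by (rule has_field_derivative_transform_within[of _ _ _ _ s]) (use greater in \<open>auto simp: dist_real_def max_def\<close>)
  then show ?thesis using greater by simp
qed

lemma bump_C1_grad:
  "C1_grad (bump r) (\<lambda>x::'a::euclidean_space. (- 4 * max 0 (r\<^sup>2 - x \<bullet> x)) *\<^sub>R x)"
  unfolding C1_grad_def
proof
  show "\<forall>x::'a. (bump r has_derivative (\<lambda>h. ((- 4 * max 0 (r\<^sup>2 - x \<bullet> x)) *\<^sub>R x) \<bullet> h)) (at x)"
  proof
    fix x :: 'a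
    have 1: "((\<lambda>x::'a. r\<^sup>2 - x \<bullet> x) has_derivative (\<lambda>h. - (2 * (x \<bullet> h)))) (at x)"
      by (auto intro!: derivative_eq_intros simp: inner_commute)
    have "((\<lambda>x::'a. (max 0 (r\<^sup>2 - x \<bullet> x))\<^sup>2) has_derivative (\<lambda>h. 2 * max 0 (r\<^sup>2 - x \<bullet> x) * (- (2 * (x \<bullet> h))))) (at x)"
      using has_derivative_compose[OF 1 DERIV_max_power2[unfolded has_field_derivative_def]] by simp
    then show "(bump r has_derivative (\<lambda>h. ((- 4 * max 0 (r\<^sup>2 - x \<bullet> x)) *\<^sub>R x) \<bullet> h)) (at x)"
      unfolding bump_def by (simp add: algebra_simps)
  qed
  show "continuous_on UNIV (\<lambda>x::'a. (- 4 * max 0 (r\<^sup>2 - x \<bullet> x)) *\<^sub>R x)"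
    by (intro continuous_intros)
qed

lemma bump_eq_0: "0 < r \<Longrightarrow> r \<le> norm x \<Longrightarrow> bump r x = 0"
  "0 < r \<Longrightarrow> r \<le> norm x \<Longrightarrow> max 0 (r\<^sup>2 - x \<bullet> x) = 0"
  by (auto simp: bump_def dot_square_norm max_def abs_le_square_iff[symmetric])

lemma bump_pos: "0 < r \<Longrightarrow> norm x < r \<Longrightarrow> 0 < bump r x"
proof -
  assume "0 < r" "norm x < r"
  then have "norm x ^ 2 < r ^ 2" by (intro power_strict_mono) auto
  then show ?thesis by (simp add: bump_def dot_square_norm max_def)
qed

lemma bump_nonneg: "0 \<le> bump r x"
  by (simp add: bump_def)

text \<open>The symmetries are exported for two purposes: evenness of \<open>K\<close> turns the
  convolution into an average over translates, and oddness of \<open>G\<close> supplies the sign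
  when the convolution is moved onto a test field.\<close>

lemma mollifier_exists:
  fixes r :: real
  assumes "0 < r"
  obtains K :: "'a::euclidean_space \<Rightarrow> real" and G where "C1_grad K G" "\<And>z. 0 \<le> K z"
    "\<And>z. K (- z) = K z" "\<And>z. G (- z) = - G z" "\<And>z. r \<le> norm z \<Longrightarrow> K z = 0" "\<And>z. r \<le> norm z \<Longrightarrow> G z = 0"
    "integrable lborel K" "integral\<^sup>L lborel K = 1"
proof -
  let ?b = "bump r :: 'a \<Rightarrow> real"
  let ?g = "\<lambda>x::'a. (- 4 * max 0 (r\<^sup>2 - x \<bullet> x)) *\<^sub>R x"
  define m where "m = integral\<^sup>L lborel ?b"
  have cont: "continuous_on UNIV ?b" using C1_grad_continuous[OF bump_C1_grad[of r]] by auto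
  have int: "integrable lborel ?b"
    by (rule continuous_vanishing_integrable[OF cont, of r]) (use assms bump_eq_0 in auto)
  have m: "0 < m"
  proof -
    have "m \<noteq> 0"
    proof
      assume "m = 0"
      then have "AE x in lborel. ?b x = 0"
        using integral_nonneg_eq_0_iff_AE[OF int] by (simp add: m_def bump_nonneg)
      then have "AE x in lborel. x \<notin> ball (0::'a) r"
        by (rule AE_mp) (use bump_pos[OF assms] in \<open>force intro!: AE_I2\<close>)
      then have "emeasure lborel (ball (0::'a) r) = 0"
        by (subst (asm) AE_iff_measurable[of "ball 0 r"]) auto
      then have "measure lborel (ball (0::'a) r) = 0" by (simp add: measure_def)
      then show False
        using content_ball_pos[OF assms, of "0::'a"] by simp
    qed
    moreover have "0 \<le> m" unfolding m_def by (simp add: bump_nonneg)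
    ultimately show ?thesis by simp
  qed
  show thesis
  proof (rule that[of "\<lambda>x. (1 / m) * ?b x" "\<lambda>x. (1 / m) *\<^sub>R ?g x"])
    show "C1_grad (\<lambda>x. (1 / m) * ?b x) (\<lambda>x. (1 / m) *\<^sub>R ?g x)"
      by (rule C1_grad_mult_left[OF bump_C1_grad])
    show "(1 / m) * bump r (- z) = (1 / m) * bump r z" for z :: 'a by (simp add: bump_def)
    show "integral\<^sup>L lborel (\<lambda>x. (1 / m) * ?b x) = 1" using m by (simp add: m_def)
    show "0 \<le> (1 / m) * ?b z" for z using m bump_nonneg[of r z] by simp
    show "(1 / m) * bump r z = 0" if "r \<le> norm z" for z :: 'a using bump_eq_0[OF assms that] by simp
    show "(1 / m) *\<^sub>R ?g z = 0" if "r \<le> norm z" for z :: 'a using bump_eq_0[OF assms that] by simp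
    show "integrable lborel (\<lambda>x. (1 / m) * ?b x)" using int by simp
  qed simp
qed

section \<open>Test fields, total variation and integration by parts\<close>

lemma test_fieldE:
  fixes p :: "('a::euclidean_space \<Rightarrow> 'a) \<times> ('a \<Rightarrow> 'a \<Rightarrow>\<^sub>L 'a)"
  assumes "p \<in> test_fields"
  obtains R B where "\<And>x. R \<le> norm x \<Longrightarrow> fst p x = 0" "\<And>x. R \<le> norm x \<Longrightarrow> snd p x = 0"
    "\<And>x. \<bar>divergence (snd p) x\<bar> \<le> B" "continuous_on UNIV (divergence (snd p))"
    "divergence (snd p) \<in> borel_measurable borel" "integrable lborel (divergence (snd p))"
proof -
  obtain \<phi> \<phi>' where p: "p = (\<phi>, \<phi>')" by (cases p)
  have D: "\<And>x. (\<phi> has_derivative blinfun_apply (\<phi>' x)) (at x)" and C: "continuous_on UNIV \<phi>'"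
    and S: "compact (closure {x. \<phi> x \<noteq> 0})"
    using assms unfolding p test_fields_def by auto
  obtain R where R: "\<And>x. x \<in> closure {x. \<phi> x \<noteq> 0} \<Longrightarrow> norm x \<le> R"
    using compact_imp_bounded[OF S] unfolding bounded_iff by auto
  \<comment> \<open>Adding one puts \<open>x\<close> into the open complement of the support, where
    the field vanishes on a neighbourhood and so does its derivative.\<close>
  have z: "\<phi> x = 0 \<and> \<phi>' x = 0" if "R + 1 \<le> norm x" for x
  proof -
    have out: "x \<in> - closure {x. \<phi> x \<noteq> 0}" using R[of x] that by auto
    then have "\<phi> x = 0" using closure_subset[of "{x. \<phi> x \<noteq> 0}"] by auto
    have "(\<phi> has_derivative (\<lambda>h. 0)) (at x)"
    proof (rule has_derivative_transform_within_open[of "\<lambda>y. 0" _ _ _ "- closure {x. \<phi> x \<noteq> 0}"])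
      show "0 = \<phi> y" if "y \<in> - closure {x. \<phi> x \<noteq> 0}" for y
        using that closure_subset[of "{x. \<phi> x \<noteq> 0}"] by auto
    qed (use out in \<open>auto intro: open_Compl\<close>)
    then have "blinfun_apply (\<phi>' x) = (\<lambda>h. 0)"
      by (rule has_derivative_unique[OF D])
    then have "\<phi>' x = 0" by (simp add: blinfun_eqI)
    then show ?thesis using \<open>\<phi> x = 0\<close> by simp
  qed
  have dc: "continuous_on UNIV (divergence \<phi>')"
    unfolding divergence_def[abs_def] by (intro continuous_intros C)
  have dz: "divergence \<phi>' x = 0" if "R + 1 \<le> norm x" for x
    using z[OF that] by (simp add: divergence_def)
  obtain B where "\<And>x. norm (divergence \<phi>' x) \<le> B"
    using continuous_vanishing_bounded[OF dc dz] by metis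
  then show thesis
    using that[of "R + 1" B] z dc dz borel_measurable_continuous_onI[OF dc]
      continuous_vanishing_integrable[OF dc dz]
    by (simp add: p)
qed

lemma test_field_apply:
  assumes "p \<in> test_fields"
  shows "(fst p has_derivative blinfun_apply (snd p x)) (at x)" "continuous_on UNIV (snd p)"
    "norm (fst p x) \<le> 1"
  using assms by (auto simp: test_fields_def)

lemma zero_test_field: "(\<lambda>x. 0, \<lambda>x. 0) \<in> test_fields"
  by (auto simp: test_fields_def zero_blinfun.rep_eq)

lemma total_variation_nonneg: "0 \<le> total_variation u"
  unfolding total_variation_def
  by (rule SUP_upper2[OF zero_test_field]) (simp add: divergence_def)

text \<open>Permits replacing a Lebesgue measurable function by a Borel representative.\<close>

lemma total_variation_cong_AE:
  assumes "u \<in> borel_measurable lebesgue" "v \<in> borel_measurable lebesgue" "AE x in lebesgue. u x = v x"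
  shows "total_variation u = total_variation v"
  unfolding total_variation_def
proof (rule SUP_cong[OF refl])
  fix p :: "('a \<Rightarrow> 'a) \<times> ('a \<Rightarrow> 'a \<Rightarrow>\<^sub>L 'a)" assume "p \<in> test_fields"
  then obtain R B where "divergence (snd p) \<in> borel_measurable borel" by (rule test_fieldE)
  then have [measurable]: "divergence (snd p) \<in> borel_measurable lebesgue"
    by (intro measurable_completion) simp
  show "ereal (LINT x|lebesgue. u x * divergence (snd p) x) = ereal (LINT x|lebesgue. v x * divergence (snd p) x)"
    using assms by (auto intro!: integral_cong_AE)
qed

text \<open>Total variation is defined by integrals over the completed measure, whereas translation
  invariance and Fubini are used on \<open>lborel\<close>; Borel functions can be moved between the
  two.\<close>

lemma integral_lebesgue_divergence:
  assumes "u \<in> borel_measurable borel" "p \<in> test_fields"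
  shows "(LINT x|lebesgue. u x * divergence (snd p) x) = (LINT x|lborel. u x * divergence (snd p) x)"
proof -
  obtain R B where "divergence (snd p) \<in> borel_measurable borel" using assms(2) by (rule test_fieldE)
  then show ?thesis using assms(1) by (intro integral_completion) simp
qed

lemma test_field_le_total_variation:
  assumes "u \<in> borel_measurable borel" "p \<in> test_fields"
  shows "ereal (LINT x|lborel. u x * divergence (snd p) x) \<le> total_variation u"
  unfolding total_variation_def integral_lebesgue_divergence[OF assms, symmetric]
  by (rule SUP_upper[OF assms(2)])

lemma total_variation_leI:
  assumes "u \<in> borel_measurable borel"
    and "\<And>p. p \<in> test_fields \<Longrightarrow> ereal (LINT x|lborel. u x * divergence (snd p) x) \<le> c"
  shows "total_variation u \<le> c"
  unfolding total_variation_def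
  by (rule SUP_least) (simp add: integral_lebesgue_divergence[OF assms(1)] assms(2))

lemma integrable_mult_divergence:
  assumes "integrable lborel u" "p \<in> test_fields"
  shows "integrable lborel (\<lambda>x. u x * divergence (snd p) x)"
proof -
  obtain B where [measurable]: "divergence (snd p) \<in> borel_measurable borel"
    and B: "\<And>x. \<bar>divergence (snd p) x\<bar> \<le> B"
    using test_fieldE[OF assms(2)] by metis
  show ?thesis
  proof (rule Bochner_Integration.integrable_bound[of lborel "\<lambda>x. u x * B"])
    show "AE x in lborel. norm (u x * divergence (snd p) x) \<le> norm (u x * B)"
      using order_trans[OF B abs_ge_self[of B]] by (intro AE_I2) (simp add: abs_mult mult_left_mono)
  qed (use assms(1) in simp_all)
qed

text \<open>Fields obtained by convolution come with one gradient per scalar component. These rows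
  are assembled into the bounded linear derivative that \<open>test_fields\<close> demands; the
  divergence is its trace.\<close>

lemma test_field_from_components:
  fixes \<phi> :: "'a::euclidean_space \<Rightarrow> 'a"
  assumes C: "\<And>b. b \<in> Basis \<Longrightarrow> C1_grad (\<lambda>x. \<phi> x \<bullet> b) (g b)"
    and n: "\<And>x. norm (\<phi> x) \<le> 1" and z: "\<And>x. R \<le> norm x \<Longrightarrow> \<phi> x = 0"
  obtains \<phi>' where "(\<phi>, \<phi>') \<in> test_fields" "\<And>x. divergence \<phi>' x = (\<Sum>b\<in>Basis. g b x \<bullet> b)"
proof -
  define \<phi>' where "\<phi>' x = Blinfun (\<lambda>h. \<Sum>b\<in>Basis. (g b x \<bullet> h) *\<^sub>R b)" for x
  have bl: "bounded_linear (\<lambda>h. \<Sum>b\<in>Basis. (g b x \<bullet> h) *\<^sub>R b)" for x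
    by (intro bounded_linear_sum bounded_linear_scaleR_const bounded_linear_inner_right)
  have ap: "blinfun_apply (\<phi>' x) = (\<lambda>h. \<Sum>b\<in>Basis. (g b x \<bullet> h) *\<^sub>R b)" for x
    unfolding \<phi>'_def by (rule bounded_linear_Blinfun_apply[OF bl])
  have "(\<phi> has_derivative blinfun_apply (\<phi>' x)) (at x)" for x
    using C unfolding has_derivative_componentwise_within[of \<phi> _ x UNIV] C1_grad_def ap
    by (simp add: inner_sum_left inner_Basis if_distrib cong: if_cong)
  moreover have "continuous_on UNIV \<phi>'"
    by (rule continuous_on_blinfun_componentwise)
       (use C in \<open>auto simp: ap C1_grad_def intro!: continuous_intros\<close>)
  moreover have "compact (closure {x. \<phi> x \<noteq> 0})"
  proof -
    have "x \<in> cball 0 R" if "\<phi> x \<noteq> 0" for x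
      using z[of x] that by (cases "R \<le> norm x") auto
    then have "{x. \<phi> x \<noteq> 0} \<subseteq> cball 0 R" by blast
    then show ?thesis
      by (meson bounded_cball bounded_closure bounded_subset closed_closure compact_eq_bounded_closed)
  qed
  ultimately have "(\<phi>, \<phi>') \<in> test_fields"
    using n by (simp add: test_fields_def)
  moreover have "divergence \<phi>' x = (\<Sum>b\<in>Basis. g b x \<bullet> b)" for x
    unfolding divergence_def ap
    by (rule sum.cong) (auto simp: inner_sum_left inner_Basis if_distrib cong: if_cong)
  ultimately show thesis by (rule that)
qed

text \<open>For each basis vector \<open>b\<close> the product of \<open>w\<close> with the
  component of the field along \<open>b\<close> has compact support, so its gradient integrates to
  zero. Adding up the \<open>b\<close>-th components of these gradients gives the identity.\<close>

lemma integration_by_parts: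
  fixes w :: "'a::euclidean_space \<Rightarrow> real"
  assumes w: "C1_grad w g" and p: "p \<in> test_fields"
  shows "(LINT x|lborel. w x * divergence (snd p) x) = - (LINT x|lborel. g x \<bullet> fst p x)"
proof -
  obtain R where R: "\<And>x. R \<le> norm x \<Longrightarrow> fst p x = 0" "\<And>x. R \<le> norm x \<Longrightarrow> snd p x = 0"
    and dc: "continuous_on UNIV (divergence (snd p))"
    using test_fieldE[OF p] by metis
  note tf = test_field_apply[OF p]
  have cw: "continuous_on UNIV w" "continuous_on UNIV g" using C1_grad_continuous[OF w] by auto
  have cp: "continuous_on UNIV (fst p)"
    using has_derivative_continuous[OF tf(1)] by (simp add: continuous_on_eq_continuous_within)
  \<comment> \<open>The gradient of the product of \<open>w\<close> and the \<open>b\<close>-th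
    component; the inner sum is the transposed derivative of the field applied to
    \<open>b\<close>.\<close>
  define H where "H b x = (fst p x \<bullet> b) *\<^sub>R g x + w x *\<^sub>R (\<Sum>c\<in>Basis. (blinfun_apply (snd p x) c \<bullet> b) *\<^sub>R c)" for b x
  have HC: "continuous_on UNIV (H b)" for b
    unfolding H_def[abs_def] by (intro continuous_intros cw cp tf(2))
  have HR: "H b x = 0" if "R \<le> norm x" for b x
    using R[OF that] by (simp add: H_def)
  have "integral\<^sup>L lborel (H b) = 0" for b
  proof (rule integral_gradient_eq_0[of "\<lambda>x. w x * (fst p x \<bullet> b)" _ R])
    have "((\<lambda>x. w x * (fst p x \<bullet> b)) has_derivative (\<lambda>h. H b x \<bullet> h)) (at x)" for x
    proof -
      have 1: "((\<lambda>x. w x * (fst p x \<bullet> b)) has_derivative (\<lambda>h. w x * (blinfun_apply (snd p x) h \<bullet> b) + (g x \<bullet> h) * (fst p x \<bullet> b))) (at x)"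
        using w tf(1) unfolding C1_grad_def by (auto intro!: derivative_eq_intros)
      have "(\<Sum>c\<in>Basis. (blinfun_apply (snd p x) c \<bullet> b) *\<^sub>R c) \<bullet> h = blinfun_apply (snd p x) h \<bullet> b" for h
      proof -
        have "blinfun_apply (snd p x) h \<bullet> b = blinfun_apply (snd p x) (\<Sum>c\<in>Basis. (h \<bullet> c) *\<^sub>R c) \<bullet> b"
          by (simp add: euclidean_representation)
        also have "\<dots> = (\<Sum>c\<in>Basis. (h \<bullet> c) * (blinfun_apply (snd p x) c \<bullet> b))"
          by (simp add: blinfun.sum_right blinfun.scaleR_right inner_sum_left)
        finally show ?thesis by (simp add: inner_sum_left inner_commute[of h] mult.commute)
      qed
      then have "(\<lambda>h. w x * (blinfun_apply (snd p x) h \<bullet> b) + (g x \<bullet> h) * (fst p x \<bullet> b)) = (\<lambda>h. H b x \<bullet> h)"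
        by (simp add: H_def inner_add_left fun_eq_iff)
      then show ?thesis using 1 by simp
    qed
    then show "C1_grad (\<lambda>x. w x * (fst p x \<bullet> b)) (H b)"
      using HC by (simp add: C1_grad_def)
  qed (use R HR in auto)
  moreover have Hi: "integrable lborel (H b)" for b
    by (rule continuous_vanishing_integrable[OF HC HR])
  ultimately have "(LINT x|lborel. H b x \<bullet> b) = 0" for b
    using integral_inner_left[of b lborel "H b"] by simp
  then have "0 = (\<Sum>b\<in>Basis. (LINT x|lborel. H b x \<bullet> b))" by simp
  also have "\<dots> = (LINT x|lborel. (\<Sum>b\<in>Basis. H b x \<bullet> b))"
    by (rule Bochner_Integration.integral_sum[symmetric]) (rule integrable_inner_left, rule Hi)
  also have "\<dots> = (LINT x|lborel. w x * divergence (snd p) x + g x \<bullet> fst p x)"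
  proof (rule Bochner_Integration.integral_cong[OF refl])
    fix x
    have "(\<Sum>b\<in>Basis. H b x \<bullet> b) = (\<Sum>b\<in>Basis. (g x \<bullet> b) * (fst p x \<bullet> b) + w x * (blinfun_apply (snd p x) b \<bullet> b))"
      by (rule sum.cong) (auto simp: H_def inner_add_left inner_sum_left inner_Basis if_distrib cong: if_cong)
    then show "(\<Sum>b\<in>Basis. H b x \<bullet> b) = w x * divergence (snd p) x + g x \<bullet> fst p x"
      by (simp add: sum.distrib divergence_def sum_distrib_left euclidean_inner[of "g x" "fst p x"])
  qed
  also have "\<dots> = (LINT x|lborel. w x * divergence (snd p) x) + (LINT x|lborel. g x \<bullet> fst p x)"
  proof (rule Bochner_Integration.integral_add)
    show "integrable lborel (\<lambda>x. w x * divergence (snd p) x)"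
      by (rule continuous_vanishing_integrable[where R=R, OF continuous_on_mult[OF cw(1) dc]])
         (simp add: R divergence_def)
    show "integrable lborel (\<lambda>x. g x \<bullet> fst p x)"
      by (rule continuous_vanishing_integrable[where R=R, OF continuous_on_inner[OF cw(2) cp]])
         (simp add: R)
  qed
  finally show ?thesis by simp
qed

section \<open>Mollification\<close>

lemma L1_translation_approx:
  fixes f :: "'a::euclidean_space \<Rightarrow> real"
  assumes f: "integrable lborel f" and Z: "Z \<longlonglongrightarrow> 0"
    and approx: "\<And>e. 0 < e \<Longrightarrow> \<exists>g. integrable lborel g \<and> (\<integral>x. \<bar>f x - g x\<bar> \<partial>lborel) < e \<and>
      (\<lambda>n. \<integral>x. \<bar>g (x + Z n) - g x\<bar> \<partial>lborel) \<longlonglongrightarrow> 0"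
  shows "(\<lambda>n. \<integral>x. \<bar>f (x + Z n) - f x\<bar> \<partial>lborel) \<longlonglongrightarrow> 0"
proof (rule LIMSEQ_I)
  fix e :: real assume "0 < e"
  \<comment> \<open>The error of \<open>g\<close> is paid twice, once translated and once in place:
    two quarters of \<open>e\<close>, leaving one half for the translation of \<open>g\<close>
    itself.\<close>
  then obtain g where g: "integrable lborel g" "(\<integral>x. \<bar>f x - g x\<bar> \<partial>lborel) < e / 4"
    "(\<lambda>n. \<integral>x. \<bar>g (x + Z n) - g x\<bar> \<partial>lborel) \<longlonglongrightarrow> 0"
    using approx[of "e / 4"] by auto
  obtain N where N: "\<And>n. N \<le> n \<Longrightarrow> \<bar>\<integral>x. \<bar>g (x + Z n) - g x\<bar> \<partial>lborel\<bar> < e / 2"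
    using LIMSEQ_D[OF g(3), of "e / 2"] \<open>0 < e\<close> by auto
  have "norm ((\<integral>x. \<bar>f (x + Z n) - f x\<bar> \<partial>lborel) - 0) < e" if n: "N \<le> n" for n
  proof -
    note i = f g(1) integrable_lborel_plus[OF f, of "Z n"] integrable_lborel_plus[OF g(1), of "Z n"]
    have "(\<integral>x. \<bar>f (x + Z n) - f x\<bar> \<partial>lborel)
        \<le> (\<integral>x. \<bar>f (x + Z n) - g (x + Z n)\<bar> + \<bar>g (x + Z n) - g x\<bar> + \<bar>f x - g x\<bar> \<partial>lborel)"
      using i by (intro integral_mono) auto
    also have "\<dots> = (\<integral>x. \<bar>f (x + Z n) - g (x + Z n)\<bar> \<partial>lborel) + (\<integral>x. \<bar>g (x + Z n) - g x\<bar> \<partial>lborel)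
        + (\<integral>x. \<bar>f x - g x\<bar> \<partial>lborel)"
      using i by simp
    also have "(\<integral>x. \<bar>f (x + Z n) - g (x + Z n)\<bar> \<partial>lborel) = (\<integral>x. \<bar>f x - g x\<bar> \<partial>lborel)"
      using integral_lborel_plus[of "\<lambda>x. \<bar>f x - g x\<bar>" "Z n"] f g(1) by simp
    finally show ?thesis using N[OF n] g(2) by simp
  qed
  then show "\<exists>N. \<forall>n\<ge>N. norm ((\<integral>x. \<bar>f (x + Z n) - f x\<bar> \<partial>lborel) - 0) < e" by blast
qed

text \<open>A translate has the same measure, so the symmetric difference has twice the measure of
  the part of \<open>U\<close> that is shifted out of \<open>U\<close>. For that part openness gives
  pointwise convergence at each point of \<open>U\<close>, and boundary points never have to be
  considered.\<close>

lemma L1_translation_open: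
  fixes U :: "'a::euclidean_space set"
  assumes U: "open U" "emeasure lborel U < \<infinity>" and Z: "Z \<longlonglongrightarrow> 0"
  shows "(\<lambda>n. \<integral>x. \<bar>indicat_real U (x + Z n) - indicator U x\<bar> \<partial>lborel) \<longlonglongrightarrow> 0"
proof -
  let ?I = "indicat_real U"
  have [measurable]: "U \<in> sets borel" using U by simp
  have i: "integrable lborel ?I" using U by (intro integrable_real_indicator) auto
  have ii: "integrable lborel (\<lambda>x. ?I x * (1 - ?I (x + Z n)))" for n
    by (rule Bochner_Integration.integrable_bound[OF i]) (auto simp: indicator_def)
  have "(\<integral>x. \<bar>?I (x + Z n) - ?I x\<bar> \<partial>lborel) = 2 * (\<integral>x. ?I x * (1 - ?I (x + Z n)) \<partial>lborel)" for n
  proof -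
    have "(\<integral>x. \<bar>?I (x + Z n) - ?I x\<bar> \<partial>lborel) = (\<integral>x. 2 * (?I x * (1 - ?I (x + Z n))) + (?I (x + Z n) - ?I x) \<partial>lborel)"
      by (rule Bochner_Integration.integral_cong) (auto simp: indicator_def)
    also have "\<dots> = 2 * (\<integral>x. ?I x * (1 - ?I (x + Z n)) \<partial>lborel) + ((\<integral>x. ?I (x + Z n) \<partial>lborel) - (\<integral>x. ?I x \<partial>lborel))"
      using ii i integrable_lborel_plus[OF i, of "Z n"] by simp
    finally show ?thesis using integral_lborel_plus[of ?I "Z n"] by simp
  qed
  moreover have "(\<lambda>n. \<integral>x. ?I x * (1 - ?I (x + Z n)) \<partial>lborel) \<longlonglongrightarrow> (LINT x|(lborel :: 'a measure). 0)"
  proof (rule integral_dominated_convergence[where w="?I"])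
    show "AE x in lborel. (\<lambda>n. ?I x * (1 - ?I (x + Z n))) \<longlonglongrightarrow> 0"
    proof (rule AE_I2)
      fix x
      show "(\<lambda>n. ?I x * (1 - ?I (x + Z n))) \<longlonglongrightarrow> 0"
      proof (cases "x \<in> U")
        case True
        have "(\<lambda>n. x + Z n) \<longlonglongrightarrow> x" using tendsto_add[OF tendsto_const Z, of x] by simp
        then have "eventually (\<lambda>n. x + Z n \<in> U) sequentially"
          using U(1) True by (rule topological_tendstoD)
        then have "eventually (\<lambda>n. ?I x * (1 - ?I (x + Z n)) = 0) sequentially"
          by (rule eventually_mono) simp
        then show ?thesis by (rule tendsto_eventually)
      qed simp
    qed
  qed (use i in \<open>auto simp: indicator_def\<close>)
  ultimately show ?thesis by (auto intro: tendsto_mult_right_zero)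
qed

text \<open>Induction from indicators over sums to limits. Outer regularity reduces indicators to
  open sets, which take the place that continuous functions have in the usual density
  argument.\<close>

lemma L1_translation_continuous:
  fixes f :: "'a::euclidean_space \<Rightarrow> real"
  assumes "integrable lborel f" "Z \<longlonglongrightarrow> 0"
  shows "(\<lambda>n. \<integral>x. \<bar>f (x + Z n) - f x\<bar> \<partial>lborel) \<longlonglongrightarrow> 0"
  using assms(1)
proof (induction rule: integrable_induct)
  case (base A c)
  have A: "A \<in> sets borel" using base by simp
  have iA: "integrable lborel (indicat_real A)" using base by (intro integrable_real_indicator) auto
  have "(\<lambda>n. \<integral>x. \<bar>indicat_real A (x + Z n) - indicator A x\<bar> \<partial>lborel) \<longlonglongrightarrow> 0"
  proof (rule L1_translation_approx[OF iA assms(2)])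
    fix e :: real assume e: "0 < e"
    obtain U where U: "open U" "A \<subseteq> U" "emeasure lborel (U - A) < ennreal e"
      using outer_regular_lborel[OF A, of e] e by (auto simp: ennreal_less_zero_iff)
    have US: "U \<in> sets borel" using U by simp
    have "emeasure lborel U \<le> emeasure lborel A + emeasure lborel (U - A)"
      using U(2) A US emeasure_subadditive[of A lborel "U - A"] by (simp add: Un_absorb1)
    also have "\<dots> < \<infinity>" using base U(3) by (auto simp: ennreal_add_eq_top less_top order.strict_trans)
    finally have Uf: "emeasure lborel U < \<infinity>" .
    have "(\<integral>x. \<bar>indicat_real A x - indicator U x\<bar> \<partial>lborel) = (\<integral>x. indicat_real (U - A) x \<partial>lborel)"
      using U(2) by (intro Bochner_Integration.integral_cong) (auto simp: indicator_def)
    also have "\<dots> = measure lborel (U - A)" using A US by simp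
    also have "\<dots> < e"
      using U(3) e by (simp add: measure_def enn2real_less_iff order.strict_trans[OF U(3) ennreal_less_top])
    finally show "\<exists>g. integrable lborel g \<and> (\<integral>x. \<bar>indicat_real A x - g x\<bar> \<partial>lborel) < e \<and>
      (\<lambda>n. \<integral>x. \<bar>g (x + Z n) - g x\<bar> \<partial>lborel) \<longlonglongrightarrow> 0"
      using L1_translation_open[OF U(1) Uf assms(2)] US Uf
      by (intro exI[of _ "indicator U"]) (auto intro!: integrable_real_indicator)
  qed
  then have "(\<lambda>n. \<bar>c\<bar> * (\<integral>x. \<bar>indicat_real A (x + Z n) - indicator A x\<bar> \<partial>lborel)) \<longlonglongrightarrow> 0"
    by (rule tendsto_mult_right_zero)
  then show ?case
    by (simp add: abs_mult left_diff_distrib[symmetric] mult.commute[of _ "\<bar>c\<bar>"])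
next
  case (add f g)
  have "(\<lambda>n. (\<integral>x. \<bar>f (x + Z n) - f x\<bar> \<partial>lborel) + (\<integral>x. \<bar>g (x + Z n) - g x\<bar> \<partial>lborel)) \<longlonglongrightarrow> 0"
    using tendsto_add[OF add.IH] by simp
  then show ?case
  proof (rule tendsto_0_le[where K=1], intro always_eventually allI)
    fix n
    note i = add.hyps integrable_lborel_plus[OF add.hyps(1), of "Z n"] integrable_lborel_plus[OF add.hyps(2), of "Z n"]
    have "(\<integral>x. \<bar>f (x + Z n) + g (x + Z n) - (f x + g x)\<bar> \<partial>lborel)
      \<le> (\<integral>x. \<bar>f (x + Z n) - f x\<bar> + \<bar>g (x + Z n) - g x\<bar> \<partial>lborel)"
      using i by (intro integral_mono) auto
    also have "\<dots> = (\<integral>x. \<bar>f (x + Z n) - f x\<bar> \<partial>lborel) + (\<integral>x. \<bar>g (x + Z n) - g x\<bar> \<partial>lborel)"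
      using i by simp
    finally show "norm (\<integral>x. \<bar>f (x + Z n) + g (x + Z n) - (f x + g x)\<bar> \<partial>lborel)
      \<le> norm ((\<integral>x. \<bar>f (x + Z n) - f x\<bar> \<partial>lborel) + (\<integral>x. \<bar>g (x + Z n) - g x\<bar> \<partial>lborel)) * 1"
      by simp
  qed
next
  case (lim f s)
  show ?case
  proof (rule L1_translation_approx[OF lim.hyps(4) assms(2)])
    fix e :: real assume e: "0 < e"
    have "(\<lambda>i. \<integral>x. \<bar>f x - s i x\<bar> \<partial>lborel) \<longlonglongrightarrow> (LINT x|(lborel :: 'a measure). 0)"
    \<comment> \<open>The functions \<open>s i\<close> supplied by the induction rule satisfy
      \<open>\<bar>s i x\<bar> \<le> 2 * \<bar>f x\<bar>\<close>, hence the factor 3.\<close>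
    proof (rule integral_dominated_convergence[where w="\<lambda>x. 3 * \<bar>f x\<bar>"])
      show "AE x in lborel. (\<lambda>i. \<bar>f x - s i x\<bar>) \<longlonglongrightarrow> 0"
      proof (rule AE_I2)
        fix x
        have "(\<lambda>i. f x - s i x) \<longlonglongrightarrow> f x - f x"
          by (intro tendsto_diff tendsto_const lim.hyps(2)) simp
        then show "(\<lambda>i. \<bar>f x - s i x\<bar>) \<longlonglongrightarrow> 0" by (simp add: tendsto_rabs_zero_iff)
      qed
      show "AE x in lborel. norm \<bar>f x - s i x\<bar> \<le> 3 * \<bar>f x\<bar>" for i
      proof (rule AE_I2)
        fix x
        show "norm \<bar>f x - s i x\<bar> \<le> 3 * \<bar>f x\<bar>" using lim.hyps(3)[of x i] by simp
      qed
    qed (use lim.hyps(1,4) in auto)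
    then obtain i where "\<bar>\<integral>x. \<bar>f x - s i x\<bar> \<partial>lborel\<bar> < e"
      using LIMSEQ_D[of _ 0 e] e by fastforce
    then show "\<exists>g. integrable lborel g \<and> (\<integral>x. \<bar>f x - g x\<bar> \<partial>lborel) < e \<and>
      (\<lambda>n. \<integral>x. \<bar>g (x + Z n) - g x\<bar> \<partial>lborel) \<longlonglongrightarrow> 0"
      using lim.hyps(1) lim.IH by (intro exI[of _ "s i"]) auto
  qed
qed

section \<open>Convolution with a mollifying kernel\<close>

locale mollifier =
  fixes K :: "'a::euclidean_space \<Rightarrow> real" and G :: "'a \<Rightarrow> 'a" and r :: real
  assumes K_C1: "C1_grad K G" and K_nonneg: "\<And>z. 0 \<le> K z"
    and K_even: "\<And>z. K (- z) = K z" and G_odd: "\<And>z. G (- z) = - G z"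
    and K_0: "\<And>z. r \<le> norm z \<Longrightarrow> K z = 0" and G_0: "\<And>z. r \<le> norm z \<Longrightarrow> G z = 0"
    and K_integrable: "integrable lborel K" and K_integral: "integral\<^sup>L lborel K = 1"
begin

definition conv :: "('a \<Rightarrow> real) \<Rightarrow> 'a \<Rightarrow> real" where
  "conv u x = (\<integral>y. u y * K (x - y) \<partial>lborel)"

definition conv_grad :: "('a \<Rightarrow> real) \<Rightarrow> 'a \<Rightarrow> 'a" where
  "conv_grad u x = (\<integral>y. u y *\<^sub>R G (x - y) \<partial>lborel)"

lemma K_measurable [measurable]: "K \<in> borel_measurable borel" "G \<in> borel_measurable borel"
  using C1_grad_measurable[OF K_C1] by auto

lemma bounded_KG: obtains B where "\<And>z. \<bar>K z\<bar> \<le> B" "\<And>z. norm (G z) \<le> B" "0 \<le> B"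
proof -
  obtain B1 where B1: "\<And>z. norm (K z) \<le> B1"
    using continuous_vanishing_bounded[OF C1_grad_continuous(1)[OF K_C1] K_0] by metis
  obtain B2 where B2: "\<And>z. norm (G z) \<le> B2"
    using continuous_vanishing_bounded[OF C1_grad_continuous(2)[OF K_C1] G_0] by metis
  show thesis
    using that[of "max B1 B2"] B1 B2 order_trans[OF norm_ge_zero B1] by (auto simp: le_max_iff_disj)
qed

lemma conv_C1_grad: "integrable lborel u \<Longrightarrow> C1_grad (conv u) (conv_grad u)"
proof -
  assume u: "integrable lborel u"
  obtain B where B: "\<And>z. \<bar>K z\<bar> \<le> B" "\<And>z. norm (G z) \<le> B" using bounded_KG by metis
  show ?thesis
    using C1_grad_integral[OF u _ K_C1 B, of uminus]
    by (simp add: conv_def[abs_def] conv_grad_def[abs_def])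
qed

lemma conv_eq_0:
  assumes "\<And>x. R \<le> norm x \<Longrightarrow> u x = 0" "R + r \<le> norm x"
  shows "conv u x = 0" "conv_grad u x = 0"
proof -
  have "u y = 0 \<or> r \<le> norm (x - y)" for y
    using assms norm_triangle_sub[of x y] by force
  then have "u y = 0 \<or> K (x - y) = 0 \<and> G (x - y) = 0" for y using K_0 G_0 by metis
  then have z: "u y * K (x - y) = 0" "u y *\<^sub>R G (x - y) = 0" for y
    by (metis mult_eq_0_iff, metis scaleR_eq_0_iff)
  show "conv u x = 0" "conv_grad u x = 0"
    unfolding conv_def conv_grad_def z by simp_all
qed

lemma integral_K_shift: "integrable lborel (\<lambda>y. K (x - y))" "(\<integral>y. K (x - y) \<partial>lborel) = 1"
proof -
  show "integrable lborel (\<lambda>y. K (x - y))" by (rule integrable_lborel_minus[OF K_integrable])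
  have "(\<integral>y. K (x - y) \<partial>lborel) = integral\<^sup>L lborel K"
    using integral_distr[of "\<lambda>y. x - y" lborel borel K] by (simp add: distr_lborel_minus)
  then show "(\<integral>y. K (x - y) \<partial>lborel) = 1" by (simp add: K_integral)
qed

lemma integrable_mult_K: "integrable lborel u \<Longrightarrow> integrable lborel (\<lambda>y. u y * K (x - y))"
proof -
  assume u: "integrable lborel u"
  obtain B where B: "\<And>z. \<bar>K z\<bar> \<le> B" using bounded_KG by metis
  show ?thesis
  proof (rule Bochner_Integration.integrable_bound[of lborel "\<lambda>x. u x * B"])
    show "AE y in lborel. norm (u y * K (x - y)) \<le> norm (u y * B)"
      using order_trans[OF B abs_ge_self[of B]] by (intro AE_I2) (simp add: abs_mult mult_left_mono)
  qed (use u in simp_all)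
qed

text \<open>Because \<open>K\<close> has mass one, \<open>conv u x - u x\<close> is the
  \<open>K\<close>-average of \<open>u (x + z) - u x\<close> over \<open>z\<close>. After Tonelli
  only translations by \<open>z\<close> with norm below \<open>r\<close> carry weight.\<close>

lemma nn_integral_conv_diff_le:
  assumes u: "integrable lborel u"
    and e: "\<And>z. norm z < r \<Longrightarrow> (\<integral>x. \<bar>u (x + z) - u x\<bar> \<partial>lborel) \<le> e"
  shows "(\<integral>\<^sup>+x. ennreal \<bar>conv u x - u x\<bar> \<partial>lborel) \<le> ennreal e"
proof -
  have [measurable]: "u \<in> borel_measurable borel" using u by simp
  have pw: "ennreal \<bar>conv u x - u x\<bar> \<le> (\<integral>\<^sup>+z. ennreal (\<bar>u (x + z) - u x\<bar> * K z) \<partial>lborel)" for x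
  proof -
    have "conv u x - u x = (\<integral>y. (u y - u x) * K (x - y) \<partial>lborel)"
      using integrable_mult_K[OF u, of x] integral_K_shift[of x]
      by (simp add: conv_def left_diff_distrib)
    then have "ennreal \<bar>conv u x - u x\<bar> \<le> (\<integral>\<^sup>+y. ennreal (norm ((u y - u x) * K (x - y))) \<partial>lborel)"
      using integral_norm_bound_ennreal[of lborel "\<lambda>y. (u y - u x) * K (x - y)"]
        integrable_mult_K[OF u, of x] integral_K_shift[of x]
      by (simp add: left_diff_distrib)
    also have "\<dots> = (\<integral>\<^sup>+y. ennreal (\<bar>u (y + x) - u x\<bar> * K y) \<partial>lborel)"
      using nn_integral_lborel_plus[of "\<lambda>y. ennreal (\<bar>u y - u x\<bar> * K (x - y))" x] K_nonneg
      by (simp add: abs_mult K_even)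
    finally show ?thesis by (simp add: add.commute)
  qed
  have "(\<integral>\<^sup>+x. ennreal \<bar>conv u x - u x\<bar> \<partial>lborel) \<le> (\<integral>\<^sup>+x. (\<integral>\<^sup>+z. ennreal (\<bar>u (x + z) - u x\<bar> * K z) \<partial>lborel) \<partial>lborel)"
    by (intro nn_integral_mono pw)
  also have "\<dots> = (\<integral>\<^sup>+z. (\<integral>\<^sup>+x. ennreal (\<bar>u (x + z) - u x\<bar> * K z) \<partial>lborel) \<partial>lborel)"
    by (rule lborel_pair.Fubini') measurable
  also have "\<dots> \<le> (\<integral>\<^sup>+z. ennreal e * ennreal (K z) \<partial>lborel)"
  proof (rule nn_integral_mono)
    fix z
    show "(\<integral>\<^sup>+x. ennreal (\<bar>u (x + z) - u x\<bar> * K z) \<partial>lborel) \<le> ennreal e * ennreal (K z)"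
    proof (cases "norm z < r")
      case True
      have "(\<integral>\<^sup>+x. ennreal (\<bar>u (x + z) - u x\<bar> * K z) \<partial>lborel) = (\<integral>\<^sup>+x. ennreal \<bar>u (x + z) - u x\<bar> \<partial>lborel) * ennreal (K z)"
        by (simp add: ennreal_mult K_nonneg nn_integral_multc)
      also have "(\<integral>\<^sup>+x. ennreal \<bar>u (x + z) - u x\<bar> \<partial>lborel) = ennreal (\<integral>x. \<bar>u (x + z) - u x\<bar> \<partial>lborel)"
        using u integrable_lborel_plus[OF u, of z] by (intro nn_integral_eq_integral) auto
      finally show ?thesis using e[OF True] by (auto intro!: mult_right_mono ennreal_leI)
    qed (simp add: K_0)
  qed
  also have "\<dots> = ennreal e * (\<integral>\<^sup>+z. ennreal (K z) \<partial>lborel)"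
    by (rule nn_integral_cmult) measurable
  also have "(\<integral>\<^sup>+z. ennreal (K z) \<partial>lborel) = 1"
    using nn_integral_eq_integral[OF K_integrable] by (simp add: K_nonneg K_integral)
  finally show ?thesis by simp
qed

text \<open>
  Moving the convolution from \<open>u\<close> to the field \<open>\<psi> = - sgn (conv_grad u)\<close> yields an admissible
  \<open>C\<^sup>1\<close> test field \<open>K * \<psi>\<close>, although \<open>\<psi>\<close> itself is merely measurable.
\<close>

lemma integral_norm_conv_grad_le:
  assumes u: "integrable lborel u" and supp: "\<And>x. R \<le> norm x \<Longrightarrow> u x = 0"
  shows "ereal (\<integral>x. norm (conv_grad u x) \<partial>lborel) \<le> total_variation u"
proof -
  obtain B where B: "\<And>z. \<bar>K z\<bar> \<le> B" "\<And>z. norm (G z) \<le> B" "0 \<le> B" using bounded_KG by metis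
  have [measurable]: "u \<in> borel_measurable borel" using u by simp
  have [measurable]: "conv_grad u \<in> borel_measurable borel"
    using C1_grad_measurable[OF conv_C1_grad[OF u]] by simp
  define \<psi> where "\<psi> x = - sgn (conv_grad u x)" for x
  have [measurable]: "\<psi> \<in> borel_measurable borel" unfolding \<psi>_def[abs_def] sgn_div_norm by measurable
  have \<psi>1: "norm (\<psi> x) \<le> indicat_real (ball 0 (R + r)) x" for x
    using conv_eq_0(2)[of R u x] supp by (auto simp: \<psi>_def indicator_def norm_sgn)
  have indint: "integrable lborel (indicat_real (ball (0::'a) (R + r)))"
    using emeasure_lborel_ball_finite[of "0::'a" "R + r"] by (intro integrable_real_indicator) auto
  have \<psi>int: "integrable lborel \<psi>"
    by (rule Bochner_Integration.integrable_bound[OF indint]) (use \<psi>1 in auto)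
  have \<psi>le1: "norm (\<psi> x) \<le> 1" for x
    by (simp add: \<psi>_def norm_sgn)
  have \<psi>G: "integrable lborel (\<lambda>x. \<psi> x \<bullet> G (y - x))" for y
  proof (rule Bochner_Integration.integrable_bound[OF integrable_mult_right[OF indint, of B]])
    show "AE x in lborel. norm (\<psi> x \<bullet> G (y - x)) \<le> norm (B * indicat_real (ball 0 (R + r)) x)"
    proof (rule AE_I2)
      fix x
      have "norm (\<psi> x \<bullet> G (y - x)) \<le> norm (\<psi> x) * norm (G (y - x))" by (simp add: Cauchy_Schwarz_ineq2)
      also have "\<dots> \<le> indicator (ball 0 (R + r)) x * B" by (intro mult_mono \<psi>1 B) auto
      finally show "norm (\<psi> x \<bullet> G (y - x)) \<le> norm (B * indicat_real (ball 0 (R + r)) x)"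
        using B(3) by (simp add: mult.commute)
    qed
  qed simp
  have \<psi>K: "integrable lborel (\<lambda>x. K (y - x) *\<^sub>R \<psi> x)" for y
  proof (rule Bochner_Integration.integrable_bound[OF integral_K_shift(1)[of y]])
    show "AE x in lborel. norm (K (y - x) *\<^sub>R \<psi> x) \<le> norm (K (y - x))"
      using \<psi>le1 by (intro AE_I2) (simp add: mult_left_le)
  qed simp
  define \<Phi> where "\<Phi> y = (\<integral>x. K (y - x) *\<^sub>R \<psi> x \<partial>lborel)" for y
  define g where "g b y = (\<integral>x. (\<psi> x \<bullet> b) *\<^sub>R G (y - x) \<partial>lborel)" for b y
  have \<Phi>C: "C1_grad (\<lambda>y. \<Phi> y \<bullet> b) (g b)" for b
  proof -
    have "\<Phi> y \<bullet> b = (\<integral>x. (\<psi> x \<bullet> b) * K (y - x) \<partial>lborel)" for y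
      using integral_inner_left[of b lborel, OF \<psi>K[of y]] by (simp add: \<Phi>_def mult.commute)
    then show ?thesis
      using C1_grad_integral[OF integrable_inner_left[OF \<psi>int, of b] _ K_C1 B(1,2), of uminus]
      by (simp add: g_def[abs_def])
  qed
  have \<Phi>1: "norm (\<Phi> y) \<le> 1" for y
  proof -
    have "norm (\<Phi> y) \<le> (\<integral>x. norm (K (y - x) *\<^sub>R \<psi> x) \<partial>lborel)"
      unfolding \<Phi>_def by (rule integral_norm_bound)
    also have "\<dots> \<le> (\<integral>x. K (y - x) \<partial>lborel)"
      using integral_K_shift[of y] \<psi>K[of y] \<psi>le1 K_nonneg
      by (intro integral_mono integrable_norm) (auto simp: mult_left_le)
    finally show ?thesis by (simp add: integral_K_shift)
  qed
  have \<Phi>0: "\<Phi> y = 0" if "(R + r) + r \<le> norm y" for y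
  proof -
    have "\<psi> x = 0 \<or> r \<le> norm (y - x)" for x
      using that norm_triangle_sub[of y x] \<psi>1[of x] by (cases "R + r \<le> norm x") auto
    then have z: "K (y - x) *\<^sub>R \<psi> x = 0" for x using K_0 by (metis scaleR_eq_0_iff)
    show ?thesis unfolding \<Phi>_def z by simp
  qed
  obtain \<phi>' where tf: "(\<Phi>, \<phi>') \<in> test_fields" and div: "\<And>y. divergence \<phi>' y = (\<Sum>b\<in>Basis. g b y \<bullet> b)"
    using test_field_from_components[OF \<Phi>C \<Phi>1 \<Phi>0] by metis
  have div': "divergence \<phi>' y = (\<integral>x. \<psi> x \<bullet> G (y - x) \<partial>lborel)" for y
  proof -
    have i: "integrable lborel (\<lambda>x. (\<psi> x \<bullet> b) *\<^sub>R G (y - x))" for b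
    proof (rule Bochner_Integration.integrable_bound[OF integrable_mult_right[OF integrable_inner_left[OF \<psi>int, of b], of B]])
      show "AE x in lborel. norm ((\<psi> x \<bullet> b) *\<^sub>R G (y - x)) \<le> norm (B * (\<psi> x \<bullet> b))"
        using B(2,3) by (intro AE_I2) (simp add: abs_mult mult.commute[of B] mult_left_mono)
    qed simp
    have "divergence \<phi>' y = (\<Sum>b\<in>Basis. \<integral>x. (\<psi> x \<bullet> b) * (G (y - x) \<bullet> b) \<partial>lborel)"
      unfolding div g_def using integral_inner_left[OF i] by (intro sum.cong) auto
    also have "\<dots> = (\<integral>x. (\<Sum>b\<in>Basis. (\<psi> x \<bullet> b) * (G (y - x) \<bullet> b)) \<partial>lborel)"
      using integrable_inner_left[OF i] by (intro Bochner_Integration.integral_sum[symmetric]) auto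
    finally show ?thesis by (simp add: euclidean_inner[of "\<psi> _" "G _"])
  qed
  \<comment> \<open>Absolute integrability for exchanging the integrals: the inner one is at most a
    constant \<open>c\<close> independent of \<open>y\<close>, so integrability of \<open>u\<close>
    settles the outer one.\<close>
  have Fub: "integrable (lborel \<Otimes>\<^sub>M lborel) (\<lambda>(y, x). u y * (\<psi> x \<bullet> G (y - x)))"
  proof (rule lborel_pair.Fubini_integrable)
    define c where "c = (\<integral>x. B * indicat_real (ball (0::'a) (R + r)) x \<partial>lborel)"
    have "0 \<le> c" unfolding c_def using B(3) by (intro integral_nonneg_AE) auto
    have le: "(\<integral>x. \<bar>\<psi> x \<bullet> G (y - x)\<bar> \<partial>lborel) \<le> c" for y
      unfolding c_def
    proof (rule integral_mono[OF integrable_abs[OF \<psi>G] integrable_mult_right[OF indint]])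
      fix x
      have "\<bar>\<psi> x \<bullet> G (y - x)\<bar> \<le> norm (\<psi> x) * norm (G (y - x))" by (simp add: Cauchy_Schwarz_ineq2)
      also have "\<dots> \<le> indicator (ball 0 (R + r)) x * B" by (intro mult_mono \<psi>1 B) auto
      finally show "\<bar>\<psi> x \<bullet> G (y - x)\<bar> \<le> B * indicat_real (ball 0 (R + r)) x" by (simp add: mult.commute)
    qed
    show "integrable lborel (\<lambda>y. \<integral>x. norm (case (y, x) of (y, x) \<Rightarrow> u y * (\<psi> x \<bullet> G (y - x))) \<partial>lborel)"
    proof (rule Bochner_Integration.integrable_bound[OF integrable_mult_left[OF u, of c]])
      show "AE y in lborel. norm (\<integral>x. norm (case (y, x) of (y, x) \<Rightarrow> u y * (\<psi> x \<bullet> G (y - x))) \<partial>lborel) \<le> norm (u y * c)"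
        using le \<open>0 \<le> c\<close> by (intro AE_I2) (simp add: abs_mult mult_left_mono)
    qed measurable
    show "AE y in lborel. integrable lborel (\<lambda>x. case (y, x) of (y, x) \<Rightarrow> u y * (\<psi> x \<bullet> G (y - x)))"
      using \<psi>G by simp
  qed measurable
  have uG: "integrable lborel (\<lambda>y. u y *\<^sub>R G (y - x))" for x
  proof (rule Bochner_Integration.integrable_bound[OF integrable_mult_left[OF u, of B]])
    show "AE y in lborel. norm (u y *\<^sub>R G (y - x)) \<le> norm (u y * B)"
      using B(2,3) by (intro AE_I2) (simp add: abs_mult mult_left_mono)
  qed simp
  have "(\<integral>y. u y * divergence \<phi>' y \<partial>lborel) = (\<integral>y. (\<integral>x. u y * (\<psi> x \<bullet> G (y - x)) \<partial>lborel) \<partial>lborel)"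
    by (simp add: div')
  also have "\<dots> = (\<integral>x. (\<integral>y. u y * (\<psi> x \<bullet> G (y - x)) \<partial>lborel) \<partial>lborel)"
    using lborel_pair.Fubini_integral[OF Fub] by simp
  also have "\<dots> = (\<integral>x. norm (conv_grad u x) \<partial>lborel)"
  proof (rule Bochner_Integration.integral_cong[OF refl])
    fix x
    have "(\<integral>y. u y * (\<psi> x \<bullet> G (y - x)) \<partial>lborel) = \<psi> x \<bullet> (\<integral>y. u y *\<^sub>R G (y - x) \<partial>lborel)"
      using integral_inner_right[OF uG[of x], of "\<psi> x"] by simp
    also have "(\<integral>y. u y *\<^sub>R G (y - x) \<partial>lborel) = - conv_grad u x"
    proof -
      have "G (y - x) = - G (x - y)" for y using G_odd[of "x - y"] by simp
      then show ?thesis by (simp add: conv_grad_def)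
    qed
    also have "\<psi> x \<bullet> (- conv_grad u x) = norm (conv_grad u x)"
      by (cases "conv_grad u x = 0") (simp_all add: \<psi>_def sgn_div_norm dot_square_norm power2_eq_square)
    finally show "(\<integral>y. u y * (\<psi> x \<bullet> G (y - x)) \<partial>lborel) = norm (conv_grad u x)" .
  qed
  finally show ?thesis
    using test_field_le_total_variation[OF _ tf, of u] by simp
qed

end

text \<open>
  The mean value inequality is applied to the correlation of \<open>v\<close> with the sign of the difference.
\<close>

lemma integral_C1_grad_translate_le:
  fixes v :: "'a::euclidean_space \<Rightarrow> real"
  assumes v: "C1_grad v w" and supp: "\<And>x. R \<le> norm x \<Longrightarrow> v x = 0" "\<And>x. R \<le> norm x \<Longrightarrow> w x = 0"
  shows "(\<integral>x. \<bar>v (x + z) - v x\<bar> \<partial>lborel) \<le> norm z * (\<integral>x. norm (w x) \<partial>lborel)"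
proof -
  have [measurable]: "v \<in> borel_measurable borel" "w \<in> borel_measurable borel"
    using C1_grad_measurable[OF v] by auto
  have wi: "integrable lborel w"
    by (rule continuous_vanishing_integrable[OF C1_grad_continuous(2)[OF v] supp(2)])
  have vi: "integrable lborel v"
    by (rule continuous_vanishing_integrable[OF C1_grad_continuous(1)[OF v] supp(1)])
  obtain A where A: "\<And>x. norm (v x) \<le> A"
    using continuous_vanishing_bounded[OF C1_grad_continuous(1)[OF v] supp(1)] by metis
  obtain B where B: "\<And>x. norm (w x) \<le> B"
    using continuous_vanishing_bounded[OF C1_grad_continuous(2)[OF v] supp(2)] by metis
  define \<psi> where "\<psi> x = sgn (v (x + z) - v x)" for x
  have [measurable]: "\<psi> \<in> borel_measurable borel" unfolding \<psi>_def[abs_def] sgn_div_norm by measurable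
  have \<psi>1: "norm (\<psi> x) \<le> 1" for x by (simp add: \<psi>_def norm_sgn)
  have \<psi>0: "\<psi> x = 0" if "R + norm z \<le> norm x" for x
  proof -
    have "norm x \<le> norm (x + z) + norm z" using norm_triangle_ineq4[of "x + z" z] by simp
    moreover have "0 \<le> norm z" by simp
    ultimately have "R \<le> norm (x + z)" "R \<le> norm x" using that by linarith+
    then show ?thesis by (simp add: \<psi>_def supp)
  qed
  have indint: "integrable lborel (indicat_real (ball (0::'a) (R + norm z)))"
    using emeasure_lborel_ball_finite[of "0::'a" "R + norm z"] by (intro integrable_real_indicator) auto
  have \<psi>int: "integrable lborel \<psi>"
    by (rule Bochner_Integration.integrable_bound[OF indint])
       (use \<psi>1 \<psi>0 in \<open>auto simp: indicator_def intro!: AE_I2\<close>)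
  \<comment> \<open>The sign \<open>\<psi>\<close> stays frozen at the given \<open>z\<close> while
    \<open>y\<close> moves. The correlation is then Lipschitz in \<open>y\<close> with constant the
    L^1 norm of \<open>w\<close>, and its increment from 0 to \<open>z\<close> is the integral to be
    bounded.\<close>
  have C: "C1_grad (\<lambda>y. \<integral>x. \<psi> x * v (y + x) \<partial>lborel) (\<lambda>y. \<integral>x. \<psi> x *\<^sub>R w (y + x) \<partial>lborel)"
    by (rule C1_grad_integral[OF \<psi>int _ v]) (use A B in auto)
  have gb: "norm (\<integral>x. \<psi> x *\<^sub>R w (y + x) \<partial>lborel) \<le> (\<integral>x. norm (w x) \<partial>lborel)" for y
  proof -
    have wy: "integrable lborel (\<lambda>x. norm (w (x + y)))"
      using integrable_lborel_plus[OF wi] by (rule integrable_norm)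
    have "norm (\<integral>x. \<psi> x *\<^sub>R w (y + x) \<partial>lborel) \<le> (\<integral>x. norm (w (x + y)) \<partial>lborel)"
    proof (rule order_trans[OF integral_norm_bound])
      have le: "norm (\<psi> x *\<^sub>R w (y + x)) \<le> norm (w (x + y))" for x
        using \<psi>1[of x] by (simp add: mult_left_le_one_le add.commute)
      then have i: "integrable lborel (\<lambda>x. \<psi> x *\<^sub>R w (y + x))"
        by (intro Bochner_Integration.integrable_bound[OF wy]) auto
      show "(\<integral>x. norm (\<psi> x *\<^sub>R w (y + x)) \<partial>lborel) \<le> (\<integral>x. norm (w (x + y)) \<partial>lborel)"
        by (rule integral_mono[OF integrable_norm[OF i] wy le])
    qed
    also have "\<dots> = (\<integral>x. norm (w x) \<partial>lborel)"
      using integral_lborel_plus[of "\<lambda>x. norm (w x)" y] by simp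
    finally show ?thesis .
  qed
  have \<psi>v: "integrable lborel (\<lambda>x. \<psi> x * v (y + x))" for y
  proof -
    have "integrable lborel (\<lambda>x. v (x + y))" by (rule integrable_lborel_plus[OF vi])
    then show ?thesis
      by (rule Bochner_Integration.integrable_bound)
         (use \<psi>1 in \<open>auto intro!: AE_I2 simp: abs_mult mult_left_le_one_le add.commute\<close>)
  qed
  have "(\<integral>x. \<bar>v (x + z) - v x\<bar> \<partial>lborel) = (\<integral>x. \<psi> x * v (z + x) - \<psi> x * v (0 + x) \<partial>lborel)"
    by (rule Bochner_Integration.integral_cong) (auto simp: \<psi>_def add.commute sgn_if algebra_simps)
  also have "\<dots> = (\<integral>x. \<psi> x * v (z + x) \<partial>lborel) - (\<integral>x. \<psi> x * v (0 + x) \<partial>lborel)"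
    by (rule Bochner_Integration.integral_diff[OF \<psi>v \<psi>v])
  also have "\<dots> \<le> (\<integral>x. norm (w x) \<partial>lborel) * norm (z - 0)"
    using C1_grad_Lipschitz[OF C gb, of z 0] by linarith
  finally show ?thesis by (simp add: mult.commute)
qed

text \<open>Continuity of translations fixes a mollification radius for each prescribed L^1 error.
  Radii are kept at most 1 so that all approximations live in one ball, and mollifying does not
  raise the total variation, so \<open>T\<close> bounds every gradient.\<close>

lemma smooth_approximation:
  fixes u :: "'a::euclidean_space \<Rightarrow> real"
  assumes u: "integrable lborel u" and supp: "\<And>x. R \<le> norm x \<Longrightarrow> u x = 0" 
    and TV: "total_variation u \<le> ereal T"
  obtains v w where "\<And>n. C1_grad (v n) (w n)" "\<And>n x. R + 1 \<le> norm x \<Longrightarrow> v n x = 0"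
    "\<And>n x. R + 1 \<le> norm x \<Longrightarrow> w n x = 0" "\<And>n. (\<integral>x. norm (w n x) \<partial>lborel) \<le> T"
    "(\<lambda>n. \<integral>x. \<bar>v n x - u x\<bar> \<partial>lborel) \<longlonglongrightarrow> 0"
proof -
  have lim: "((\<lambda>z. \<integral>x. \<bar>u (x + z) - u x\<bar> \<partial>lborel) \<longlongrightarrow> 0) (at 0)"
    unfolding tendsto_at_iff_sequentially o_def using L1_translation_continuous[OF u] by auto
  have small: "\<exists>d>0. d \<le> 1 \<and> (\<forall>z. norm z < d \<longrightarrow> (\<integral>x. \<bar>u (x + z) - u x\<bar> \<partial>lborel) \<le> e)" if e: "0 < e" for e
  proof -
    obtain d where d: "d > 0" "\<And>z. z \<noteq> 0 \<Longrightarrow> norm z < d \<Longrightarrow> \<bar>\<integral>x. \<bar>u (x + z) - u x\<bar> \<partial>lborel\<bar> < e"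
      using LIM_D[OF lim e] by auto
    have "(\<integral>x. \<bar>u (x + z) - u x\<bar> \<partial>lborel) \<le> e" if "norm z < d" for z
      using d(2)[of z] that e by (cases "z = 0") auto
    then show ?thesis using d(1) by (intro exI[of _ "min d 1"]) auto
  qed
  have "\<exists>d>0. d \<le> 1 \<and> (\<forall>z. norm z < d \<longrightarrow> (\<integral>x. \<bar>u (x + z) - u x\<bar> \<partial>lborel) \<le> inverse (real (Suc n)))" for n
    by (rule small) simp
  then obtain d where d: "\<And>n. 0 < d n" "\<And>n. d n \<le> 1"
    "\<And>n z. norm z < d n \<Longrightarrow> (\<integral>x. \<bar>u (x + z) - u x\<bar> \<partial>lborel) \<le> inverse (real (Suc n))" by metis
  have "\<exists>p. mollifier (fst p :: 'a \<Rightarrow> real) (snd p) (d n)" for n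
  proof -
    obtain K :: "'a \<Rightarrow> real" and G where "C1_grad K G" "\<And>z. 0 \<le> K z"
      "\<And>z. K (- z) = K z" "\<And>z. G (- z) = - G z" "\<And>z. d n \<le> norm z \<Longrightarrow> K z = 0" "\<And>z. d n \<le> norm z \<Longrightarrow> G z = 0"
      "integrable lborel K" "integral\<^sup>L lborel K = 1"
      by (rule mollifier_exists[OF d(1)[of n], where 'a='a], rule that)
    then have "mollifier K G (d n)" by unfold_locales
    then show ?thesis by (intro exI[of _ "(K, G)"]) simp
  qed
  then obtain p where p: "\<And>n. mollifier (fst (p n) :: 'a \<Rightarrow> real) (snd (p n)) (d n)" by metis
  define K G where "K n = fst (p n)" and "G n = snd (p n)" for n
  have mol: "mollifier (K n) (G n) (d n)" for n using p[of n] by (simp add: K_def G_def)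
  define v where "v n = mollifier.conv (K n) u" for n
  define w where "w n = mollifier.conv_grad (G n) u" for n
  have vw: "C1_grad (v n) (w n)" for n
    unfolding v_def w_def by (rule mollifier.conv_C1_grad[OF mol u])
  have 0: "v n x = 0" "w n x = 0" if "R + 1 \<le> norm x" for n x
    unfolding v_def w_def using mollifier.conv_eq_0[OF mol, of R u n x] supp d(2)[of n] that by auto
  have wT: "(\<integral>x. norm (w n x) \<partial>lborel) \<le> T" for n
  proof -
    have "ereal (\<integral>x. norm (w n x) \<partial>lborel) \<le> total_variation u"
      unfolding w_def by (rule mollifier.integral_norm_conv_grad_le[OF mol u]) (rule supp)
    then have "ereal (\<integral>x. norm (w n x) \<partial>lborel) \<le> ereal T" using TV by (rule order_trans)
    then show ?thesis by simp
  qed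
  have vi: "integrable lborel (v n)" for n
    by (rule continuous_vanishing_integrable[OF C1_grad_continuous(1)[OF vw] 0(1)])
  have le: "(\<integral>x. \<bar>v n x - u x\<bar> \<partial>lborel) \<le> inverse (real (Suc n))" for n
  proof -
    have "ennreal (\<integral>x. \<bar>v n x - u x\<bar> \<partial>lborel) = (\<integral>\<^sup>+x. ennreal \<bar>v n x - u x\<bar> \<partial>lborel)"
      using vi u by (intro nn_integral_eq_integral[symmetric]) auto
    also have "\<dots> \<le> ennreal (inverse (real (Suc n)))"
      unfolding v_def by (rule mollifier.nn_integral_conv_diff_le[OF mol u d(3)])
    finally show ?thesis by (subst (asm) ennreal_le_iff) auto
  qed
  have "(\<lambda>n. \<integral>x. \<bar>v n x - u x\<bar> \<partial>lborel) \<longlonglongrightarrow> 0"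
    by (rule tendsto_sandwich[OF _ _ tendsto_const LIMSEQ_inverse_real_of_nat])
       (use le in \<open>auto intro!: always_eventually\<close>)
  then show thesis using that[of v w] vw 0 wT by blast
qed

text \<open>The smooth estimate survives the L^1 limit; the approximation error enters twice, once
  translated and once in place.\<close>

lemma integral_translate_le_total_variation:
  fixes u :: "'a::euclidean_space \<Rightarrow> real"
  assumes u: "integrable lborel u" and supp: "\<And>x. R \<le> norm x \<Longrightarrow> u x = 0" 
    and TV: "total_variation u \<le> ereal T"
  shows "(\<integral>x. \<bar>u (x + z) - u x\<bar> \<partial>lborel) \<le> norm z * T"
proof -
  obtain v w where vw: "\<And>n. C1_grad (v n) (w n)" "\<And>n x. R + 1 \<le> norm x \<Longrightarrow> v n x = 0"
    "\<And>n x. R + 1 \<le> norm x \<Longrightarrow> w n x = 0" "\<And>n. (\<integral>x. norm (w n x) \<partial>lborel) \<le> T"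
    and lim: "(\<lambda>n. \<integral>x. \<bar>v n x - u x\<bar> \<partial>lborel) \<longlonglongrightarrow> 0"
    by (rule smooth_approximation[OF u supp TV], assumption, rule that)
  have vi: "integrable lborel (v n)" for n
    by (rule continuous_vanishing_integrable[OF C1_grad_continuous(1)[OF vw(1)] vw(2)])
  have le: "(\<integral>x. \<bar>u (x + z) - u x\<bar> \<partial>lborel) \<le> 2 * (\<integral>x. \<bar>v n x - u x\<bar> \<partial>lborel) + norm z * T" for n
  proof -
    note i = u vi[of n] integrable_lborel_plus[OF u, of z] integrable_lborel_plus[OF vi[of n], of z]
    have "(\<integral>x. \<bar>u (x + z) - u x\<bar> \<partial>lborel)
        \<le> (\<integral>x. \<bar>v n (x + z) - u (x + z)\<bar> + \<bar>v n (x + z) - v n x\<bar> + \<bar>v n x - u x\<bar> \<partial>lborel)"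
      using i by (intro integral_mono) auto
    also have "\<dots> = (\<integral>x. \<bar>v n (x + z) - u (x + z)\<bar> \<partial>lborel) + (\<integral>x. \<bar>v n (x + z) - v n x\<bar> \<partial>lborel)
        + (\<integral>x. \<bar>v n x - u x\<bar> \<partial>lborel)"
      using i by simp
    also have "(\<integral>x. \<bar>v n (x + z) - u (x + z)\<bar> \<partial>lborel) = (\<integral>x. \<bar>v n x - u x\<bar> \<partial>lborel)"
      using integral_lborel_plus[of "\<lambda>x. \<bar>v n x - u x\<bar>" z] u vi[of n] by simp
    also have "(\<integral>x. \<bar>v n (x + z) - v n x\<bar> \<partial>lborel) \<le> norm z * (\<integral>x. norm (w n x) \<partial>lborel)"
      by (rule integral_C1_grad_translate_le[OF vw(1-3)])
    also have "\<dots> \<le> norm z * T" by (intro mult_left_mono vw(4)) simp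
    finally show ?thesis by simp
  qed
  have "(\<lambda>n. 2 * (\<integral>x. \<bar>v n x - u x\<bar> \<partial>lborel) + norm z * T) \<longlonglongrightarrow> 2 * 0 + norm z * T"
    by (intro tendsto_intros lim)
  then have "(\<integral>x. \<bar>u (x + z) - u x\<bar> \<partial>lborel) \<le> 2 * 0 + norm z * T"
    by (rule LIMSEQ_le_const) (use le in auto)
  then show ?thesis by simp
qed

section \<open>The coarea inequality\<close>

text \<open>
  Smooth approximations of the indicator of the positive half line; as the test fields have compact
  support, the approximations themselves need not be eventually constant.
\<close>

definition step :: "real \<Rightarrow> real \<Rightarrow> real" where
  "step c s = 1 / 2 + arctan (c * s) / pi"

text \<open>For positive \<open>c\<close> this is the Cauchy probability density of scale
  \<open>1 / c\<close>.\<close>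

definition step_deriv :: "real \<Rightarrow> real \<Rightarrow> real" where
  "step_deriv c s = c / (pi * (1 + (c * s)\<^sup>2))"

lemma DERIV_step: "(step c has_real_derivative step_deriv c s) (at s)"
proof -
  have "((\<lambda>s. 1 / 2 + arctan (c * s) / pi) has_real_derivative (0 + inverse (1 + (c * s)\<^sup>2) * c / pi)) (at s)"
    by (intro DERIV_add DERIV_const DERIV_cdivide DERIV_chain2[OF DERIV_arctan] DERIV_cmult_Id)
  then show ?thesis
    unfolding step_def[abs_def] step_deriv_def by (simp add: inverse_eq_divide mult.commute)
qed

lemma step_bounds: "0 \<le> step c s" "step c s \<le> 1"
  using arctan_bounded[of "c * s"] by (auto simp: step_def field_simps)

lemma step_deriv_nonneg: "0 \<le> c \<Longrightarrow> 0 \<le> step_deriv c s"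
  unfolding step_deriv_def by (intro divide_nonneg_nonneg mult_nonneg_nonneg) (auto simp: add_nonneg_nonneg)

lemma continuous_on_step_deriv: "continuous_on UNIV (step_deriv c)"
proof -
  have "pi * (1 + (c * s)\<^sup>2) \<noteq> 0" for s
    using zero_le_power2[of "c * s"] by (simp add: add_nonneg_eq_0_iff)
  then show ?thesis
    unfolding step_deriv_def[abs_def] by (intro continuous_intros) auto
qed

lemma step_deriv_measurable [measurable]: "step_deriv c \<in> borel_measurable borel"
  by (rule borel_measurable_continuous_onI[OF continuous_on_step_deriv])

lemma step_measurable [measurable]: "step c \<in> borel_measurable borel"
  by (rule borel_measurable_continuous_onI)
     (meson DERIV_isCont DERIV_step continuous_at_imp_continuous_on)

text \<open>As a function of \<open>t\<close> the density has total mass one on the line; with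
  antiderivative \<open>- step c (s - t)\<close> the half line collects only \<open>step c s\<close>
  of it.\<close>

lemma nn_integral_step_deriv_le:
  assumes "0 < c"
  shows "(\<integral>\<^sup>+t. ennreal (step_deriv c (s - t)) * indicator {0..} t \<partial>lborel) \<le> 1"
proof -
  have "(\<integral>\<^sup>+t. ennreal (step_deriv c (s - t)) * indicator {0..} t \<partial>lborel) = ennreal (0 - (- step c (s - 0)))"
  proof (rule nn_integral_FTC_atLeast)
    show "((\<lambda>t. - step c (s - t)) has_real_derivative step_deriv c (s - t)) (at t)" for t
    proof -
      have "((\<lambda>t. s - t) has_real_derivative -1) (at t)" by (auto intro!: derivative_eq_intros)
      from DERIV_minus[OF DERIV_chain2[OF DERIV_step this, of c]] show ?thesis by simp
    qed
    have "filterlim (\<lambda>t. c * (s - t)) at_bot at_top"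
    proof -
      have "filterlim (\<lambda>t. - (c * (s - t))) at_top at_top"
        unfolding filterlim_at_top
      proof
        fix Z
        show "\<forall>\<^sub>F t in at_top. Z \<le> - (c * (s - t))"
          using eventually_ge_at_top[of "Z / c + s"]
        proof eventually_elim
          case (elim t)
          then have "Z / c \<le> t - s" by simp
          then have "Z \<le> (t - s) * c" using assms by (simp add: pos_divide_le_eq)
          then show ?case by (simp add: algebra_simps)
        qed
      qed
      then show ?thesis by (simp add: filterlim_uminus_at_bot)
    qed
    then have "((\<lambda>t. arctan (c * (s - t))) \<longlongrightarrow> - (pi / 2)) at_top"
      by (rule filterlim_compose[OF tendsto_arctan_at_bot])
    then have "((\<lambda>t. - (1 / 2 + arctan (c * (s - t)) / pi)) \<longlongrightarrow> - (1 / 2 + (- (pi / 2)) / pi)) at_top"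
      by (intro tendsto_intros) auto
    then show "((\<lambda>t. - step c (s - t)) \<longlongrightarrow> 0) at_top" by (simp add: step_def)
  qed (use assms in \<open>auto intro: step_deriv_nonneg\<close>)
  also have "\<dots> \<le> ennreal 1" using step_bounds(2)[of c s] by (intro ennreal_leI) simp
  finally show ?thesis by simp
qed

text \<open>The steepness grows while the argument still moves. For \<open>a \<noteq> t\<close> the
  limit of \<open>v n - t\<close> has a definite sign and wins; for \<open>a = t\<close> the product
  could tend to anything.\<close>

lemma step_tendsto:
  assumes v: "v \<longlonglongrightarrow> a" and "a \<noteq> t"
  shows "(\<lambda>n. step (real (Suc n)) (v n - t)) \<longlonglongrightarrow> indicat_real {t<..} a"
proof -
  have lim: "(\<lambda>n. v n - t) \<longlonglongrightarrow> a - t" by (intro tendsto_intros v)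
  have S: "filterlim (\<lambda>n. real (Suc n)) at_top sequentially"
    by (rule filterlim_compose[OF filterlim_real_sequentially filterlim_Suc])
  show ?thesis
  proof (cases "t < a")
    case True
    have "filterlim (\<lambda>n. (v n - t) * real (Suc n)) at_top sequentially"
      by (rule filterlim_tendsto_pos_mult_at_top[OF lim _ S]) (use True in simp)
    then have "(\<lambda>n. arctan ((v n - t) * real (Suc n))) \<longlonglongrightarrow> pi / 2"
      by (rule filterlim_compose[OF tendsto_arctan_at_top])
    then have "(\<lambda>n. 1 / 2 + arctan ((v n - t) * real (Suc n)) / pi) \<longlonglongrightarrow> 1 / 2 + (pi / 2) / pi"
      by (intro tendsto_intros) auto
    then show ?thesis using True by (simp add: step_def mult.commute)
  next
    case False
    have "filterlim (\<lambda>n. (v n - t) * real (Suc n)) at_bot sequentially"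
      by (rule filterlim_tendsto_neg_mult_at_bot[OF lim _ S]) (use False assms(2) in simp)
    then have "(\<lambda>n. arctan ((v n - t) * real (Suc n))) \<longlonglongrightarrow> - (pi / 2)"
      by (rule filterlim_compose[OF tendsto_arctan_at_bot])
    then have "(\<lambda>n. 1 / 2 + arctan ((v n - t) * real (Suc n)) / pi) \<longlonglongrightarrow> 1 / 2 + (- (pi / 2)) / pi"
      by (intro tendsto_intros) auto
    then show ?thesis using False by (simp add: step_def mult.commute)
  qed
qed

lemma C1_grad_step:
  assumes v: "C1_grad v w"
  shows "C1_grad (\<lambda>x. step c (v x - t)) (\<lambda>x. step_deriv c (v x - t) *\<^sub>R w x)"
  unfolding C1_grad_def
proof
  have "((\<lambda>x. step c (v x - t)) has_derivative (\<lambda>h. (step_deriv c (v x - t) *\<^sub>R w x) \<bullet> h)) (at x)" for x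
  proof -
    have "((\<lambda>x. v x - t) has_derivative (\<lambda>h. w x \<bullet> h)) (at x)"
      using v unfolding C1_grad_def by (auto intro!: derivative_eq_intros)
    from has_derivative_compose[OF this DERIV_step[unfolded has_field_derivative_def]]
    show ?thesis by (simp add: mult.commute)
  qed
  then show "\<forall>x. ((\<lambda>x. step c (v x - t)) has_derivative (\<lambda>h. (step_deriv c (v x - t) *\<^sub>R w x) \<bullet> h)) (at x)" by blast
  show "continuous_on UNIV (\<lambda>x. step_deriv c (v x - t) *\<^sub>R w x)"
    using C1_grad_continuous[OF v]
    by (intro continuous_on_scaleR continuous_on_compose2[OF continuous_on_step_deriv] continuous_on_diff continuous_on_const) auto
qed

lemma integral_step_divergence_le:
  fixes v :: "'a::euclidean_space \<Rightarrow> real"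
  assumes v: "C1_grad v w" and c: "0 \<le> c" and p: "p \<in> test_fields"
  shows "ennreal (\<integral>x. step c (v x - t) * divergence (snd p) x \<partial>lborel) \<le>
    (\<integral>\<^sup>+x. ennreal (step_deriv c (v x - t) * norm (w x)) \<partial>lborel)"
proof -
  let ?g = "\<lambda>x. step_deriv c (v x - t) *\<^sub>R w x"
  have "ennreal (\<integral>x. step c (v x - t) * divergence (snd p) x \<partial>lborel) = ennreal (\<integral>x. - (?g x \<bullet> fst p x) \<partial>lborel)"
    using integration_by_parts[OF C1_grad_step[OF v] p] by simp
  also have "\<dots> \<le> (\<integral>\<^sup>+x. ennreal (- (?g x \<bullet> fst p x)) \<partial>lborel)"
  \<comment> \<open>Without integrability the Bochner integral takes its default value 0, and the
    bound is trivial.\<close>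
  proof (cases "integrable lborel (\<lambda>x. - (?g x \<bullet> fst p x))")
    case True
    have "(\<integral>x. - (?g x \<bullet> fst p x) \<partial>lborel) \<le> (\<integral>x. max 0 (- (?g x \<bullet> fst p x)) \<partial>lborel)"
      using True by (intro integral_mono) auto
    then have "ennreal (\<integral>x. - (?g x \<bullet> fst p x) \<partial>lborel) \<le> ennreal (\<integral>x. max 0 (- (?g x \<bullet> fst p x)) \<partial>lborel)"
      by (rule ennreal_leI)
    also have "\<dots> = (\<integral>\<^sup>+x. ennreal (max 0 (- (?g x \<bullet> fst p x))) \<partial>lborel)"
      using True by (intro nn_integral_eq_integral[symmetric]) auto
    also have "\<dots> = (\<integral>\<^sup>+x. ennreal (- (?g x \<bullet> fst p x)) \<partial>lborel)"
      by (intro nn_integral_cong) (simp only: max_def split: if_split, auto simp: ennreal_neg)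
    finally show ?thesis .
  qed (simp add: not_integrable_integral_eq)
  also have "\<dots> \<le> (\<integral>\<^sup>+x. ennreal (step_deriv c (v x - t) * norm (w x)) \<partial>lborel)"
  proof (intro nn_integral_mono ennreal_leI)
    fix x
    have "- (?g x \<bullet> fst p x) \<le> norm (?g x) * norm (fst p x)"
      using Cauchy_Schwarz_ineq2[of "?g x" "fst p x"] by linarith
    also have "\<dots> \<le> norm (?g x) * 1"
      by (intro mult_left_mono test_field_apply[OF p]) simp
    finally show "- (?g x \<bullet> fst p x) \<le> step_deriv c (v x - t) * norm (w x)"
      using step_deriv_nonneg[OF c, of "v x - t"] by simp
  qed
  finally show ?thesis .
qed

text \<open>The coarea inequality for smooth functions with the levels smeared out: after Tonelli
  each \<open>x\<close> distributes the mass \<open>norm (w x)\<close> over the levels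
  \<open>t\<close> by a probability density, so at most this mass falls on nonnegative
  levels.\<close>

lemma nn_integral_step_slices_le:
  fixes v :: "'a::euclidean_space \<Rightarrow> real"
  assumes [measurable]: "v \<in> borel_measurable borel" "w \<in> borel_measurable borel" and c: "0 < c"
  shows "(\<integral>\<^sup>+t. (\<integral>\<^sup>+x. ennreal (step_deriv c (v x - t) * norm (w x)) \<partial>lborel) * indicator {0..} t \<partial>lborel)
    \<le> (\<integral>\<^sup>+x. ennreal (norm (w x :: 'a)) \<partial>lborel)"
proof -
  have "(\<integral>\<^sup>+t. (\<integral>\<^sup>+x. ennreal (step_deriv c (v x - t) * norm (w x)) \<partial>lborel) * indicator {0..} t \<partial>lborel)
    = (\<integral>\<^sup>+t. (\<integral>\<^sup>+x. ennreal (norm (w x)) * (ennreal (step_deriv c (v x - t)) * indicator {0..} t) \<partial>lborel) \<partial>lborel)"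
  proof (rule nn_integral_cong)
    fix t :: real
    show "(\<integral>\<^sup>+x. ennreal (step_deriv c (v x - t) * norm (w x)) \<partial>lborel) * indicator {0..} t
      = (\<integral>\<^sup>+x. ennreal (norm (w x)) * (ennreal (step_deriv c (v x - t)) * indicator {0..} t) \<partial>lborel)"
      using c by (cases "0 \<le> t") (simp_all add: ennreal_mult step_deriv_nonneg mult.commute)
  qed
  also have "\<dots> = (\<integral>\<^sup>+x. (\<integral>\<^sup>+t. ennreal (norm (w x)) * (ennreal (step_deriv c (v x - t)) * indicator {0..} t) \<partial>lborel) \<partial>lborel)"
    by (rule lborel_pair.Fubini') measurable
  also have "\<dots> = (\<integral>\<^sup>+x. ennreal (norm (w x)) * (\<integral>\<^sup>+t. (ennreal (step_deriv c (v x - t)) * indicator {0..} t) \<partial>lborel) \<partial>lborel)"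
    by (intro nn_integral_cong nn_integral_cmult) measurable
  also have "\<dots> \<le> (\<integral>\<^sup>+x. ennreal (norm (w x)) * 1 \<partial>lborel)"
    by (intro nn_integral_mono mult_left_mono nn_integral_step_deriv_le[OF c]) simp
  finally show ?thesis by simp
qed

text \<open>Both sides measure the region under the graph, sliced once by level and once by
  point.\<close>

lemma nn_integral_layer_cake:
  fixes u :: "'a::euclidean_space \<Rightarrow> real"
  assumes [measurable]: "u \<in> borel_measurable borel" and u0: "\<And>x. 0 \<le> u x"
  shows "(\<integral>\<^sup>+t. emeasure lborel {x. t < u x} * indicator {0..} t \<partial>lborel) = (\<integral>\<^sup>+x. ennreal (u x) \<partial>lborel)"
proof -
  have "(\<integral>\<^sup>+t. emeasure lborel {x. t < u x} * indicator {0..} t \<partial>lborel)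
    = (\<integral>\<^sup>+t. (\<integral>\<^sup>+x. indicator {p. 0 \<le> snd p \<and> snd p < u (fst p)} (x, t) \<partial>lborel) \<partial>lborel)"
  proof (rule nn_integral_cong)
    fix t :: real
    have [measurable]: "{x. t < u x} \<in> sets borel" by measurable
    have "emeasure lborel {x. t < u x} * indicator {0..} t = (\<integral>\<^sup>+x. indicator {x. t < u x} x * indicator {0..} t \<partial>lborel)"
      by (subst nn_integral_multc) auto
    also have "\<dots> = (\<integral>\<^sup>+x. indicator {p. 0 \<le> snd p \<and> snd p < u (fst p)} (x, t) \<partial>lborel)"
      by (rule nn_integral_cong) (auto simp: indicator_def)
    finally show "emeasure lborel {x. t < u x} * indicator {0..} t =
      (\<integral>\<^sup>+x. indicator {p. 0 \<le> snd p \<and> snd p < u (fst p)} (x, t) \<partial>lborel)" .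
  qed
  also have "\<dots> = (\<integral>\<^sup>+x. (\<integral>\<^sup>+t. indicator {p. 0 \<le> snd p \<and> snd p < u (fst p)} (x, t) \<partial>lborel) \<partial>lborel)"
    by (rule lborel_pair.Fubini') measurable
  also have "\<dots> = (\<integral>\<^sup>+x. ennreal (u x) \<partial>lborel)"
  proof (rule nn_integral_cong)
    fix x
    have "(\<integral>\<^sup>+t. indicator {p. 0 \<le> snd p \<and> snd p < u (fst p)} (x, t) \<partial>lborel) = (\<integral>\<^sup>+t. indicator {0..<u x} t \<partial>lborel)"
      by (rule nn_integral_cong) (auto simp: indicator_def)
    then show "(\<integral>\<^sup>+t. indicator {p. 0 \<le> snd p \<and> snd p < u (fst p)} (x, t) \<partial>lborel) = ennreal (u x)"
      using u0[of x] by simp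
  qed
  finally show ?thesis .
qed

text \<open>The coarea inequality in the form in which it is applied. With the lower bound
  \<open>lam\<close> on each level as a hypothesis, the measure of the superlevel sets is integrated
  in place of their perimeter, whose measurability in \<open>t\<close> would otherwise be an
  issue.\<close>

theorem superlevel_perimeter_le_total_variation:
  fixes u :: "'a::euclidean_space \<Rightarrow> real"
  assumes u: "integrable lborel u" and u0: "\<And>x. 0 \<le> u x" and supp: "\<And>x. R \<le> norm x \<Longrightarrow> u x = 0"
    and TV: "total_variation u \<le> ereal T" and lam: "0 \<le> lam"
    and level: "\<And>t. 0 \<le> t \<Longrightarrow> ereal (lam * measure lborel {x. t < u x}) \<le> perimeter {x. t < u x}"
  shows "lam * integral\<^sup>L lborel u \<le> T"
proof -
  have T0: "0 \<le> T" using order_trans[OF total_variation_nonneg TV] by simp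
  have [measurable]: "u \<in> borel_measurable borel" using u by simp
  obtain v w where vw: "\<And>n. C1_grad (v n) (w n)" "\<And>n x. R + 1 \<le> norm x \<Longrightarrow> v n x = 0"
    "\<And>n x. R + 1 \<le> norm x \<Longrightarrow> w n x = 0" "\<And>n. (\<integral>x. norm (w n x) \<partial>lborel) \<le> T"
    and lim: "(\<lambda>n. \<integral>x. \<bar>v n x - u x\<bar> \<partial>lborel) \<longlonglongrightarrow> 0"
    by (rule smooth_approximation[OF u supp TV], assumption, rule that)
  have vi: "integrable lborel (v n)" for n
    by (rule continuous_vanishing_integrable[OF C1_grad_continuous(1)[OF vw(1)] vw(2)])
  have wi: "integrable lborel (w n)" for n
    by (rule continuous_vanishing_integrable[OF C1_grad_continuous(2)[OF vw(1)] vw(3)])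
  have [measurable]: "v n \<in> borel_measurable borel" "w n \<in> borel_measurable borel" for n
    using C1_grad_measurable[OF vw(1)] by auto
  \<comment> \<open>Convergence almost everywhere, along a subsequence, is what the step functions
    below can follow.\<close>
  obtain s :: "nat \<Rightarrow> nat" where s: "strict_mono s" and AEs: "AE x in lborel. (\<lambda>n. v (s n) x - u x) \<longlonglongrightarrow> 0"
    using tendsto_L1_AE_subseq[of lborel "\<lambda>n x. v n x - u x"] vi u lim by auto
  have AEv: "AE x in lborel. (\<lambda>n. v (s n) x) \<longlonglongrightarrow> u x"
    using AEs by eventually_elim (rule LIM_zero_cancel)
  \<comment> \<open>A bound for the \<open>n\<close>-th smooth slice at level \<open>t\<close>
    against all test fields simultaneously. Being free of the field and measurable in
    \<open>t\<close>, it is the quantity to which Fatou applies.\<close>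
  define D where "D n t = (\<integral>\<^sup>+x. ennreal (step_deriv (real (Suc n)) (v (s n) x - t) * norm (w (s n) x)) \<partial>lborel)" for n t
  have [measurable]: "D n \<in> borel_measurable borel" for n
    unfolding D_def[abs_def] by measurable
  have D_le: "(\<integral>\<^sup>+t. D n t * indicator {0..} t \<partial>lborel) \<le> ennreal T" for n
  proof -
    have "(\<integral>\<^sup>+t. D n t * indicator {0..} t \<partial>lborel) \<le> (\<integral>\<^sup>+x. ennreal (norm (w (s n) x)) \<partial>lborel)"
      unfolding D_def by (rule nn_integral_step_slices_le) auto
    also have "\<dots> = ennreal (\<integral>x. norm (w (s n) x) \<partial>lborel)"
      using wi by (intro nn_integral_eq_integral) auto
    also have "\<dots> \<le> ennreal T" by (intro ennreal_leI vw(4))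
    finally show ?thesis .
  qed
  \<comment> \<open>Exchanging the quantifiers is Fubini for the graph of \<open>u\<close>: almost
    every level is attained only on a null set, and at such levels the smooth steps converge to the
    indicator.\<close>
  have "AE x in lborel. AE t in lborel. u x \<noteq> t"
  proof (rule AE_I2)
    fix x
    show "AE t in lborel. u x \<noteq> t"
      using AE_lborel_singleton[of "u x"] by eventually_elim simp
  qed
  then have AEt: "AE t in lborel. AE x in lborel. u x \<noteq> t"
    by (subst (asm) lborel_pair.AE_commute) measurable
  \<comment> \<open>Lower semicontinuity of the perimeter: the limit is taken for one field at a
    time, and the resulting bound is the same for all of them.\<close>
  have per: "perimeter {x. t < u x} \<le> enn2ereal (liminf (\<lambda>n. D n t))" if t: "AE x in lborel. u x \<noteq> t" for t
    unfolding perimeter_def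
  proof (rule total_variation_leI)
    have [measurable]: "{x. t < u x} \<in> sets borel" by measurable
    show "indicat_real {x. t < u x} \<in> borel_measurable borel" by measurable
    fix p :: "('a \<Rightarrow> 'a) \<times> ('a \<Rightarrow> 'a \<Rightarrow>\<^sub>L 'a)" assume p: "p \<in> test_fields"
    have [measurable]: "divergence (snd p) \<in> borel_measurable borel"
      and di: "integrable lborel (divergence (snd p))"
      by (rule test_fieldE[OF p], assumption)+
    have "(\<lambda>n. \<integral>x. step (real (Suc n)) (v (s n) x - t) * divergence (snd p) x \<partial>lborel)
        \<longlonglongrightarrow> (\<integral>x. indicat_real {x. t < u x} x * divergence (snd p) x \<partial>lborel)"
    proof (rule integral_dominated_convergence[where w="\<lambda>x. \<bar>divergence (snd p) x\<bar>"])
      show "AE x in lborel. (\<lambda>n. step (real (Suc n)) (v (s n) x - t) * divergence (snd p) x)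
          \<longlonglongrightarrow> indicat_real {x. t < u x} x * divergence (snd p) x"
        using AEv t
      proof eventually_elim
        case (elim x)
        have "indicat_real {t<..} (u x) = indicat_real {x. t < u x} x" by (simp add: indicator_def)
        then show ?case using step_tendsto[OF elim] by (intro tendsto_mult tendsto_const) simp
      qed
      show "AE x in lborel. norm (step (real (Suc n)) (v (s n) x - t) * divergence (snd p) x) \<le> \<bar>divergence (snd p) x\<bar>" for n
        using step_bounds by (intro AE_I2) (simp add: abs_mult mult_left_le_one_le)
    qed (use di in auto)
    then have "(\<lambda>n. ennreal (\<integral>x. step (real (Suc n)) (v (s n) x - t) * divergence (snd p) x \<partial>lborel))
        \<longlonglongrightarrow> ennreal (\<integral>x. indicat_real {x. t < u x} x * divergence (snd p) x \<partial>lborel)"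
      by (rule tendsto_ennrealI)
    then have "ennreal (\<integral>x. indicat_real {x. t < u x} x * divergence (snd p) x \<partial>lborel)
      = liminf (\<lambda>n. ennreal (\<integral>x. step (real (Suc n)) (v (s n) x - t) * divergence (snd p) x \<partial>lborel))"
      by (intro lim_imp_Liminf[symmetric]) auto
    also have "\<dots> \<le> liminf (\<lambda>n. D n t)"
      unfolding D_def by (intro Liminf_mono always_eventually allI integral_step_divergence_le[OF vw(1) _ p]) simp
    finally have "enn2ereal (ennreal (\<integral>x. indicat_real {x. t < u x} x * divergence (snd p) x \<partial>lborel)) \<le> enn2ereal (liminf (\<lambda>n. D n t))"
      by (simp add: less_eq_ennreal.rep_eq)
    \<comment> \<open>Negative integrals are cut to 0 in \<open>ennreal\<close>, so coming back is
      an inequality, in the useful direction.\<close>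
    moreover have "ereal y \<le> enn2ereal (ennreal y)" for y
      by (cases "0 \<le> y") (auto simp: enn2ereal_ennreal ennreal_neg zero_ennreal.rep_eq)
    ultimately show "ereal (\<integral>x. indicat_real {x. t < u x} x * divergence (snd p) x \<partial>lborel) \<le> enn2ereal (liminf (\<lambda>n. D n t))"
      by (rule order_trans[rotated])
  qed
  have fin: "emeasure lborel {x. t < u x} = ennreal (measure lborel {x. t < u x})" if "0 \<le> t" for t
  proof -
    have "{x. t < u x} \<subseteq> ball 0 R" using supp that by (force simp: not_le)
    then have "emeasure lborel {x. t < u x} \<le> emeasure lborel (ball (0::'a) R)"
      by (intro emeasure_mono) auto
    then show ?thesis
      using emeasure_lborel_ball_finite[of "0::'a" R] by (intro emeasure_eq_ennreal_measure) (auto simp: top_unique)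
  qed
  have "ennreal (lam * integral\<^sup>L lborel u) = ennreal lam * (\<integral>\<^sup>+x. ennreal (u x) \<partial>lborel)"
    using lam u u0 by (simp add: ennreal_mult nn_integral_eq_integral)
  also have "\<dots> = (\<integral>\<^sup>+t. ennreal lam * (emeasure lborel {x. t < u x} * indicator {0..} t) \<partial>lborel)"
    unfolding nn_integral_layer_cake[OF \<open>u \<in> borel_measurable borel\<close> u0, symmetric]
    by (rule nn_integral_cmult[symmetric]) measurable
  also have "\<dots> \<le> (\<integral>\<^sup>+t. liminf (\<lambda>n. D n t * indicator {0..} t) \<partial>lborel)"
  proof (rule nn_integral_mono_AE)
    show "AE t in lborel. ennreal lam * (emeasure lborel {x. t < u x} * indicator {0..} t) \<le> liminf (\<lambda>n. D n t * indicator {0..} t)"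
      using AEt
    proof eventually_elim
      case (elim t)
      show ?case
      proof (cases "0 \<le> t")
        case True
        have "ereal (lam * measure lborel {x. t < u x}) \<le> enn2ereal (liminf (\<lambda>n. D n t))"
          by (rule order_trans[OF level[OF True] per[OF elim]])
        then have "enn2ereal (ennreal (lam * measure lborel {x. t < u x})) \<le> enn2ereal (liminf (\<lambda>n. D n t))"
          using lam by (simp add: enn2ereal_ennreal)
        then have "ennreal (lam * measure lborel {x. t < u x}) \<le> liminf (\<lambda>n. D n t)"
          by (simp add: less_eq_ennreal.rep_eq)
        then show ?thesis using True lam by (simp add: fin ennreal_mult)
      qed simp
    qed
  qed
  also have "\<dots> \<le> liminf (\<lambda>n. \<integral>\<^sup>+t. D n t * indicator {0..} t \<partial>lborel)"
    by (rule nn_integral_liminf) measurable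
  also have "\<dots> \<le> liminf (\<lambda>n. ennreal T)"
    by (intro Liminf_mono always_eventually allI D_le)
  also have "\<dots> = ennreal T" by (simp add: Liminf_const)
  finally show ?thesis using T0 by (simp add: ennreal_le_iff)
qed

text \<open>
  A weak isoperimetric inequality: the translation estimate is averaged over \<open>z\<close> in the ball of
  radius \<open>r\<close>, over which the overlap of \<open>F\<close> with its translates integrates to at most \<open>|F|\<^sup>2\<close>.
\<close>

lemma small_set_perimeter:
  fixes F :: "'a::euclidean_space set"
  assumes F[measurable]: "F \<in> sets borel" and FR: "F \<subseteq> ball 0 R" and P: "perimeter F \<le> ereal P"
    and pos: "0 < measure lborel F" and r: "0 < r" and small: "2 * measure lborel F < measure lborel (ball (0::'a) r)"
  shows "measure lborel F \<le> r * P"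
proof (rule ccontr)
  let ?I = "indicat_real F"
  define m where "m = measure lborel F"
  define b where "b = measure lborel (ball (0::'a) r)"
  assume "\<not> measure lborel F \<le> r * P"
  then have contra: "r * P < m" by (simp add: m_def)
  have "emeasure lborel F \<le> emeasure lborel (ball (0::'a) R)" using FR by (intro emeasure_mono) auto
  then have Ffin: "emeasure lborel F < \<infinity>"
    using emeasure_lborel_ball_finite[of "0::'a" R] by (rule order.strict_trans1)
  have Fm: "emeasure lborel F = ennreal m" unfolding m_def
    using Ffin by (intro emeasure_eq_ennreal_measure) auto
  have Bm: "emeasure lborel (ball (0::'a) r) = ennreal b" unfolding b_def
    using emeasure_lborel_ball_finite[of "0::'a" r] by (intro emeasure_eq_ennreal_measure) auto
  have Ii: "integrable lborel ?I" using Ffin by (intro integrable_real_indicator) auto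
  have P0: "0 \<le> P" using order_trans[OF total_variation_nonneg P[unfolded perimeter_def]] by simp
  define c where "c z = (\<integral>x. ?I x * ?I (x + z) \<partial>lborel)" for z
  have ci: "integrable lborel (\<lambda>x. ?I x * ?I (x + z))" for z
    by (rule Bochner_Integration.integrable_bound[OF Ii]) (auto simp: indicator_def)
  \<comment> \<open>\<open>F\<close> and its translate differ in a set of measure
    \<open>2 * m - 2 * c z\<close>. The translation estimate bounds this by \<open>r * P\<close>,
    which is below \<open>m\<close> under the assumption to be refuted.\<close>
  have c_ge: "m / 2 \<le> c z" if "norm z < r" for z
  proof -
    have "(\<integral>x. \<bar>?I (x + z) - ?I x\<bar> \<partial>lborel) \<le> norm z * P"
    proof (rule integral_translate_le_total_variation[OF Ii _ P[unfolded perimeter_def]])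
      show "?I x = 0" if "R \<le> norm x" for x using FR that by (auto simp: indicator_def)
    qed
    also have "\<dots> \<le> r * P" using that P0 by (intro mult_right_mono) auto
    also have "(\<integral>x. \<bar>?I (x + z) - ?I x\<bar> \<partial>lborel) = (\<integral>x. ?I (x + z) + ?I x - 2 * (?I x * ?I (x + z)) \<partial>lborel)"
      by (rule Bochner_Integration.integral_cong) (auto simp: indicator_def)
    also have "\<dots> = (\<integral>x. ?I (x + z) \<partial>lborel) + (\<integral>x. ?I x \<partial>lborel) - 2 * c z"
      using ci Ii integrable_lborel_plus[OF Ii, of z] by (simp add: c_def)
    also have "(\<integral>x. ?I (x + z) \<partial>lborel) = (\<integral>x. ?I x \<partial>lborel)"
      by (rule integral_lborel_plus) simp
    also have "(\<integral>x. ?I x \<partial>lborel) = m" using F by (simp add: m_def)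
    finally show ?thesis using contra by linarith
  qed
  have cnn: "(\<integral>\<^sup>+x. ennreal (?I x * ?I (x + z)) \<partial>lborel) = ennreal (c z)" for z
    unfolding c_def by (rule nn_integral_eq_integral[OF ci]) simp
  have "ennreal (m / 2 * b) = (\<integral>\<^sup>+z. ennreal (m / 2) * indicator (ball (0::'a) r) z \<partial>lborel)"
  proof -
    have "(\<integral>\<^sup>+z. ennreal (m / 2) * indicator (ball (0::'a) r) z \<partial>lborel) = ennreal (m / 2) * ennreal b"
      unfolding Bm[symmetric] by (rule nn_integral_cmult_indicator) simp
    moreover have "ennreal (m / 2 * b) = ennreal (m / 2) * ennreal b"
      by (rule ennreal_mult) (simp_all add: m_def b_def)
    ultimately show ?thesis by simp
  qed
  also have "\<dots> \<le> (\<integral>\<^sup>+z. ennreal (c z) \<partial>lborel)"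
    by (rule nn_integral_mono) (auto simp: indicator_def intro!: ennreal_leI c_ge)
  also have "\<dots> = (\<integral>\<^sup>+z. (\<integral>\<^sup>+x. ennreal (?I x * ?I (x + z)) \<partial>lborel) \<partial>lborel)"
    by (simp add: cnn)
  also have "\<dots> = (\<integral>\<^sup>+x. (\<integral>\<^sup>+z. ennreal (?I x * ?I (x + z)) \<partial>lborel) \<partial>lborel)"
    by (rule lborel_pair.Fubini') measurable
  also have "\<dots> = (\<integral>\<^sup>+x. ennreal (?I x) * ennreal m \<partial>lborel)"
  proof (rule nn_integral_cong)
    fix x
    have "(\<integral>\<^sup>+z. ennreal (?I x * ?I (x + z)) \<partial>lborel) = ennreal (?I x) * (\<integral>\<^sup>+z. ennreal (?I (z + x)) \<partial>lborel)"
      by (simp add: ennreal_mult nn_integral_cmult add.commute)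
    also have "(\<integral>\<^sup>+z. ennreal (?I (z + x)) \<partial>lborel) = (\<integral>\<^sup>+z. ennreal (?I z) \<partial>lborel)"
      by (rule nn_integral_lborel_plus) simp
    also have "\<dots> = ennreal m" using Fm F by (simp add: ennreal_indicator)
    finally show "(\<integral>\<^sup>+z. ennreal (?I x * ?I (x + z)) \<partial>lborel) = ennreal (?I x) * ennreal m" .
  qed
  also have "\<dots> = ennreal (m * m)"
    using Fm F by (simp add: nn_integral_multc ennreal_indicator ennreal_mult m_def)
  finally have "m / 2 * b \<le> m * m" by (subst (asm) ennreal_le_iff) auto
  then have "b \<le> 2 * m" using pos by (simp add: m_def)
  then show False using small by (simp add: m_def b_def)
qed

section \<open>Existence of Cheeger functions\<close>

lemma total_variation_le_iff:
  assumes "u \<in> borel_measurable borel"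
  shows "total_variation u \<le> ereal c \<longleftrightarrow> (\<forall>p\<in>test_fields. (\<integral>x. u x * divergence (snd p) x \<partial>lborel) \<le> c)"
proof
  assume *: "total_variation u \<le> ereal c"
  show "\<forall>p\<in>test_fields. (\<integral>x. u x * divergence (snd p) x \<partial>lborel) \<le> c"
    using order_trans[OF test_field_le_total_variation[OF assms] *] by simp
qed (auto intro!: total_variation_leI[OF assms])

text \<open>Along a fast subsequence the squared L^2 gaps are at most \<open>(1 / 4) ^ k\<close>. As
  everything lives on a set of finite measure, the L^1 gaps are then of order
  \<open>(1 / 2) ^ k\<close>, so the telescoping series converges absolutely almost
  everywhere.\<close>

lemma L2_Cauchy_imp_AE_convergent_subseq:
  fixes g :: "nat \<Rightarrow> 'a \<Rightarrow> real"
  assumes fin: "emeasure M E < \<infinity>" and [measurable]: "E \<in> sets M" "\<And>n. g n \<in> borel_measurable M"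
    and g0: "\<And>n x. x \<notin> E \<Longrightarrow> g n x = 0" and g1: "\<And>n x. \<bar>g n x\<bar> \<le> 1"
    and Cauchy: "\<And>e. 0 < e \<Longrightarrow> \<exists>N. \<forall>n\<ge>N. \<forall>m\<ge>N. (\<integral>x. (g n x - g m x)\<^sup>2 \<partial>M) \<le> e"
  shows "\<exists>s. strict_mono s \<and> (AE x in M. convergent (\<lambda>k. g (s k) x))"
proof -
  have "\<exists>N. \<forall>n\<ge>N. \<forall>m\<ge>N. (\<integral>x. (g n x - g m x)\<^sup>2 \<partial>M) \<le> (1 / 4) ^ k" for k :: nat
    by (rule Cauchy) simp
  then obtain N where N: "\<And>k n m. N k \<le> n \<Longrightarrow> N k \<le> m \<Longrightarrow> (\<integral>x. (g n x - g m x)\<^sup>2 \<partial>M) \<le> (1 / 4) ^ k"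
    by metis
  \<comment> \<open>The sum ensures \<open>N k \<le> s k\<close>; the summand \<open>k\<close> makes
    \<open>s\<close> strictly increasing.\<close>
  define s where "s k = (\<Sum>i\<le>k. N i) + k" for k
  have s: "strict_mono s" by (rule strict_monoI_Suc) (simp add: s_def)
  have sN: "N k \<le> s k" for k unfolding s_def using member_le_sum[of k "{..k}" N] by simp
  have sN': "N k \<le> s (Suc k)" for k using sN[of k] s by (meson le_trans less_or_eq_imp_le lessI strict_mono_def)
  have Ei: "integrable M (indicat_real E)" using fin by (intro integrable_real_indicator) auto
  have i2: "integrable M (\<lambda>x. (g n x - g m x)\<^sup>2)" for n m
  proof (rule Bochner_Integration.integrable_bound[OF integrable_mult_right[OF Ei, of 4]])
    show "AE x in M. norm ((g n x - g m x)\<^sup>2) \<le> norm (4 * indicat_real E x)"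
    proof (rule AE_I2)
      fix x
      have "\<bar>g n x - g m x\<bar> \<le> 2" using g1[of n x] g1[of m x] by linarith
      then have "\<bar>g n x - g m x\<bar>\<^sup>2 \<le> 2\<^sup>2" by (intro power_mono) auto
      then show "norm ((g n x - g m x)\<^sup>2) \<le> norm (4 * indicat_real E x)"
        using g0[of x n] g0[of x m] by (cases "x \<in> E") auto
    qed
  qed measurable
  have i1: "integrable M (\<lambda>x. \<bar>g n x - g m x\<bar>)" for n m
  proof (rule Bochner_Integration.integrable_bound[OF integrable_mult_right[OF Ei, of 2]])
    show "AE x in M. norm \<bar>g n x - g m x\<bar> \<le> norm (2 * indicat_real E x)"
    proof (rule AE_I2)
      fix x
      have "\<bar>g n x - g m x\<bar> \<le> 2" using g1[of n x] g1[of m x] by linarith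
      then show "norm \<bar>g n x - g m x\<bar> \<le> norm (2 * indicat_real E x)"
        using g0[of x n] g0[of x m] by (cases "x \<in> E") auto
    qed
  qed measurable
  define c where "c = measure M E + 1"
  have L1: "(\<integral>x. \<bar>g (s (Suc k)) x - g (s k) x\<bar> \<partial>M) \<le> c * (1 / 2) ^ k" for k
  proof -
    let ?d = "\<lambda>x. g (s (Suc k)) x - g (s k) x"
    \<comment> \<open>Young's inequality with weight \<open>2 ^ k\<close>, chosen so that both terms
      contribute a multiple of \<open>(1 / 2) ^ k\<close>.\<close>
    have "(\<integral>x. \<bar>?d x\<bar> \<partial>M) \<le> (\<integral>x. (1 / 2) ^ k * indicat_real E x + 2 ^ k * (?d x)\<^sup>2 \<partial>M)"
    proof (rule integral_mono[OF i1])
      show "integrable M (\<lambda>x. (1 / 2) ^ k * indicat_real E x + 2 ^ k * (?d x)\<^sup>2)"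
        using Ei i2 by simp
      fix x
      show "\<bar>?d x\<bar> \<le> (1 / 2) ^ k * indicat_real E x + 2 ^ k * (?d x)\<^sup>2"
      proof (cases "x \<in> E")
        case True
        define a where "a = (2::real) ^ k"
        have a: "a > 0" "(1 / 2) ^ k = 1 / a" by (simp_all add: a_def power_divide)
        have "0 \<le> (a * \<bar>?d x\<bar> - 1)\<^sup>2 + a * \<bar>?d x\<bar>" using a by simp
        then have "a * \<bar>?d x\<bar> \<le> 1 + a * (a * (?d x)\<^sup>2)"
          by (simp add: power2_eq_square algebra_simps abs_mult_self_eq)
        then have "\<bar>?d x\<bar> \<le> (1 + a * (a * (?d x)\<^sup>2)) / a"
          using a by (simp add: pos_le_divide_eq mult.commute)
        also have "\<dots> = 1 / a + a * (?d x)\<^sup>2" using a by (simp add: add_divide_distrib)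
        finally show ?thesis using True a by (simp add: a_def)
      qed (simp add: g0)
    qed
    also have "\<dots> = (1 / 2) ^ k * measure M E + 2 ^ k * (\<integral>x. (?d x)\<^sup>2 \<partial>M)"
      using Ei i2 by simp
    also have "\<dots> \<le> (1 / 2) ^ k * measure M E + 2 ^ k * (1 / 4) ^ k"
      by (intro add_left_mono mult_left_mono N sN sN') simp
    also have "2 ^ k * (1 / 4) ^ k = (1 / 2 :: real) ^ k"
      by (simp add: power_mult_distrib[symmetric])
    finally show ?thesis by (simp add: c_def algebra_simps)
  qed
  have "(\<integral>\<^sup>+x. (\<Sum>k. ennreal \<bar>g (s (Suc k)) x - g (s k) x\<bar>) \<partial>M)
    = (\<Sum>k. \<integral>\<^sup>+x. ennreal \<bar>g (s (Suc k)) x - g (s k) x\<bar> \<partial>M)"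
    by (rule nn_integral_suminf) measurable
  also have "\<dots> = (\<Sum>k. ennreal (\<integral>x. \<bar>g (s (Suc k)) x - g (s k) x\<bar> \<partial>M))"
    using i1 by (intro suminf_cong nn_integral_eq_integral) auto
  also have "\<dots> \<le> (\<Sum>k. ennreal (c * (1 / 2) ^ k))"
    by (intro suminf_le ennreal_leI L1) auto
  also have "\<dots> < \<infinity>"
    unfolding infinity_ennreal_def less_top[symmetric]
    by (intro ennreal_suminf_neq_top summable_mult summable_geometric) (auto simp: c_def)
  finally have "(\<integral>\<^sup>+x. (\<Sum>k. ennreal \<bar>g (s (Suc k)) x - g (s k) x\<bar>) \<partial>M) \<noteq> \<infinity>"
    by simp
  then have "AE x in M. (\<Sum>k. ennreal \<bar>g (s (Suc k)) x - g (s k) x\<bar>) \<noteq> \<infinity>"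
    by (intro nn_integral_PInf_AE) measurable
  then have "AE x in M. convergent (\<lambda>k. g (s k) x)"
  proof eventually_elim
    case (elim x)
    then have "summable (\<lambda>k. \<bar>g (s (Suc k)) x - g (s k) x\<bar>)"
      by (intro summable_suminf_not_top) auto
    then have "summable (\<lambda>k. g (s (Suc k)) x - g (s k) x)"
      by (rule summable_rabs_cancel)
    then have "convergent (\<lambda>n. \<Sum>k<n. g (s (Suc k)) x - g (s k) x)"
      by (simp add: summable_iff_convergent)
    moreover have "(\<lambda>n. \<Sum>k<n. g (s (Suc k)) x - g (s k) x) = (\<lambda>n. g (s n) x - g (s 0) x)"
      using sum_lessThan_telescope[of "\<lambda>k. g (s k) x"] by (intro ext)
    ultimately have "convergent (\<lambda>n. g (s n) x - g (s 0) x)" by simp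
    from convergent_add[OF this convergent_const[of "g (s 0) x"]] show ?case by simp
  qed
  then show ?thesis using s by blast
qed

text \<open>The projection argument for convex sets, run along a decreasing family. For
  \<open>n \<le> m\<close> both elements and their midpoint lie in \<open>A n\<close>, so the
  midpoint has squared norm at least \<open>a n\<close>, and the parallelogram law bounds the
  distance by the gap \<open>a m - a n\<close> and the selection errors. The infima
  \<open>a n\<close> increase and stay below \<open>C\<close>, so the gaps tend to zero.\<close>

lemma norm_minimizing_sequence_L2_Cauchy:
  fixes A :: "nat \<Rightarrow> ('a \<Rightarrow> real) set"
  assumes ne: "\<And>n. A n \<noteq> {}" and dec: "\<And>n m. n \<le> m \<Longrightarrow> A m \<subseteq> A n"
    and mid: "\<And>n f g. f \<in> A n \<Longrightarrow> g \<in> A n \<Longrightarrow> (\<lambda>x. (f x + g x) / 2) \<in> A n"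
    and meas: "\<And>n f. f \<in> A n \<Longrightarrow> f \<in> borel_measurable M"
    and int: "\<And>n f. f \<in> A n \<Longrightarrow> integrable M (\<lambda>x. (f x)\<^sup>2)"
    and bnd: "\<And>n f. f \<in> A n \<Longrightarrow> (\<integral>x. (f x)\<^sup>2 \<partial>M) \<le> C"
  shows "\<exists>g. (\<forall>n. g n \<in> A n) \<and>
    (\<forall>e>0. \<exists>N. \<forall>n\<ge>N. \<forall>m\<ge>N. (\<integral>x. (g n x - g m x)\<^sup>2 \<partial>M) \<le> e)"
proof -
  define q where "q f = (\<integral>x. (f x)\<^sup>2 \<partial>M)" for f :: "'a \<Rightarrow> real"
  define a where "a n = Inf (q ` A n)" for n
  have bb: "bdd_below (q ` A n)" for n
    by (rule bdd_belowI[of _ 0]) (auto simp: q_def)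
  have ale: "a n \<le> q f" if "f \<in> A n" for n f
    unfolding a_def by (rule cInf_lower[OF _ bb]) (use that in auto)
  have amono: "a n \<le> a m" if "n \<le> m" for n m
    unfolding a_def by (rule cInf_superset_mono) (use ne bb dec[OF that] in auto)
  have aC: "a n \<le> C" for n
    using ne[of n] ale[of _ n] bnd[of _ n] unfolding q_def by (meson ex_in_conv order_trans)
  have "\<exists>f. f \<in> A n \<and> q f < a n + inverse (real (Suc n))" for n
  proof -
    have "Inf (q ` A n) < a n + inverse (real (Suc n))" by (simp add: a_def)
    then show ?thesis using cInf_lessD[of "q ` A n"] ne[of n] by blast
  qed
  then obtain g where g: "\<And>n. g n \<in> A n" "\<And>n. q (g n) < a n + inverse (real (Suc n))" by metis
  have key: "(\<integral>x. (g n x - g m x)\<^sup>2 \<partial>M) \<le> 2 * (a m - a n) + 4 * inverse (real (Suc n))" if "n \<le> m" for n m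
  proof -
    have gm: "g m \<in> A n" using g(1)[of m] dec[OF that] by blast
    let ?h = "\<lambda>x. (g n x + g m x) / 2"
    have h: "?h \<in> A n" by (rule mid[OF g(1) gm])
    note i = int[OF g(1)[of n]] int[OF gm] int[OF h]
    have "(\<integral>x. (g n x - g m x)\<^sup>2 \<partial>M) = (\<integral>x. 2 * (g n x)\<^sup>2 + 2 * (g m x)\<^sup>2 - 4 * (?h x)\<^sup>2 \<partial>M)"
      by (rule Bochner_Integration.integral_cong) (auto simp: power2_eq_square field_simps)
    also have "\<dots> = 2 * q (g n) + 2 * q (g m) - 4 * q ?h"
      using i unfolding q_def by simp
    also have "\<dots> \<le> 2 * (a n + inverse (real (Suc n))) + 2 * (a m + inverse (real (Suc m))) - 4 * a n"
    proof -
      have "2 * y + 2 * z - 4 * w \<le> 2 * y' + 2 * z' - 4 * w'" if "y < y'" "z < z'" "w' \<le> w" for y y' z z' w w' :: real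
        using that by linarith
      from this[OF g(2)[of n] g(2)[of m] ale[OF h]] show ?thesis .
    qed
    also have "\<dots> \<le> 2 * (a m - a n) + 4 * inverse (real (Suc n))"
      using le_imp_inverse_le[of "real (Suc n)" "real (Suc m)"] that by simp
    finally show ?thesis .
  qed
  have "incseq a" using amono by (simp add: incseq_def)
  then obtain L where "a \<longlonglongrightarrow> L"
    by (rule incseq_convergent[of a C]) (use aC in auto)
  then have "convergent a" by (rule convergentI)
  then have Ca: "Cauchy a" by (rule convergent_Cauchy)
  show ?thesis
  proof (intro exI[of _ g] conjI allI impI g(1))
    fix e :: real assume e: "0 < e"
    obtain N1 where N1: "\<And>m n. N1 \<le> m \<Longrightarrow> N1 \<le> n \<Longrightarrow> \<bar>a m - a n\<bar> < e / 4"
      using CauchyD[OF Ca, of "e / 4"] e by auto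
    obtain N2 where N2: "inverse (real (Suc N2)) < e / 8"
      using reals_Archimedean[of "e / 8"] e by auto
    have le: "(\<integral>x. (g n x - g m x)\<^sup>2 \<partial>M) \<le> e" if "max N1 N2 \<le> n" "n \<le> m" for n m
    proof -
      have "inverse (real (Suc n)) \<le> inverse (real (Suc N2))"
        using that by (intro le_imp_inverse_le) auto
      moreover have "\<bar>a m - a n\<bar> < e / 4" using N1[of m n] that by simp
      ultimately have "2 * (a m - a n) + 4 * inverse (real (Suc n)) \<le> e" using N2 by argo
      with key[OF that(2)] show ?thesis by (rule order_trans)
    qed
    have "(\<integral>x. (g n x - g m x)\<^sup>2 \<partial>M) \<le> e" if "max N1 N2 \<le> n" "max N1 N2 \<le> m" for n m
      using le[of n m] le[of m n] that by (cases "n \<le> m") (auto simp: power2_commute)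
    then show "\<exists>N. \<forall>n\<ge>N. \<forall>m\<ge>N. (\<integral>x. (g n x - g m x)\<^sup>2 \<partial>M) \<le> e" by blast
  qed
qed

text \<open>Together \<open>lower\<close> and \<open>upper\<close> say that \<open>lam\<close> is
  the infimum of perimeter over measure among Borel subsets of \<open>E\<close> of positive measure.
  For the limit function, \<open>\<le>\<close> passes to the limit one test field at a time;
  \<open>\<ge>\<close> is the coarea inequality, with \<open>lower\<close> applied to the superlevel
  sets.\<close>

theorem cheeger_function_exists:
  fixes E :: "'a::euclidean_space set"
  assumes E[measurable]: "E \<in> sets borel" and ER: "E \<subseteq> ball 0 R" and lam: "0 \<le> lam"
    and lower: "\<And>S. S \<in> sets borel \<Longrightarrow> S \<subseteq> E \<Longrightarrow> 0 < measure lborel S \<Longrightarrow> ereal (lam * measure lborel S) \<le> perimeter S"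
    and upper: "\<And>e. 0 < e \<Longrightarrow> \<exists>S. S \<in> sets borel \<and> S \<subseteq> E \<and> 0 < measure lborel S \<and>
      perimeter S \<le> ereal ((lam + e) * measure lborel S)"
  obtains g where "g \<in> borel_measurable borel" "\<And>x. 0 \<le> g x" "\<And>x. x \<notin> E \<Longrightarrow> g x = 0"
    "integrable lborel g" "0 < integral\<^sup>L lborel g" "total_variation g = ereal (lam * integral\<^sup>L lborel g)"
proof -
  have "emeasure lborel E \<le> emeasure lborel (ball (0::'a) R)" using ER by (intro emeasure_mono) auto
  then have Efin: "emeasure lborel E < \<infinity>"
    using emeasure_lborel_ball_finite[of "0::'a" R] by (rule order.strict_trans1)
  have Ei: "integrable lborel (indicat_real E)" using Efin by (intro integrable_real_indicator) auto
  define c where "c = measure lborel E"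
  \<comment> \<open>Half the volume of a ball of radius \<open>r = 1 / (2 * (lam + 1))\<close>. A
    set of smaller positive measure whose perimeter is at most \<open>lam + 1\<close> times its
    measure would have measure at most \<open>r\<close> times its perimeter, hence at most half of
    itself.\<close>
  define m where "m = measure lborel (ball (0::'a) (1 / (2 * (lam + 1)))) / 2"
  have m: "0 < m" unfolding m_def using lam by (simp add: content_ball_pos)
  \<comment> \<open>Spelling out total variation through test fields makes every constraint affine
    in \<open>g\<close>, so midpoints stay in the set. The error carries
    \<open>c = measure lborel E\<close> because an excess ratio \<open>e\<close> costs a subset
    \<open>S\<close> of \<open>E\<close> at most \<open>e * c\<close>.\<close>
  define A where "A n = {g :: 'a \<Rightarrow> real. g \<in> borel_measurable borel \<and> (\<forall>x. 0 \<le> g x \<and> g x \<le> indicator E x)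
    \<and> m \<le> integral\<^sup>L lborel g \<and> (\<forall>p\<in>test_fields. (\<integral>x. g x * divergence (snd p) x \<partial>lborel)
      \<le> lam * integral\<^sup>L lborel g + c * inverse (real (Suc n)))}" for n
  have AD: "g \<in> borel_measurable borel" "0 \<le> g x" "g x \<le> indicator E x" "m \<le> integral\<^sup>L lborel g"
    "p \<in> test_fields \<Longrightarrow> (\<integral>x. g x * divergence (snd p) x \<partial>lborel) \<le> lam * integral\<^sup>L lborel g + c * inverse (real (Suc n))"
    if "g \<in> A n" for g n x p using that by (auto simp: A_def)
  have Aint: "integrable lborel g" if "g \<in> A n" for g n
    by (rule Bochner_Integration.integrable_bound[OF Ei]) (use AD[OF that] in \<open>auto intro!: AE_I2\<close>)
  have A1: "g x \<le> 1" "x \<notin> E \<Longrightarrow> g x = 0" if "g \<in> A n" for g n x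
    using AD(2,3)[OF that, of x] by (cases "x \<in> E"; simp)+
  have Asq: "(g x)\<^sup>2 \<le> indicat_real E x" if "g \<in> A n" for g n x
    using AD(2)[OF that, of x] A1[OF that, of x] by (cases "x \<in> E") (auto simp: power_le_one)
  have Aint2: "integrable lborel (\<lambda>x. (g x)\<^sup>2)" if "g \<in> A n" for g n
    by (rule Bochner_Integration.integrable_bound[OF Ei])
       (use AD(1)[OF that] Asq[OF that] in \<open>auto intro!: AE_I2\<close>)
  have "A n \<noteq> {}" for n
  proof -
    let ?e = "inverse (real (Suc n))"
    obtain S where S[measurable]: "S \<in> sets borel" and SE: "S \<subseteq> E" and Spos: "0 < measure lborel S"
      and P: "perimeter S \<le> ereal ((lam + ?e) * measure lborel S)"
      using upper[of ?e] by auto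
    have Sle: "measure lborel S \<le> c"
      unfolding c_def using SE Efin by (intro measure_mono_fmeasurable) (auto simp: fmeasurable_def)
    have "m \<le> measure lborel S"
    proof (rule ccontr)
      assume "\<not> m \<le> measure lborel S"
      then have small: "2 * measure lborel S < measure lborel (ball (0::'a) (1 / (2 * (lam + 1))))"
        by (simp add: m_def)
      have "?e \<le> 1" by (simp add: inverse_le_1_iff)
      then have "(lam + ?e) * measure lborel S \<le> (lam + 1) * measure lborel S"
        by (intro mult_right_mono) auto
      then have "perimeter S \<le> ereal ((lam + 1) * measure lborel S)"
        using P by (meson ereal_less_eq(3) order_trans)
      then have "measure lborel S \<le> 1 / (2 * (lam + 1)) * ((lam + 1) * measure lborel S)"
        using SE ER lam by (intro small_set_perimeter[OF S _ _ Spos _ small]) auto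
      also have "\<dots> = measure lborel S / 2" using lam by (simp add: field_simps)
      finally show False using Spos by simp
    qed
    moreover have "(\<integral>x. indicat_real S x * divergence (snd p) x \<partial>lborel) \<le> lam * measure lborel S + c * ?e"
      if "p \<in> test_fields" for p
    proof -
      have "(\<integral>x. indicat_real S x * divergence (snd p) x \<partial>lborel) \<le> (lam + ?e) * measure lborel S"
        using P that unfolding perimeter_def by (subst (asm) total_variation_le_iff) auto
      also have "\<dots> \<le> lam * measure lborel S + c * ?e"
        using Sle by (simp add: distrib_right mult.commute[of ?e] mult_right_mono)
      finally show ?thesis .
    qed
    ultimately have "indicat_real S \<in> A n"
      using SE by (auto simp: A_def indicator_def)
    then show ?thesis by blast
  qed
  moreover have "A j \<subseteq> A i" if "i \<le> j" for i j
  proof -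
    have "c * inverse (real (Suc j)) \<le> c * inverse (real (Suc i))"
      using that by (intro mult_left_mono le_imp_inverse_le) (auto simp: c_def)
    then show ?thesis unfolding A_def by (auto intro: order_trans)
  qed
  moreover have "(\<lambda>x. (f x + g x) / 2) \<in> A n" if f: "f \<in> A n" and g: "g \<in> A n" for n f g
  proof -
    note [measurable] = AD(1)[OF f] AD(1)[OF g]
    have int: "(\<integral>x. (f x + g x) / 2 \<partial>lborel) = (integral\<^sup>L lborel f + integral\<^sup>L lborel g) / 2"
      using Aint[OF f] Aint[OF g] by simp
    have "(\<integral>x. (f x + g x) / 2 * divergence (snd p) x \<partial>lborel)
      \<le> lam * (\<integral>x. (f x + g x) / 2 \<partial>lborel) + c * inverse (real (Suc n))" if p: "p \<in> test_fields" for p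
    proof -
      have "(\<integral>x. (f x + g x) / 2 * divergence (snd p) x \<partial>lborel)
        = (\<integral>x. (f x * divergence (snd p) x + g x * divergence (snd p) x) / 2 \<partial>lborel)"
        by (rule Bochner_Integration.integral_cong) (auto simp: field_simps)
      also have "\<dots> = ((\<integral>x. f x * divergence (snd p) x \<partial>lborel) + (\<integral>x. g x * divergence (snd p) x \<partial>lborel)) / 2"
        using integrable_mult_divergence[OF Aint[OF f] p] integrable_mult_divergence[OF Aint[OF g] p] by simp
      also have "\<dots> \<le> lam * ((integral\<^sup>L lborel f + integral\<^sup>L lborel g) / 2) + c * inverse (real (Suc n))"
        using AD(5)[OF f p] AD(5)[OF g p] by (simp add: distrib_left add_divide_distrib)
      finally show ?thesis unfolding int .
    qed
    moreover have "0 \<le> (f x + g x) / 2 \<and> (f x + g x) / 2 \<le> indicat_real E x" for x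
      using AD(2,3)[OF f, of x] AD(2,3)[OF g, of x] by simp
    moreover have "m \<le> (\<integral>x. (f x + g x) / 2 \<partial>lborel)"
    proof -
      have "m \<le> (y + z) / 2" if "m \<le> y" "m \<le> z" for y z :: real using that by simp
      from this[OF AD(4)[OF f] AD(4)[OF g]] show ?thesis unfolding int .
    qed
    ultimately show ?thesis unfolding A_def by simp
  qed
  moreover have "(\<integral>x. (f x)\<^sup>2 \<partial>lborel) \<le> c" if "f \<in> A n" for f n
  proof -
    have "(\<integral>x. (f x)\<^sup>2 \<partial>lborel) \<le> (\<integral>x. indicat_real E x \<partial>lborel)"
      by (rule integral_mono[OF Aint2[OF that] Ei Asq[OF that]])
    then show ?thesis by (simp add: c_def)
  qed
  ultimately obtain h where h: "\<And>n. h n \<in> A n"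
    and Ch: "\<And>e. 0 < e \<Longrightarrow> \<exists>N. \<forall>n\<ge>N. \<forall>m\<ge>N. (\<integral>x. (h n x - h m x)\<^sup>2 \<partial>lborel) \<le> e"
    using norm_minimizing_sequence_L2_Cauchy[of A lborel c] AD(1) Aint2 by force
  note [measurable] = AD(1)[OF h]
  obtain s :: "nat \<Rightarrow> nat" where s: "strict_mono s" and conv: "AE x in lborel. convergent (\<lambda>k. h (s k) x)"
    using L2_Cauchy_imp_AE_convergent_subseq[of lborel E h, OF Efin _ _ _ _ Ch] A1[OF h] AD(2)[OF h] by auto
  \<comment> \<open>Where the sequence diverges, \<open>lim\<close> is an arbitrary value; the
    truncation makes the bounds and the vanishing outside \<open>E\<close> hold everywhere and
    changes nothing where it converges.\<close>
  define g where "g x = max 0 (min (indicator E x) (lim (\<lambda>k. h (s k) x)))" for x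
  have gm[measurable]: "g \<in> borel_measurable borel"
    unfolding g_def[abs_def] by measurable
  have g0: "0 \<le> g x" and gE: "g x \<le> indicator E x" for x by (auto simp: g_def)
  have glim: "AE x in lborel. (\<lambda>k. h (s k) x) \<longlonglongrightarrow> g x"
    using conv
  proof eventually_elim
    case (elim x)
    then have L: "(\<lambda>k. h (s k) x) \<longlonglongrightarrow> lim (\<lambda>k. h (s k) x)" by (simp add: convergent_LIMSEQ_iff)
    have "0 \<le> lim (\<lambda>k. h (s k) x)" by (rule LIMSEQ_le_const[OF L]) (use AD(2)[OF h] in auto)
    moreover have "lim (\<lambda>k. h (s k) x) \<le> indicator E x" by (rule LIMSEQ_le_const2[OF L]) (use AD(3)[OF h] in auto)
    ultimately show ?case using L by (simp add: g_def)
  qed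
  have gi: "integrable lborel g"
    by (rule Bochner_Integration.integrable_bound[OF Ei]) (use g0 gE in \<open>auto intro!: AE_I2\<close>)
  have hle: "\<bar>h n x\<bar> \<le> indicat_real E x" for n x using AD(2,3)[OF h, of n x] by simp
  have Ilim: "(\<lambda>k. integral\<^sup>L lborel (h (s k))) \<longlonglongrightarrow> integral\<^sup>L lborel g"
    by (rule integral_dominated_convergence[where w="indicat_real E"]) (use Ei glim hle in auto)
  have gmge: "m \<le> integral\<^sup>L lborel g"
    by (rule LIMSEQ_le_const[OF Ilim]) (use AD(4)[OF h] in auto)
  have TVle: "total_variation g \<le> ereal (lam * integral\<^sup>L lborel g)"
    unfolding total_variation_le_iff[OF gm]
  proof
    fix p :: "('a \<Rightarrow> 'a) \<times> ('a \<Rightarrow> 'a \<Rightarrow>\<^sub>L 'a)" assume p: "p \<in> test_fields"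
    have [measurable]: "divergence (snd p) \<in> borel_measurable borel"
      by (rule test_fieldE[OF p], assumption)
    have Dlim: "(\<lambda>k. \<integral>x. h (s k) x * divergence (snd p) x \<partial>lborel) \<longlonglongrightarrow> (\<integral>x. g x * divergence (snd p) x \<partial>lborel)"
    proof (rule integral_dominated_convergence[where w="\<lambda>x. \<bar>indicat_real E x * divergence (snd p) x\<bar>"])
      show "integrable lborel (\<lambda>x. \<bar>indicat_real E x * divergence (snd p) x\<bar>)"
        by (rule integrable_abs[OF integrable_mult_divergence[OF Ei p]])
      show "AE x in lborel. (\<lambda>k. h (s k) x * divergence (snd p) x) \<longlonglongrightarrow> g x * divergence (snd p) x"
        using glim by eventually_elim (intro tendsto_intros)
      show "AE x in lborel. norm (h (s k) x * divergence (snd p) x) \<le> \<bar>indicat_real E x * divergence (snd p) x\<bar>" for k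
        using hle by (intro AE_I2) (simp add: abs_mult mult_right_mono)
    qed measurable
    have "(\<lambda>k. inverse (real (Suc (s k)))) \<longlonglongrightarrow> 0"
      using LIMSEQ_subseq_LIMSEQ[OF LIMSEQ_inverse_real_of_nat s] by (simp add: o_def)
    then have "(\<lambda>k. lam * integral\<^sup>L lborel (h (s k)) + c * inverse (real (Suc (s k))))
        \<longlonglongrightarrow> lam * integral\<^sup>L lborel g + c * 0"
      by (intro tendsto_intros Ilim)
    from LIMSEQ_le[OF Dlim this] show "(\<integral>x. g x * divergence (snd p) x \<partial>lborel) \<le> lam * integral\<^sup>L lborel g"
      using AD(5)[OF h p] by auto
  qed
  obtain T where T: "total_variation g = ereal T"
    using TVle total_variation_nonneg[of g] by (cases "total_variation g") auto
  \<comment> \<open>The reverse inequality. Superlevel sets at \<open>t \<ge> 0\<close> lie inside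
    \<open>E\<close>, so \<open>lower\<close> applies to them unless they are null, in which case
    the bound reads \<open>0 \<le> perimeter\<close>.\<close>
  have "lam * integral\<^sup>L lborel g \<le> T"
  proof (rule superlevel_perimeter_le_total_variation[where R=R, OF gi g0 _ _ lam])
    show "g x = 0" if "R \<le> norm x" for x
    proof -
      have "x \<notin> E" using ER that by auto
      then show ?thesis using g0[of x] gE[of x] by simp
    qed
    show "total_variation g \<le> ereal T" by (simp add: T)
    fix t :: real assume t: "0 \<le> t"
    have sub: "{x. t < g x} \<subseteq> E"
    proof
      fix x assume "x \<in> {x. t < g x}"
      then show "x \<in> E" using gE[of x] t by (cases "x \<in> E") auto
    qed
    show "ereal (lam * measure lborel {x. t < g x}) \<le> perimeter {x. t < g x}"
    proof (cases "0 < measure lborel {x. t < g x}")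
      case True
      show ?thesis by (rule lower[OF _ sub True]) measurable
    next
      case False
      then have "measure lborel {x. t < g x} = 0" by (simp add: not_less measure_le_0_iff)
      then show ?thesis using total_variation_nonneg by (simp add: perimeter_def zero_ereal_def[symmetric])
    qed
  qed
  then have "total_variation g = ereal (lam * integral\<^sup>L lborel g)"
    using TVle T by simp
  then show thesis
    using that[of g] gm g0 gE gi m gmge
    by (metis indicator_simps(2) order_antisym order_less_le_trans)
qed

section \<open>Comparison of the two problems\<close>

text \<open>The approximation is from inside, so that whatever is supported in \<open>B\<close>
  vanishes outside \<open>S\<close> at every point.\<close>

lemma lebesgue_borel_part:
  assumes "S \<in> sets lebesgue"
  obtains B where "B \<in> sets borel" "B \<subseteq> S" "S - B \<in> null_sets lebesgue"
proof -
  obtain C N where CN: "fsigma C" "N \<in> null_sets lebesgue" "C \<union> N = S" "disjnt C N"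
    by (rule lebesgue_set_almost_fsigma[OF assms])
  have "C \<in> sets borel" using CN(1) by cases auto
  moreover have "S - C = N" using CN(3,4) by (auto simp: disjnt_def)
  ultimately show thesis
    using that[of C] CN(2,3) by auto
qed

lemma perimeter_cong_AE:
  assumes "A \<in> sets lebesgue" "B \<in> sets lebesgue" "AE x in lebesgue. x \<in> A \<longleftrightarrow> x \<in> B"
  shows "perimeter A = perimeter B"
  unfolding perimeter_def
proof (rule total_variation_cong_AE)
  show "AE x in lebesgue. indicat_real A x = indicator B x"
    using assms(3) by eventually_elim (simp add: indicator_def)
qed (use assms in auto)

lemma cheeger_nonneg: "0 \<le> cheeger F"
  unfolding cheeger_def
proof (rule INF_greatest)
  fix E :: "'a set" assume "E \<in> {E. E \<in> sets lebesgue \<and> E - F \<in> null_sets lebesgue \<and> 0 < emeasure lebesgue E}"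
  have "0 \<le> perimeter E" unfolding perimeter_def by (rule total_variation_nonneg)
  then show "0 \<le> perimeter E / enn2ereal (emeasure lebesgue E)"
    by (rule zero_le_divide_ereal) (rule enn2ereal_nonneg)
qed

text \<open>Stated for a real lower bound \<open>l\<close>, so that it also serves when the Cheeger
  constant is not yet known to be finite.\<close>

lemma cheeger_mult_measure_le_perimeter:
  assumes S: "S \<in> sets borel" "S - F \<in> null_sets lebesgue" "0 < measure lborel S"
    and l: "ereal l \<le> cheeger F"
  shows "ereal (l * measure lborel S) \<le> perimeter S"
proof -
  \<comment> \<open>\<open>measure\<close> is 0 on sets of infinite measure, so a positive value
    already entails finiteness.\<close>
  have em: "emeasure lebesgue S = ennreal (measure lborel S)"
    using S(1,3) by (simp add: measure_def enn2real_positive_iff)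
  have "ereal l \<le> perimeter S / enn2ereal (emeasure lebesgue S)"
  proof (rule order_trans[OF l])
    have "0 < emeasure lebesgue S" using em S(3) by (simp add: ennreal_less_zero_iff)
    then show "cheeger F \<le> perimeter S / enn2ereal (emeasure lebesgue S)"
      unfolding cheeger_def using S(1,2) by (intro INF_lower) simp
  qed
  also have "enn2ereal (emeasure lebesgue S) = ereal (measure lborel S)"
    by (simp add: em enn2ereal_ennreal)
  finally show ?thesis
    using S(3) by (simp add: ereal_le_divide_pos mult.commute)
qed

text \<open>Every superlevel set at \<open>t \<ge> 0\<close> is a competitor for
  \<open>{x. 0 < u x}\<close> or a null set. So any real \<open>l\<close> below the Cheeger constant
  bounds perimeter over measure on all levels, and the coarea inequality with unit mass yields
  \<open>l \<le> T\<close>.\<close>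

lemma superlevel_cheeger_le_total_variation:
  fixes u :: "'a::euclidean_space \<Rightarrow> real"
  assumes u: "u \<in> BV0 \<Omega>" and \<Omega>: "\<Omega> \<in> sets borel" "\<Omega> \<subseteq> ball 0 R" and u0: "AE x in lebesgue. 0 \<le> u x"
    and u1: "integral\<^sup>L lebesgue (\<lambda>x. \<bar>u x\<bar>) = 1"
  shows "cheeger {x. 0 < u x} \<le> total_variation u"
proof -
  have ui: "integrable lebesgue u" and uTV: "total_variation u < \<infinity>"
    and uO: "AE x in lebesgue. x \<notin> \<Omega> \<longrightarrow> u x = 0"
    using u by (auto simp: BV0_def BV_def)
  obtain T where T: "total_variation u = ereal T"
    using uTV total_variation_nonneg[of u] by (cases "total_variation u") auto
  obtain u' where u'[measurable]: "u' \<in> borel_measurable lborel" and eq': "AE x in lborel. u x = u' x"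
    using completion_ex_borel_measurable_real[of u lborel] ui by auto
  \<comment> \<open>A Borel representative for which nonnegativity and vanishing outside
    \<open>\<Omega>\<close>, known for \<open>u\<close> almost everywhere, hold at every
    point.\<close>
  define v where "v x = indicator \<Omega> x * max 0 (u' x)" for x
  have vm[measurable]: "v \<in> borel_measurable borel" unfolding v_def[abs_def] using u' \<Omega>(1) by simp
  have vu: "AE x in lebesgue. u x = v x"
    using AE_completion[OF eq'] u0 uO
    by eventually_elim (auto simp: v_def indicator_def)
  have TVv: "total_variation v = ereal T"
    unfolding T[symmetric]
    by (rule total_variation_cong_AE[symmetric]) (use ui vm vu in \<open>auto intro: measurable_completion\<close>)
  have v0: "0 \<le> v x" for x by (simp add: v_def)
  have vl: "integrable lebesgue v"
    using ui by (rule integrable_cong_AE_imp) (use vm vu in \<open>auto intro: measurable_completion elim: eventually_mono\<close>)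
  then have vi: "integrable lborel v"
    using integrable_completion[of v lborel] by simp
  have "(\<integral>x. v x \<partial>lborel) = (\<integral>x. v x \<partial>lebesgue)" by (rule integral_completion[symmetric]) simp
  also have "\<dots> = (\<integral>x. \<bar>u x\<bar> \<partial>lebesgue)"
  proof (rule integral_cong_AE)
    show "AE x in lebesgue. v x = \<bar>u x\<bar>" using vu by eventually_elim (simp add: v0)
  qed (use ui vl in auto)
  finally have v1: "integral\<^sup>L lborel v = 1" by (simp add: u1)
  have le: "l \<le> T" if l: "0 \<le> l" "ereal l \<le> cheeger {x. 0 < u x}" for l
  proof -
    have "l * integral\<^sup>L lborel v \<le> T"
    proof (rule superlevel_perimeter_le_total_variation[where R=R, OF vi v0 _ _ l(1)])
      show "v x = 0" if "R \<le> norm x" for x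
        using \<Omega>(2) that by (auto simp: v_def indicator_def)
      show "total_variation v \<le> ereal T" by (simp add: TVv)
      fix t :: real assume t: "0 \<le> t"
      have S: "{x. t < v x} \<in> sets borel" by measurable
      have sub: "{x. t < v x} - {x. 0 < u x} \<in> null_sets lebesgue"
      proof (rule AE_iff_null_sets[THEN iffD2])
        have "{x \<in> space lebesgue. 0 < u x} \<in> sets lebesgue" using ui by measurable
        moreover have "{x. t < v x} \<in> sets lebesgue" using S by simp
        ultimately show "{x. t < v x} - {x. 0 < u x} \<in> sets lebesgue" by (intro sets.Diff) simp_all
        show "AE x in lebesgue. x \<notin> {x. t < v x} - {x. 0 < u x}"
          using vu by eventually_elim (use t in auto)
      qed
      show "ereal (l * measure lborel {x. t < v x}) \<le> perimeter {x. t < v x}"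
      proof (cases "0 < measure lborel {x. t < v x}")
        case True
        then show ?thesis by (rule cheeger_mult_measure_le_perimeter[OF S sub _ l(2)])
      next
        case False
        then have "measure lborel {x. t < v x} = 0" by (simp add: not_less measure_le_0_iff)
        then show ?thesis using total_variation_nonneg by (simp add: perimeter_def zero_ereal_def[symmetric])
      qed
    qed
    then show ?thesis by (simp add: v1)
  qed
  show ?thesis
  proof (cases "cheeger {x. 0 < u x}")
    case (real l)
    then show ?thesis using le[of l] cheeger_nonneg[of "{x. 0 < u x}"] by (simp add: T)
  next
    case PInf
    have "0 \<le> T" using total_variation_nonneg[of u] by (simp add: T)
    \<comment> \<open>An infinite Cheeger constant would admit \<open>l = T + 1\<close>,
      contradicting \<open>l \<le> T\<close>.\<close>
    then show ?thesis using le[of "T + 1"] PInf by simp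
  next
    case MInf
    then show ?thesis by simp
  qed
qed

text \<open>Competitors are determined up to null sets, so replacing \<open>E\<close> by a Borel
  part inside \<open>E \<inter> \<Omega>\<close> and each competitor by a Borel part inside that one
  leaves the infimum unchanged. The function found there is divided by its mass.\<close>

lemma cheeger_minimizer_exists:
  fixes E :: "'a::euclidean_space set"
  assumes \<Omega>: "\<Omega> \<in> sets borel" "\<Omega> \<subseteq> ball 0 R" and E: "E \<in> sets lebesgue" "E - \<Omega> \<in> null_sets lebesgue"
    and fin: "cheeger E < \<infinity>"
  shows "\<exists>u. u \<in> BV0 \<Omega> \<and> (\<forall>x. 0 \<le> u x) \<and> (\<forall>x. x \<notin> E \<longrightarrow> u x = 0) \<and> integral\<^sup>L lebesgue (\<lambda>x. \<bar>u x\<bar>) = 1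
    \<and> total_variation u = cheeger E"
proof -
  obtain l where l: "cheeger E = ereal l" "0 \<le> l"
    using fin cheeger_nonneg[of E] by (cases "cheeger E") auto
  have O: "\<Omega> \<in> sets lebesgue" using \<Omega>(1) by simp
  obtain B where B: "B \<in> sets borel" "B \<subseteq> E \<inter> \<Omega>" "E \<inter> \<Omega> - B \<in> null_sets lebesgue"
    by (rule lebesgue_borel_part[of "E \<inter> \<Omega>"]) (use E(1) O in auto)
  have EB: "E - B \<in> null_sets lebesgue"
  proof -
    have "E - B = (E - \<Omega>) \<union> (E \<inter> \<Omega> - B)" using B(2) by auto
    then show ?thesis using E(2) B(3) by auto
  qed
  obtain g where g: "g \<in> borel_measurable borel" "\<And>x. 0 \<le> g x" "\<And>x. x \<notin> B \<Longrightarrow> g x = 0"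
    "integrable lborel g" "0 < integral\<^sup>L lborel g" "total_variation g = ereal (l * integral\<^sup>L lborel g)"
  proof (rule cheeger_function_exists[of B R l])
    show "B \<in> sets borel" by (rule B(1))
    show "B \<subseteq> ball 0 R" using B(2) \<Omega>(2) by blast
    show "0 \<le> l" by (rule l(2))
    show "ereal (l * measure lborel S) \<le> perimeter S" if "S \<in> sets borel" "S \<subseteq> B" "0 < measure lborel S" for S
    proof -
      have "S - E = {}" using that(2) B(2) by auto
      then have "S - E \<in> null_sets lebesgue" by (simp only: null_sets.empty_sets)
      then show ?thesis
        using that l(1) by (intro cheeger_mult_measure_le_perimeter[of S E]) simp_all
    qed
    show "\<exists>S. S \<in> sets borel \<and> S \<subseteq> B \<and> 0 < measure lborel S \<and> perimeter S \<le> ereal ((l + e) * measure lborel S)"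
      if e: "0 < e" for e
    proof -
      have "cheeger E < ereal (l + e)" using e by (simp add: l)
      then obtain S0 where S0: "S0 \<in> sets lebesgue" "S0 - E \<in> null_sets lebesgue" "0 < emeasure lebesgue S0"
        "perimeter S0 / enn2ereal (emeasure lebesgue S0) < ereal (l + e)"
        unfolding cheeger_def INF_less_iff by auto
      obtain S where S: "S \<in> sets borel" "S \<subseteq> S0 \<inter> B" "S0 \<inter> B - S \<in> null_sets lebesgue"
        by (rule lebesgue_borel_part[of "S0 \<inter> B"]) (use S0(1) B(1) in auto)
      have Sl: "S \<in> sets lebesgue" using S(1) by simp
      have AE: "AE x in lebesgue. x \<in> S0 \<longleftrightarrow> x \<in> S"
        using AE_not_in[OF S0(2)] AE_not_in[OF EB] AE_not_in[OF S(3)]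
        by eventually_elim (use S(2) in auto)
      have em: "emeasure lebesgue S0 = emeasure lebesgue S"
        using AE S0(1) Sl by (rule emeasure_eq_AE)
      have "emeasure lborel S \<le> emeasure lborel (ball (0::'a) R)"
        using S(2) B(2) \<Omega>(2) by (intro emeasure_mono) auto
      then have "emeasure lborel S < \<infinity>"
        using emeasure_lborel_ball_finite[of "0::'a" R] by (rule order.strict_trans1)
      then have em': "emeasure lebesgue S = ennreal (measure lborel S)"
        using S(1) by (simp add: emeasure_eq_ennreal_measure)
      then have pos: "0 < measure lborel S" using S0(3) em by (simp add: ennreal_less_zero_iff)
      have "perimeter S / ereal (measure lborel S) < ereal (l + e)"
        using S0(4) perimeter_cong_AE[OF S0(1) Sl AE] em em' by (simp add: enn2ereal_ennreal)
      then have "perimeter S \<le> ereal ((l + e) * measure lborel S)"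
        using pos by (simp add: ereal_divide_less_pos mult.commute less_imp_le)
      then show ?thesis using S(1,2) pos by blast
    qed
  qed (rule that)
  define c where "c = integral\<^sup>L lborel g"
  have c: "0 < c" using g(5) by (simp add: c_def)
  define u where "u x = g x / c" for x
  have um: "u \<in> borel_measurable borel" using g(1) by (simp add: u_def[abs_def])
  have ui: "integrable lborel u" using g(4) by (simp add: u_def[abs_def])
  have intdiv: "(\<integral>x. u x * divergence (snd p) x \<partial>lborel) = (\<integral>x. g x * divergence (snd p) x \<partial>lborel) / c" for p :: "('a \<Rightarrow> 'a) \<times> ('a \<Rightarrow> 'a \<Rightarrow>\<^sub>L 'a)"
  proof -
    have "(\<integral>x. u x * divergence (snd p) x \<partial>lborel) = (\<integral>x. g x * divergence (snd p) x / c \<partial>lborel)"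
      by (simp add: u_def)
    then show ?thesis by simp
  qed
  have TVu: "total_variation u = ereal l"
  proof -
    \<comment> \<open>Homogeneity of total variation, expressed through all real upper bounds
      \<open>d\<close> so that it follows from the test field characterization; the bounds
      \<open>l\<close> and then the value itself pin down equality.\<close>
    have *: "total_variation u \<le> ereal d \<longleftrightarrow> l \<le> d" for d
    proof -
      have "total_variation u \<le> ereal d \<longleftrightarrow> total_variation g \<le> ereal (d * c)"
        unfolding total_variation_le_iff[OF um] total_variation_le_iff[OF g(1)] intdiv
        using c by (simp add: pos_divide_le_eq)
      then show ?thesis using c g(6) by (simp add: c_def)
    qed
    obtain d where d: "total_variation u = ereal d"
      using *[of l] total_variation_nonneg[of u] by (cases "total_variation u") auto
    show ?thesis using *[of l] *[of d] d by simp
  qed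
  have "u \<in> BV0 \<Omega>"
    unfolding BV0_def BV_def
  proof (intro CollectI conjI)
    show "integrable lebesgue u" using ui um integrable_completion[of u lborel] by simp
    show "total_variation u < \<infinity>" by (simp add: TVu)
    show "AE x in lebesgue. x \<notin> \<Omega> \<longrightarrow> u x = 0"
      using B(2) g(3) by (intro AE_I2) (auto simp: u_def)
  qed
  moreover have "\<forall>x. 0 \<le> u x" using g(2) c by (simp add: u_def)
  moreover have "\<forall>x. x \<notin> E \<longrightarrow> u x = 0" using g(3) B(2) by (auto simp: u_def)
  moreover have "integral\<^sup>L lebesgue (\<lambda>x. \<bar>u x\<bar>) = 1"
  proof -
    have "(\<lambda>x. \<bar>u x\<bar>) = u" using g(2) c by (simp add: u_def[abs_def] abs_of_nonneg)
    then have "integral\<^sup>L lebesgue (\<lambda>x. \<bar>u x\<bar>) = integral\<^sup>L lborel u"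
      using integral_completion[of u lborel] um by simp
    also have "\<dots> = 1" using c by (simp add: u_def[abs_def] c_def)
    finally show ?thesis .
  qed
  ultimately show ?thesis using TVu l(1) by auto
qed

section \<open>Existence of admissible functions\<close>

lemma C1_grad_total_variation_finite:
  fixes v :: "'a::euclidean_space \<Rightarrow> real"
  assumes v: "C1_grad v w" and supp: "\<And>x. R \<le> norm x \<Longrightarrow> w x = 0"
  shows "total_variation v < \<infinity>"
proof -
  have vm: "v \<in> borel_measurable borel" and [measurable]: "w \<in> borel_measurable borel"
    using C1_grad_measurable[OF v] by auto
  have wi: "integrable lborel w"
    by (rule continuous_vanishing_integrable[OF C1_grad_continuous(2)[OF v] supp])
  have "total_variation v \<le> ereal (\<integral>x. norm (w x) \<partial>lborel)"
    unfolding total_variation_le_iff[OF vm]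
  proof
    fix p :: "('a \<Rightarrow> 'a) \<times> ('a \<Rightarrow> 'a \<Rightarrow>\<^sub>L 'a)" assume p: "p \<in> test_fields"
    have "continuous_on UNIV (fst p)"
      using has_derivative_continuous[OF test_field_apply(1)[OF p]] by (simp add: continuous_on_eq_continuous_within)
    then have [measurable]: "fst p \<in> borel_measurable borel" by (rule borel_measurable_continuous_onI)
    have le: "\<bar>w x \<bullet> fst p x\<bar> \<le> norm (w x)" for x
    proof -
      have "\<bar>w x \<bullet> fst p x\<bar> \<le> norm (w x) * norm (fst p x)" by (rule Cauchy_Schwarz_ineq2)
      also have "\<dots> \<le> norm (w x) * 1" by (intro mult_left_mono test_field_apply(3)[OF p]) simp
      finally show ?thesis by simp
    qed
    have i: "integrable lborel (\<lambda>x. w x \<bullet> fst p x)"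
      by (rule Bochner_Integration.integrable_bound[OF integrable_norm[OF wi]]) (use le in \<open>auto intro!: AE_I2\<close>)
    have "(\<integral>x. v x * divergence (snd p) x \<partial>lborel) = (\<integral>x. - (w x \<bullet> fst p x) \<partial>lborel)"
      using integration_by_parts[OF v p] by simp
    also have "\<dots> \<le> (\<integral>x. norm (w x) \<partial>lborel)"
    proof (rule integral_mono)
      show "- (w x \<bullet> fst p x) \<le> norm (w x)" for x using le[of x] by linarith
    qed (use i wi in auto)
    finally show "(\<integral>x. v x * divergence (snd p) x \<partial>lborel) \<le> (\<integral>x. norm (w x) \<partial>lborel)" .
  qed
  then show ?thesis by (rule order.strict_trans1) simp
qed

lemma C1_grad_shift:
  assumes "C1_grad K G" shows "C1_grad (\<lambda>x. K (x - a)) (\<lambda>x. G (x - a))"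
  unfolding C1_grad_def
proof
  have "((\<lambda>x. K (x - a)) has_derivative (\<lambda>h. G (x - a) \<bullet> h)) (at x)" for x
  proof -
    have "((\<lambda>x. x - a) has_derivative (\<lambda>h. h)) (at x)" by (auto intro!: derivative_eq_intros)
    moreover have "(K has_derivative (\<lambda>h. G (x - a) \<bullet> h)) (at (x - a))"
      using assms by (simp add: C1_grad_def)
    ultimately show ?thesis by (rule has_derivative_compose)
  qed
  then show "\<forall>x. ((\<lambda>x. K (x - a)) has_derivative (\<lambda>h. G (x - a) \<bullet> h)) (at x)" by blast
  show "continuous_on UNIV (\<lambda>x. G (x - a))"
    by (rule continuous_on_compose2[OF C1_grad_continuous(2)[OF assms]]) (auto intro!: continuous_intros)
qed

lemma disjoint_balls_exist:
  fixes \<Omega> :: "'a::euclidean_space set"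
  assumes "\<Omega> \<noteq> {}" "open \<Omega>"
  obtains c :: "'n::finite \<Rightarrow> 'a" and d where "0 < d" "\<And>i. ball (c i) d \<subseteq> \<Omega>"
    "\<And>i j. i \<noteq> j \<Longrightarrow> ball (c i) d \<inter> ball (c j) d = {}"
proof -
  obtain a r where r: "0 < r" "ball a r \<subseteq> \<Omega>"
    using assms by (meson all_not_in_conv openE)
  obtain f :: "'n \<Rightarrow> nat" and N where fN: "f ` UNIV = {i. i < N}" and inj: "inj f"
    using finite_imp_inj_to_nat_seg[of "UNIV :: 'n set"] by auto
  obtain e :: 'a where e: "e \<in> Basis" using nonempty_Basis by blast
  \<comment> \<open>Centres are placed along one axis at spacing \<open>3 * d\<close>, more than the
    \<open>2 * d\<close> that disjointness requires. With at most \<open>N\<close> steps the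
    farthest ball stays within \<open>3 * d * N + d\<close>, which equals \<open>r\<close>.\<close>
  define d where "d = r / (3 * real N + 1)"
  have d: "0 < d" using r by (simp add: d_def add_nonneg_pos)
  define c where "c i = a + (3 * d * real (f i)) *\<^sub>R e" for i
  show thesis
  proof (rule that[of d c])
    show "ball (c i) d \<subseteq> \<Omega>" for i
    proof
      fix x assume "x \<in> ball (c i) d"
      then have "dist a x < dist a (c i) + d"
        using dist_triangle[of a x "c i"] by simp
      also have "dist a (c i) = 3 * d * real (f i)" using d e by (simp add: c_def dist_norm)
      also have "real (f i) \<le> real N" using fN by (metis (mono_tags) image_eqI iso_tuple_UNIV_I less_imp_le mem_Collect_eq of_nat_mono)
      finally have "dist a x < 3 * d * real N + d" using d by (simp add: mult_left_mono)
      also have "3 * d * real N + d = d * (3 * real N + 1)" by (simp add: algebra_simps)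
      also have "\<dots> = r" by (simp add: d_def add_nonneg_eq_0_iff)
      finally show "x \<in> \<Omega>" using r(2) by auto
    qed
    show "ball (c i) d \<inter> ball (c j) d = {}" if "i \<noteq> j" for i j
    proof (rule disjoint_ballI)
      have "f i \<noteq> f j" using inj that by (simp add: inj_eq)
      then have "1 \<le> \<bar>real (f i) - real (f j)\<bar>" by linarith
      then have "3 * d * 1 \<le> 3 * d * \<bar>real (f i) - real (f j)\<bar>" using d by (intro mult_left_mono) auto
      moreover have "dist (c i) (c j) = 3 * d * \<bar>real (f i) - real (f j)\<bar>"
      proof -
        have "c i - c j = (3 * d * (real (f i) - real (f j))) *\<^sub>R e"
          by (simp add: c_def algebra_simps)
        then show ?thesis using d e by (simp add: dist_norm abs_mult)
      qed
      ultimately show "d + d \<le> dist (c i) (c j)" using d by linarith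
    qed
  qed (rule d)
qed

text \<open>Guarantees that both infima are taken over nonempty sets of values, without which the
  real \<open>Inf\<close> carries no information. The witnesses are translates of one kernel, one
  for each of the disjoint balls.\<close>

lemma one_N_function_exists:
  fixes \<Omega> :: "'a::euclidean_space set"
  assumes "\<Omega> \<noteq> {}" "open \<Omega>" "\<Omega> \<subseteq> ball 0 R"
  shows "\<exists>u :: 'n::finite \<Rightarrow> 'a \<Rightarrow> real. one_N_function \<Omega> u"
proof -
  obtain c :: "'n \<Rightarrow> 'a" and d where d: "0 < d" and cO: "\<And>i. ball (c i) d \<subseteq> \<Omega>"
    and disj: "\<And>i j. i \<noteq> j \<Longrightarrow> ball (c i) d \<inter> ball (c j) d = {}"
    by (rule disjoint_balls_exist[OF assms(1,2)], rule that)
  obtain K :: "'a \<Rightarrow> real" and G where KG: "C1_grad K G" "\<And>z. 0 \<le> K z"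
      "\<And>z. K (- z) = K z" "\<And>z. G (- z) = - G z" "\<And>z. d \<le> norm z \<Longrightarrow> K z = 0" "\<And>z. d \<le> norm z \<Longrightarrow> G z = 0"
      "integrable lborel K" "integral\<^sup>L lborel K = 1"
    by (rule mollifier_exists[OF d, where 'a='a], rule that)
  have [measurable]: "K \<in> borel_measurable borel" using C1_grad_measurable[OF KG(1)] by simp
  define u where "u i x = K (x - c i)" for i x
  have um[measurable]: "u i \<in> borel_measurable borel" for i unfolding u_def[abs_def] by measurable
  have u0: "u i x = 0" "G (x - c i) = 0" if "x \<notin> ball (c i) d" for i x
    using that KG(5,6)[of "x - c i"] by (auto simp: u_def dist_norm norm_minus_commute)
  have out: "x \<notin> ball (c i) d" if "R \<le> norm x" for i x
  proof
    assume "x \<in> ball (c i) d"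
    then have "x \<in> ball 0 R" using cO assms(3) by blast
    then show False using that by simp
  qed
  have ui: "integrable lborel (u i)" for i
    unfolding u_def[abs_def] using integrable_lborel_plus[OF KG(7), of "- c i"] by simp
  have "u i \<in> BV0 \<Omega>" for i
    unfolding BV0_def BV_def
  proof (intro CollectI conjI)
    show "integrable lebesgue (u i)" using ui[of i] integrable_completion[of "u i" lborel] by simp
    show "total_variation (u i) < \<infinity>"
      unfolding u_def[abs_def]
      by (rule C1_grad_total_variation_finite[OF C1_grad_shift[OF KG(1)]]) (rule u0(2)[OF out])
    show "AE x in lebesgue. x \<notin> \<Omega> \<longrightarrow> u i x = 0"
      using cO u0 by (intro AE_I2) blast
  qed
  moreover have "integral\<^sup>L lebesgue (\<lambda>x. \<bar>u i x\<bar>) = 1" for i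
  proof -
    have "(\<lambda>x. \<bar>u i x\<bar>) = u i" using KG(2) by (simp add: u_def[abs_def] abs_of_nonneg)
    then have "integral\<^sup>L lebesgue (\<lambda>x. \<bar>u i x\<bar>) = integral\<^sup>L lborel (u i)"
      using integral_completion[of "u i" lborel] by simp
    also have "\<dots> = 1"
      unfolding u_def[abs_def] using integral_lborel_plus[of K "- c i"] KG(8) by simp
    finally show ?thesis .
  qed
  moreover have "u i x * u j x = 0" if "i \<noteq> j" for i j x
  proof -
    have "x \<notin> ball (c i) d \<or> x \<notin> ball (c j) d" using disj[OF that] by blast
    then show ?thesis using u0(1)[of x] by fastforce
  qed
  ultimately have "one_N_function \<Omega> u"
    using KG(2) by (simp add: one_N_function_def u_def)
  then show ?thesis by blast
qed

section \<open>Passage between N-sets and N-functions, and the comparison\<close>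

lemma tv_vec_nonneg: "0 \<le> tv_vec u $ i"
  by (simp add: tv_vec_def real_of_ereal_pos total_variation_nonneg)

lemma h_vec_nonneg: "0 \<le> h_vec E $ i"
  by (simp add: h_vec_def real_of_ereal_pos cheeger_nonneg)

text \<open>Cheeger functions are chosen separately for the sets; as each vanishes outside its own
  \<open>E i\<close>, two of them can overlap only in the null set
  \<open>E i \<inter> E j\<close>.\<close>

lemma N_set_to_one_N_function:
  fixes E :: "'n::finite \<Rightarrow> 'a::euclidean_space set"
  assumes \<Omega>: "\<Omega> \<in> sets borel" "\<Omega> \<subseteq> ball 0 R" and E: "N_set \<Omega> E" "\<forall>i. cheeger (E i) < \<infinity>"
  obtains u where "one_N_function \<Omega> u" "tv_vec u = h_vec E" "\<And>i. {x. 0 < u i x} - E i \<in> null_sets lebesgue"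
proof -
  have "\<forall>i. \<exists>u. u \<in> BV0 \<Omega> \<and> (\<forall>x. 0 \<le> u x) \<and> (\<forall>x. x \<notin> E i \<longrightarrow> u x = 0)
    \<and> integral\<^sup>L lebesgue (\<lambda>x. \<bar>u x\<bar>) = 1 \<and> total_variation u = cheeger (E i)"
    using E by (intro allI cheeger_minimizer_exists[OF \<Omega>]) (auto simp: N_set_def)
  from choice[OF this] obtain u where u: "\<And>i. u i \<in> BV0 \<Omega>" "\<And>i x. 0 \<le> u i x" "\<And>i x. x \<notin> E i \<Longrightarrow> u i x = 0"
    "\<And>i. integral\<^sup>L lebesgue (\<lambda>x. \<bar>u i x\<bar>) = 1" "\<And>i. total_variation (u i) = cheeger (E i)"
    by blast
  have "AE x in lebesgue. u i x * u j x = 0" if "i \<noteq> j" for i j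
  proof -
    have "E i \<inter> E j \<in> null_sets lebesgue" using E(1) that by (auto simp: N_set_def)
    from AE_not_in[OF this] show ?thesis by eventually_elim (use u(3) in auto)
  qed
  then have "one_N_function \<Omega> u" using u(1,2,4) by (simp add: one_N_function_def)
  moreover have "tv_vec u = h_vec E" by (simp add: tv_vec_def h_vec_def u(5))
  moreover have "{x. 0 < u i x} - E i \<in> null_sets lebesgue" for i
  proof -
    have "{x. 0 < u i x} - E i = {}" using u(3)[of _ i] by force
    then show ?thesis by (simp only: null_sets.empty_sets)
  qed
  ultimately show thesis by (rule that)
qed

text \<open>In this direction the vectors are merely ordered, since a function may have larger total
  variation than the Cheeger constant of its positivity set. This is where monotonicity of
  \<open>\<Phi>\<close> comes in.\<close>

lemma one_N_function_to_N_set: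
  fixes u :: "'n::finite \<Rightarrow> 'a::euclidean_space \<Rightarrow> real"
  assumes \<Omega>: "\<Omega> \<in> sets borel" "\<Omega> \<subseteq> ball 0 R" and u: "one_N_function \<Omega> u"
  shows "N_set \<Omega> (\<lambda>i. {x. 0 < u i x})" "cheeger {x. 0 < u i x} < \<infinity>"
    "h_vec (\<lambda>i. {x. 0 < u i x}) $ i \<le> tv_vec u $ i"
proof -
  have uB: "u i \<in> BV0 \<Omega>" and u0: "AE x in lebesgue. 0 \<le> u i x" and u1: "integral\<^sup>L lebesgue (\<lambda>x. \<bar>u i x\<bar>) = 1" for i
    using u by (auto simp: one_N_function_def)
  have ui: "integrable lebesgue (u i)" and fin: "total_variation (u i) < \<infinity>"
    and uO: "AE x in lebesgue. x \<notin> \<Omega> \<longrightarrow> u i x = 0" for i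
    using uB[of i] by (auto simp: BV0_def BV_def)
  have meas: "{x. 0 < u i x} \<in> sets lebesgue" for i
  proof -
    have "{x \<in> space lebesgue. 0 < u i x} \<in> sets lebesgue" using ui[of i] by measurable
    then show ?thesis by simp
  qed
  have Ol: "\<Omega> \<in> sets lebesgue" using \<Omega>(1) by simp
  show "N_set \<Omega> (\<lambda>i. {x. 0 < u i x})"
    unfolding N_set_def
  proof (intro conjI allI impI meas)
    show "{x. 0 < u i x} - \<Omega> \<in> null_sets lebesgue" for i
    proof (rule AE_iff_null_sets[THEN iffD2])
      show "{x. 0 < u i x} - \<Omega> \<in> sets lebesgue" using meas Ol by blast
      show "AE x in lebesgue. x \<notin> {x. 0 < u i x} - \<Omega>" using uO[of i] by eventually_elim auto
    qed
    show "0 < emeasure lebesgue {x. 0 < u i x}" for i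
    proof (rule ccontr)
      assume "\<not> 0 < emeasure lebesgue {x. 0 < u i x}"
      then have "{x. 0 < u i x} \<in> null_sets lebesgue" using meas[of i] by (simp add: null_sets_def)
      from AE_not_in[OF this] u0[of i] have "AE x in lebesgue. \<bar>u i x\<bar> = 0"
        by eventually_elim auto
      then have "integral\<^sup>L lebesgue (\<lambda>x. \<bar>u i x\<bar>) = 0" by (rule integral_eq_zero_AE)
      then show False using u1[of i] by simp
    qed
    show "{x. 0 < u i x} \<inter> {x. 0 < u j x} \<in> null_sets lebesgue" if "i \<noteq> j" for i j
    proof (rule AE_iff_null_sets[THEN iffD2])
      show "{x. 0 < u i x} \<inter> {x. 0 < u j x} \<in> sets lebesgue" using meas by blast
      have "AE x in lebesgue. u i x * u j x = 0" using u that by (simp add: one_N_function_def)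
      then show "AE x in lebesgue. x \<notin> {x. 0 < u i x} \<inter> {x. 0 < u j x}" by eventually_elim auto
    qed
  qed
  have le: "cheeger {x. 0 < u i x} \<le> total_variation (u i)"
    by (rule superlevel_cheeger_le_total_variation[OF uB \<Omega> u0 u1])
  then show "cheeger {x. 0 < u i x} < \<infinity>" using fin[of i] by (rule order.strict_trans1)
  show "h_vec (\<lambda>i. {x. 0 < u i x}) $ i \<le> tv_vec u $ i"
    unfolding h_vec_def tv_vec_def vec_lambda_beta
    by (rule real_of_ereal_positive_mono[OF cheeger_nonneg le]) (use fin[of i] in auto)
qed

theorem mainTheorem9:
  fixes \<Omega> :: "'a::euclidean_space set" and \<Phi> :: "real^'n::finite \<Rightarrow> real"
  assumes "\<Omega> \<noteq> {}" and "bounded \<Omega>" and "open \<Omega>"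
    and "\<forall>v. (\<forall>i. 0 \<le> v $ i) \<longrightarrow> 0 \<le> \<Phi> v"
  shows "L_eig \<Phi> \<Omega> \<ge> (Lambda_eig \<Phi> \<Omega> :: real)
    \<and> (Phi3 \<Phi> \<longrightarrow>
        L_eig \<Phi> \<Omega> = Lambda_eig \<Phi> \<Omega>
        \<and> (\<forall>u. eigen_N_function \<Phi> \<Omega> u \<longrightarrow> eigen_N_set \<Phi> \<Omega> (\<lambda>i. {x. u i x > 0}))
        \<and> (\<forall>E. eigen_N_set \<Phi> \<Omega> E \<longrightarrow>
              (\<exists>u. eigen_N_function \<Phi> \<Omega> u \<and> (\<forall>i. {x. u i x > 0} - E i \<in> null_sets lebesgue))))"
proof -
  obtain R where R: "\<Omega> \<subseteq> ball 0 R"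
    using bounded_subset_ballD[OF assms(2), of 0] by blast
  have \<Omega>: "\<Omega> \<in> sets borel" using assms(3) by simp
  define LS where "LS = {\<Phi> (h_vec E) | E :: 'n \<Rightarrow> 'a set. N_set \<Omega> E \<and> (\<forall>i. cheeger (E i) < \<infinity>)}"
  define FS where "FS = {\<Phi> (tv_vec u) | u :: 'n \<Rightarrow> 'a \<Rightarrow> real. one_N_function \<Omega> u}"
  have L: "L_eig \<Phi> \<Omega> = Inf LS" and F: "Lambda_eig \<Phi> \<Omega> = Inf FS"
    by (simp_all add: L_eig_def LS_def Lambda_eig_def FS_def)
  \<comment> \<open>Nonnegativity on the orthant supplies the lower bound that the real infima
    require.\<close>
  have "0 \<le> \<Phi> (h_vec E)" "0 \<le> \<Phi> (tv_vec u)" for E :: "'n \<Rightarrow> 'a set" and u :: "'n \<Rightarrow> 'a \<Rightarrow> real"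
    using assms(4) h_vec_nonneg[of E] tv_vec_nonneg[of u] by blast+
  then have bdL: "bdd_below LS" and bdF: "bdd_below FS"
    unfolding LS_def FS_def by (auto intro: bdd_belowI[of _ 0])
  note toset = one_N_function_to_N_set[OF \<Omega> R]
  have Lmem: "\<Phi> (h_vec (\<lambda>i. {x. 0 < u i x})) \<in> LS" if "one_N_function \<Omega> u" for u
    using toset(1,2)[OF that] unfolding LS_def by blast
  have neL: "LS \<noteq> {}"
    using one_N_function_exists[OF assms(1,3) R] Lmem by blast
  \<comment> \<open>Inclusion of the sets of values themselves: the vectors coincide, hence so do
    their images, whatever \<open>\<Phi>\<close> is.\<close>
  have sub: "LS \<subseteq> FS"
  proof
    fix y assume "y \<in> LS"
    then obtain E :: "'n \<Rightarrow> 'a set" where y: "y = \<Phi> (h_vec E)" and E: "N_set \<Omega> E" "\<forall>i. cheeger (E i) < \<infinity>"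
      unfolding LS_def by blast
    obtain u where u: "one_N_function \<Omega> u" "tv_vec u = h_vec E"
      by (rule N_set_to_one_N_function[OF \<Omega> R E])
    then have "y = \<Phi> (tv_vec u)" using y by simp
    then show "y \<in> FS" using u(1) unfolding FS_def by blast
  qed
  have ge: "Lambda_eig \<Phi> \<Omega> \<le> L_eig \<Phi> \<Omega>"
    unfolding L F by (rule cInf_superset_mono[OF neL bdF sub])
  have main: "L_eig \<Phi> \<Omega> = Lambda_eig \<Phi> \<Omega>
        \<and> (\<forall>u. eigen_N_function \<Phi> \<Omega> u \<longrightarrow> eigen_N_set \<Phi> \<Omega> (\<lambda>i. {x. u i x > 0}))
        \<and> (\<forall>E. eigen_N_set \<Phi> \<Omega> E \<longrightarrow>
              (\<exists>u. eigen_N_function \<Phi> \<Omega> u \<and> (\<forall>i. {x. u i x > 0} - E i \<in> null_sets lebesgue)))"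
    if P3: "Phi3 \<Phi>"
  proof -
    have le: "\<Phi> (h_vec (\<lambda>i. {x. 0 < u i x})) \<le> \<Phi> (tv_vec u)" if "one_N_function \<Omega> u" for u
      using P3 toset(3)[OF that] h_vec_nonneg unfolding Phi3_def by blast
    have "Inf LS \<le> y" if "y \<in> FS" for y
    proof -
      obtain u :: "'n \<Rightarrow> 'a \<Rightarrow> real" where u: "one_N_function \<Omega> u" "y = \<Phi> (tv_vec u)"
        using \<open>y \<in> FS\<close> unfolding FS_def by blast
      show ?thesis
        using cInf_lower[OF Lmem[OF u(1)] bdL] le[OF u(1)] u(2) by simp
    qed
    then have "Inf LS \<le> Inf FS" using neL sub by (intro cInf_greatest) auto
    then have eq: "L_eig \<Phi> \<Omega> = Lambda_eig \<Phi> \<Omega>" using ge L F by simp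
    moreover have "eigen_N_set \<Phi> \<Omega> (\<lambda>i. {x. u i x > 0})" if "eigen_N_function \<Phi> \<Omega> u" for u
    proof -
      have u: "one_N_function \<Omega> u" "\<Phi> (tv_vec u) = Lambda_eig \<Phi> \<Omega>"
        using that by (auto simp: eigen_N_function_def)
      \<comment> \<open>A chain that closes up: \<open>L_eig\<close> is at most this value, which is
        at most \<open>\<Phi> (tv_vec u)\<close>, and the latter is \<open>Lambda_eig\<close>, equal
        to \<open>L_eig\<close>.\<close>
      have "\<Phi> (h_vec (\<lambda>i. {x. 0 < u i x})) = L_eig \<Phi> \<Omega>"
        using cInf_lower[OF Lmem[OF u(1)] bdL] le[OF u(1)] u(2) eq L by simp
      then show ?thesis using toset(1,2)[OF u(1)] by (simp add: eigen_N_set_def)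
    qed
    moreover have "\<exists>u. eigen_N_function \<Phi> \<Omega> u \<and> (\<forall>i. {x. u i x > 0} - E i \<in> null_sets lebesgue)"
      if "eigen_N_set \<Phi> \<Omega> E" for E
    proof -
      have E: "N_set \<Omega> E" "\<forall>i. cheeger (E i) < \<infinity>" "\<Phi> (h_vec E) = L_eig \<Phi> \<Omega>"
        using that by (auto simp: eigen_N_set_def)
      obtain u where "one_N_function \<Omega> u" "tv_vec u = h_vec E" "\<And>i. {x. 0 < u i x} - E i \<in> null_sets lebesgue"
        by (rule N_set_to_one_N_function[OF \<Omega> R E(1,2)], rule that)
      then show ?thesis using E(3) eq by (auto simp: eigen_N_function_def)
    qed
    ultimately show ?thesis by blast
  qed
  show ?thesis using ge main by blast
qed

end
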